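(* $\mathsf{RCA}_0$ proves that $\mathsf{CL}_{\mathsf B1}$ implies $\mathsf{SC}$, where $\mathsf{CL}_{\mathsf B1}$ (Cousin's lemma for Baire 1 functions) is the statement that every Baire 1 gauge $\delta\colon[0,1]\to\mathbb R^+$ has a $\delta$-fine partition, and $\mathsf{SC}$ is the statement that every Cauchy sequence of real numbers in $[0,1]$ has a limit.
   Context: Everything takes place in second-order arithmetic (two-sorted language $0,1,+,\cdot,<,\in$). $\mathsf{RCA}_0$ is the standard base system: the basic axioms for $0,1,+,\cdot,<$, induction for $\Sigma^0_1$ formulas, and $\Delta^0_1$ comprehension. Rationals are coded by natural numbers. A real number is a sequence $(q_i)_{i\in\mathbb N}$ of rationals with $|q_m-q_n|\le 2^{-m}$ for all $m\le n$; $(q_i)=_{\mathbb R}(q_i')$ iff $|q_k-q_k'|\le 2^{-k+1}$ for all $k$; $(q_i)\le_{\mathbb R}(q'_i)$ iff $q_k\le q'_k+2^{-k+1}$ for all $k$. Basic intervals. $\mathcal B_{\mathbb R}$ is the set of pairs $(p,q)\in\mathbb Q^2$ with $p<q$, coding $V_{p,q}=(p,q)\subseteq\mathbb R$; $V_{p,q}\cap V_{p',q'}\neq\varnothing$ means $p<q'$ and $p'<q$; $V_{p,q}\subseteq V_{p',q'}$ means $p\ge p'$ and $q\le q'$; $\ell(V_{p,q})=q-p$. For $p,q\in\mathbb Q$ put $\overline p=\max\{p,0\}$, $\overline q=\min\{q,1\}$. $\mathcal B_{[0,1]}$ is the set of pairs $(p,q)\in\mathbb Q^2$ with $\overline p<\overline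 q$, coding $U_{p,q}=(p,q)\cap[0,1]$; a real $x$ is in $U_{p,q}$ if $x\in[0,1]$ and $p<x<q$; $U_{p',q'}\subseteq U_{p,q}$ means $(p<0\lor p\le p')\land(q>1\lor q\ge q')$. A (partial) continuous function $f\colon[0,1]\to\mathbb R$ is a set $f\subseteq\mathcal B_{[0,1]}\times\mathcal B_{\mathbb R}$ such that: (i) $(U,V),(U,V')\in f$ implies $V\cap V'\ne\varnothing$; (ii) $(U,V)\in f$ and $U'\subseteq U$ imply $(U',V)\in f$; (iii) $(U,V)\in f$ and $V\subseteq V'$ imply $(U,V')\in f$. A real $x\in[0,1]$ is in the domain of $f$ if for every $\varepsilon\in\mathbb Q^+$ there is $(U,V)\in f$ with $x\in U$ and $\ell(V)\le\varepsilon$; then $f(x)$ is the real $(q_n)$ where $q_n$ is the midpoint of the least $V$ witnessing this for $\varepsilon=2^{-n}$. $f$ is total if every $x\in[0,1]$ is in its domain. Baire functions. The Baire 0 functions are the total continuous functions. A Baire 1 function $f\colon[0,1]\to\mathbb R$ is a sequence $(f_n)_{n\in\mathbb N}$ of Baire 0 functions that is pointwise Cauchy: for each $x\in[0,1]$ and $\varepsilon\in\mathbb Q^+$, $|f_m(x)-f_n(x)|\le\varepsilon$ for all sufficiently large $m,n$ (the value $f(x)$ need not exist as a real). For $f=(f_n)$ Baire 1, $x\in[0,1]$ and $y\in\mathbb R$: $f(x)\ge y$ means that for every rational $q<y$, $f_m(x)>q$ for sufficiently large $m$; $f(x)\le y$ means that for every rational $q>y$, $f_m(x)<q$ for sufficiently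 large $m$; $f(x)>y$ means that $f(x)\le y$ is false; $f(x)<y$ means that $f(x)\ge y$ is false. A gauge is a function $\delta$ with $\delta(x)>0$ for all $x\in[0,1]$. A tagged partition of $[0,1]$ of size $\ell$ is a finite sequence of reals $P=\langle x_0,t_0,x_1,t_1,\dots,x_{\ell-1},t_{\ell-1},x_\ell\rangle$ with $0=x_0<x_1<\cdots<x_\ell=1$ and $x_j\le t_j\le x_{j+1}$ for all $j<\ell$. For a Baire 1 gauge $\delta=(\delta_m)_{m\in\mathbb N}$, $P$ is $\delta$-fine if for all $j<\ell$, $\delta(t_j)\ge t_j-x_j$ and $\delta(t_j)\ge x_{j+1}-t_j$, meaning that for every rational $q<t_j-x_j$, $\delta_m(t_j)>q$ for sufficiently large $m$, and for every rational $q<x_{j+1}-t_j$, $\delta_m(t_j)>q$ for sufficiently large $m$. *)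

theory Defs
  imports Main
begin

section \<open>The language of second-order arithmetic\<close>

text \<open>
  Number variables and set variables are de Bruijn indices in two separate index spaces:
  \<open>Var i\<close> is the \<open>i\<close>-th number variable, and the second argument of \<open>In\<close> is a set variable.
  \<open>AllN\<close> binds number variable 0, \<open>AllS\<close> binds set variable 0. Equality is primitive for numbers only.
\<close>

datatype tm = Var nat | Zero | One | Add tm tm | Mul tm tm

datatype fm =
    Bot
  | Eq tm tm
  | Less tm tm
  | In tm nat
  | Imp fm fm
  | AllN fm
  | AllS fm

definition Neg :: "fm \<Rightarrow> fm" where "Neg \<phi> = Imp \<phi> Bot"
definition And :: "fm \<Rightarrow> fm \<Rightarrow> fm" where "And \<phi> \<psi> = Neg (Imp \<phi> (Neg \<psi>))"
definition Or :: "fm \<Rightarrow> fm \<Rightarrow> fm" where "Or \<phi> \<psi> = Imp (Neg \<phi>) \<psi>"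
definition Iff :: "fm \<Rightarrow> fm \<Rightarrow> fm" where "Iff \<phi> \<psi> = And (Imp \<phi> \<psi>) (Imp \<psi> \<phi>)"
definition ExN :: "fm \<Rightarrow> fm" where "ExN \<phi> = Neg (AllN (Neg \<phi>))"
definition ExS :: "fm \<Rightarrow> fm" where "ExS \<phi> = Neg (AllS (Neg \<phi>))"

subsection \<open>Substitution\<close>

primrec sub_tm :: "(nat \<Rightarrow> tm) \<Rightarrow> tm \<Rightarrow> tm" where
  "sub_tm \<sigma> (Var i) = \<sigma> i"
| "sub_tm \<sigma> Zero = Zero"
| "sub_tm \<sigma> One = One"
| "sub_tm \<sigma> (Add s t) = Add (sub_tm \<sigma> s) (sub_tm \<sigma> t)"
| "sub_tm \<sigma> (Mul s t) = Mul (sub_tm \<sigma> s) (sub_tm \<sigma> t)"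

definition lift_tm :: "tm \<Rightarrow> tm" where "lift_tm = sub_tm (\<lambda>i. Var (Suc i))"

text \<open>Set variables are the only set terms, so set substitutions are renamings.\<close>

primrec sub :: "(nat \<Rightarrow> tm) \<Rightarrow> (nat \<Rightarrow> nat) \<Rightarrow> fm \<Rightarrow> fm" where
  "sub \<sigma> \<rho> Bot = Bot"
| "sub \<sigma> \<rho> (Eq s t) = Eq (sub_tm \<sigma> s) (sub_tm \<sigma> t)"
| "sub \<sigma> \<rho> (Less s t) = Less (sub_tm \<sigma> s) (sub_tm \<sigma> t)"
| "sub \<sigma> \<rho> (In t X) = In (sub_tm \<sigma> t) (\<rho> X)"
| "sub \<sigma> \<rho> (Imp \<phi> \<psi>) = Imp (sub \<sigma> \<rho> \<phi>) (sub \<sigma> \<rho> \<psi>)"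
| "sub \<sigma> \<rho> (AllN \<phi>) = AllN (sub (case_nat (Var 0) (\<lambda>i. lift_tm (\<sigma> i))) \<rho> \<phi>)"
| "sub \<sigma> \<rho> (AllS \<phi>) = AllS (sub \<sigma> (case_nat 0 (\<lambda>i. Suc (\<rho> i))) \<phi>)"

definition lift_N :: "fm \<Rightarrow> fm" where "lift_N = sub (\<lambda>i. Var (Suc i)) id"
definition lift_S :: "fm \<Rightarrow> fm" where "lift_S = sub Var Suc"
definition inst_N :: "tm \<Rightarrow> fm \<Rightarrow> fm" where "inst_N t = sub (case_nat t Var) id"
definition inst_S :: "nat \<Rightarrow> fm \<Rightarrow> fm" where "inst_S X = sub Var (case_nat X id)"

subsection \<open>Provability\<close>

text \<open>Classical two-sorted natural deduction; \<open>provable \<Gamma> \<phi>\<close> says that \<open>\<phi>\<close> is derivable from \<open>\<Gamma>\<close>.\<close>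

inductive provable :: "fm set \<Rightarrow> fm \<Rightarrow> bool" where
  Assm: "\<phi> \<in> \<Gamma> \<Longrightarrow> provable \<Gamma> \<phi>"
| ImpI: "provable (insert \<phi> \<Gamma>) \<psi> \<Longrightarrow> provable \<Gamma> (Imp \<phi> \<psi>)"
| ImpE: "provable \<Gamma> (Imp \<phi> \<psi>) \<Longrightarrow> provable \<Gamma> \<phi> \<Longrightarrow> provable \<Gamma> \<psi>"
| RAA: "provable (insert (Neg \<phi>) \<Gamma>) Bot \<Longrightarrow> provable \<Gamma> \<phi>"
| AllN_I: "provable (lift_N ` \<Gamma>) \<phi> \<Longrightarrow> provable \<Gamma> (AllN \<phi>)"
| AllN_E: "provable \<Gamma> (AllN \<phi>) \<Longrightarrow> provable \<Gamma> (inst_N t \<phi>)"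
| AllS_I: "provable (lift_S ` \<Gamma>) \<phi> \<Longrightarrow> provable \<Gamma> (AllS \<phi>)"
| AllS_E: "provable \<Gamma> (AllS \<phi>) \<Longrightarrow> provable \<Gamma> (inst_S X \<phi>)"
| Eq_refl: "provable \<Gamma> (Eq t t)"
| Eq_subst: "provable \<Gamma> (Eq s t) \<Longrightarrow> provable \<Gamma> (inst_N s \<phi>) \<Longrightarrow> provable \<Gamma> (inst_N t \<phi>)"

section \<open>Writing formulas with HOL binders\<close>

text \<open>
  To write concrete formulas with named bound variables, a number term is represented by a
  function of the number of enclosing \<open>AllN\<close> binders, a set variable by a function of the number
  of enclosing \<open>AllS\<close> binders, and a formula by a function of both. A variable bound at depth
  \<open>d\<close> has index \<open>d' - Suc d\<close> when it is used at depth \<open>d'\<close>.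
\<close>

type_synonym num_e = "nat \<Rightarrow> tm"
type_synonym set_e = "nat \<Rightarrow> nat"
type_synonym fm_e = "nat \<Rightarrow> nat \<Rightarrow> fm"

definition sentence :: "fm_e \<Rightarrow> fm" where "sentence A = A 0 0"

definition zero_e :: num_e ("\<zero>") where "\<zero> = (\<lambda>d. Zero)"
definition one_e :: num_e ("\<one>") where "\<one> = (\<lambda>d. One)"
definition add_e :: "num_e \<Rightarrow> num_e \<Rightarrow> num_e" (infixl "\<oplus>" 65) where
  "s \<oplus> t = (\<lambda>d. Add (s d) (t d))"
definition mul_e :: "num_e \<Rightarrow> num_e \<Rightarrow> num_e" (infixl "\<otimes>" 70) where
  "s \<otimes> t = (\<lambda>d. Mul (s d) (t d))"

definition eq_e :: "num_e \<Rightarrow> num_e \<Rightarrow> fm_e" (infix "\<^bold>=" 50) where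
  "(s \<^bold>= t) = (\<lambda>d e. Eq (s d) (t d))"
definition less_e :: "num_e \<Rightarrow> num_e \<Rightarrow> fm_e" (infix "\<^bold><" 50) where
  "(s \<^bold>< t) = (\<lambda>d e. Less (s d) (t d))"
definition in_e :: "num_e \<Rightarrow> set_e \<Rightarrow> fm_e" (infix "\<^bold>\<in>" 50) where
  "(t \<^bold>\<in> X) = (\<lambda>d e. In (t d) (X e))"
definition neg_e :: "fm_e \<Rightarrow> fm_e" ("\<^bold>\<not> _" [40] 40) where
  "(\<^bold>\<not> A) = (\<lambda>d e. Neg (A d e))"
definition and_e :: "fm_e \<Rightarrow> fm_e \<Rightarrow> fm_e" (infixr "\<^bold>\<and>" 35) where
  "(A \<^bold>\<and> B) = (\<lambda>d e. And (A d e) (B d e))"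
definition or_e :: "fm_e \<Rightarrow> fm_e \<Rightarrow> fm_e" (infixr "\<^bold>\<or>" 30) where
  "(A \<^bold>\<or> B) = (\<lambda>d e. Or (A d e) (B d e))"
definition imp_e :: "fm_e \<Rightarrow> fm_e \<Rightarrow> fm_e" (infixr "\<^bold>\<longrightarrow>" 25) where
  "(A \<^bold>\<longrightarrow> B) = (\<lambda>d e. Imp (A d e) (B d e))"
definition iff_e :: "fm_e \<Rightarrow> fm_e \<Rightarrow> fm_e" (infixr "\<^bold>\<longleftrightarrow>" 25) where
  "(A \<^bold>\<longleftrightarrow> B) = (\<lambda>d e. Iff (A d e) (B d e))"

definition allN_e :: "(num_e \<Rightarrow> fm_e) \<Rightarrow> fm_e" (binder "\<forall>\<^sub>N" 10) where
  "allN_e B = (\<lambda>d e. AllN (B (\<lambda>d'. Var (d' - Suc d)) (Suc d) e))"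
definition exN_e :: "(num_e \<Rightarrow> fm_e) \<Rightarrow> fm_e" (binder "\<exists>\<^sub>N" 10) where
  "exN_e B = (\<lambda>d e. ExN (B (\<lambda>d'. Var (d' - Suc d)) (Suc d) e))"
definition allS_e :: "(set_e \<Rightarrow> fm_e) \<Rightarrow> fm_e" (binder "\<forall>\<^sub>S" 10) where
  "allS_e B = (\<lambda>d e. AllS (B (\<lambda>e'. e' - Suc e) d (Suc e)))"
definition exS_e :: "(set_e \<Rightarrow> fm_e) \<Rightarrow> fm_e" (binder "\<exists>\<^sub>S" 10) where
  "exS_e B = (\<lambda>d e. ExS (B (\<lambda>e'. e' - Suc e) d (Suc e)))"

definition le_e :: "num_e \<Rightarrow> num_e \<Rightarrow> fm_e" (infix "\<^bold>\<le>" 50) where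
  "(s \<^bold>\<le> t) = (s \<^bold>< t \<^bold>\<or> s \<^bold>= t)"

section \<open>The axioms of RCA\<open>\<^sub>0\<close>\<close>

definition basic_axioms :: "fm set" where
  "basic_axioms = sentence `
    { \<forall>\<^sub>N n. \<^bold>\<not> (n \<oplus> \<one> \<^bold>= \<zero>),
      \<forall>\<^sub>N m n. m \<oplus> \<one> \<^bold>= n \<oplus> \<one> \<^bold>\<longrightarrow> m \<^bold>= n,
      \<forall>\<^sub>N m. m \<oplus> \<zero> \<^bold>= m,
      \<forall>\<^sub>N m n. m \<oplus> (n \<oplus> \<one>) \<^bold>= (m \<oplus> n) \<oplus> \<one>,
      \<forall>\<^sub>N m. m \<otimes> \<zero> \<^bold>= \<zero>,
      \<forall>\<^sub>N m n. m \<otimes> (n \<oplus> \<one>) \<^bold>= m \<otimes> n \<oplus> m,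
      \<forall>\<^sub>N m. \<^bold>\<not> (m \<^bold>< \<zero>),
      \<forall>\<^sub>N m n. m \<^bold>< n \<oplus> \<one> \<^bold>\<longleftrightarrow> (m \<^bold>< n \<^bold>\<or> m \<^bold>= n) }"

inductive bounded_fm :: "fm \<Rightarrow> bool" where
  "bounded_fm Bot"
| "bounded_fm (Eq s t)"
| "bounded_fm (Less s t)"
| "bounded_fm (In t X)"
| "bounded_fm \<phi> \<Longrightarrow> bounded_fm \<psi> \<Longrightarrow> bounded_fm (Imp \<phi> \<psi>)"
| "bounded_fm \<phi> \<Longrightarrow> bounded_fm (AllN (Imp (Less (Var 0) (lift_tm t)) \<phi>))"
| "bounded_fm \<phi> \<Longrightarrow> bounded_fm (ExN (And (Less (Var 0) (lift_tm t)) \<phi>))"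

definition is_Sigma1 :: "fm \<Rightarrow> bool" where
  "is_Sigma1 \<phi> \<longleftrightarrow> (\<exists>\<theta>. bounded_fm \<theta> \<and> \<phi> = ExN \<theta>)"
definition is_Pi1 :: "fm \<Rightarrow> bool" where
  "is_Pi1 \<phi> \<longleftrightarrow> (\<exists>\<theta>. bounded_fm \<theta> \<and> \<phi> = AllN \<theta>)"

text \<open>In both schemes number variable 0 of \<open>\<phi>\<close> and \<open>\<psi>\<close> is the distinguished variable \<open>n\<close>.\<close>

definition induction_ax :: "fm \<Rightarrow> fm" where
  "induction_ax \<phi> =
    Imp (And (inst_N Zero \<phi>)
             (AllN (Imp \<phi> (sub (case_nat (Add (Var 0) One) (\<lambda>i. Var (Suc i))) id \<phi>))))
        (AllN \<phi>)"

definition comprehension_ax :: "fm \<Rightarrow> fm \<Rightarrow> fm" where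
  "comprehension_ax \<phi> \<psi> =
    Imp (AllN (Iff \<phi> \<psi>)) (ExS (AllN (Iff (In (Var 0) 0) (lift_S \<phi>))))"

primrec tm_below :: "nat \<Rightarrow> tm \<Rightarrow> bool" where
  "tm_below n (Var i) \<longleftrightarrow> i < n"
| "tm_below n Zero \<longleftrightarrow> True"
| "tm_below n One \<longleftrightarrow> True"
| "tm_below n (Add s t) \<longleftrightarrow> tm_below n s \<and> tm_below n t"
| "tm_below n (Mul s t) \<longleftrightarrow> tm_below n s \<and> tm_below n t"

text \<open>\<open>fm_below n m \<phi>\<close>: free number variables are below \<open>n\<close>, free set variables below \<open>m\<close>.\<close>

primrec fm_below :: "nat \<Rightarrow> nat \<Rightarrow> fm \<Rightarrow> bool" where
  "fm_below n m Bot \<longleftrightarrow> True"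
| "fm_below n m (Eq s t) \<longleftrightarrow> tm_below n s \<and> tm_below n t"
| "fm_below n m (Less s t) \<longleftrightarrow> tm_below n s \<and> tm_below n t"
| "fm_below n m (In t X) \<longleftrightarrow> tm_below n t \<and> X < m"
| "fm_below n m (Imp \<phi> \<psi>) \<longleftrightarrow> fm_below n m \<phi> \<and> fm_below n m \<psi>"
| "fm_below n m (AllN \<phi>) \<longleftrightarrow> fm_below (Suc n) m \<phi>"
| "fm_below n m (AllS \<phi>) \<longleftrightarrow> fm_below n (Suc m) \<phi>"

definition universal_closures :: "fm set \<Rightarrow> fm set" where
  "universal_closures A = {(AllS ^^ m) ((AllN ^^ n) \<phi>) | m n \<phi>. \<phi> \<in> A \<and> fm_below n m \<phi>}"

definition RCA0 :: "fm set" where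
  "RCA0 = basic_axioms
     \<union> universal_closures {induction_ax \<phi> | \<phi>. is_Sigma1 \<phi>}
     \<union> universal_closures {comprehension_ax \<phi> \<psi> | \<phi> \<psi>. is_Sigma1 \<phi> \<and> is_Pi1 \<psi>}"

section \<open>Numbers, rationals and basic intervals\<close>

definition pair :: "num_e \<Rightarrow> num_e \<Rightarrow> num_e" where
  "pair s t = (s \<oplus> t) \<otimes> (s \<oplus> t) \<oplus> s"

definition pow2 :: "num_e \<Rightarrow> num_e \<Rightarrow> fm_e" where
  \<comment> \<open>\<open>m = 2\<^sup>k\<close>, through the set-coded function defined by primitive recursion\<close>
  "pow2 k m = (\<exists>\<^sub>S F.
      (\<forall>\<^sub>N n. n \<^bold>\<in> F \<^bold>\<longrightarrow> (\<exists>\<^sub>N i j. n \<^bold>= pair i j)) \<^bold>\<and>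
      (\<forall>\<^sub>N i. \<exists>\<^sub>N j. pair i j \<^bold>\<in> F \<^bold>\<and> (\<forall>\<^sub>N j'. pair i j' \<^bold>\<in> F \<^bold>\<longrightarrow> j' \<^bold>= j)) \<^bold>\<and>
      pair \<zero> \<one> \<^bold>\<in> F \<^bold>\<and>
      (\<forall>\<^sub>N i j. pair i j \<^bold>\<in> F \<^bold>\<longrightarrow> pair (i \<oplus> \<one>) (j \<oplus> j) \<^bold>\<in> F) \<^bold>\<and>
      pair k m \<^bold>\<in> F)"

text \<open>
  The triple \<open>(a, b, c)\<close> stands for the rational \<open>(a - b) / (c + 1)\<close> and has code
  \<open>pair (pair a b) c\<close>. A rational has many codes, and a sequence of rationals is a function
  into codes. Order and arithmetic respect equality of values.
\<close>

type_synonym rat_e = "num_e \<times> num_e \<times> num_e"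

fun qcode :: "rat_e \<Rightarrow> num_e" where "qcode (a, b, c) = pair (pair a b) c"

definition allQ_e :: "(rat_e \<Rightarrow> fm_e) \<Rightarrow> fm_e" (binder "\<forall>\<^sub>Q" 10) where
  "allQ_e B = (\<forall>\<^sub>N a b c. B (a, b, c))"
definition exQ_e :: "(rat_e \<Rightarrow> fm_e) \<Rightarrow> fm_e" (binder "\<exists>\<^sub>Q" 10) where
  "exQ_e B = (\<exists>\<^sub>N a b c. B (a, b, c))"

definition qzero :: rat_e where "qzero = (\<zero>, \<zero>, \<zero>)"
definition qone :: rat_e where "qone = (\<one>, \<zero>, \<zero>)"
fun qadd :: "rat_e \<Rightarrow> rat_e \<Rightarrow> rat_e" (infixl "+\<^sub>Q" 65) where
  "(a, b, c) +\<^sub>Q (a', b', c') =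
    (a \<otimes> (c' \<oplus> \<one>) \<oplus> a' \<otimes> (c \<oplus> \<one>), b \<otimes> (c' \<oplus> \<one>) \<oplus> b' \<otimes> (c \<oplus> \<one>), c \<otimes> c' \<oplus> c \<oplus> c')"
fun qneg :: "rat_e \<Rightarrow> rat_e" where "qneg (a, b, c) = (b, a, c)"
definition qsub :: "rat_e \<Rightarrow> rat_e \<Rightarrow> rat_e" (infixl "-\<^sub>Q" 65) where "p -\<^sub>Q q = p +\<^sub>Q qneg q"
fun qhalf :: "rat_e \<Rightarrow> rat_e" where "qhalf (a, b, c) = (a, b, c \<oplus> c \<oplus> \<one>)"
fun qle :: "rat_e \<Rightarrow> rat_e \<Rightarrow> fm_e" (infix "\<le>\<^sub>Q" 50) where
  "(a, b, c) \<le>\<^sub>Q (a', b', c') =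
    (a \<otimes> (c' \<oplus> \<one>) \<oplus> b' \<otimes> (c \<oplus> \<one>) \<^bold>\<le> a' \<otimes> (c \<oplus> \<one>) \<oplus> b \<otimes> (c' \<oplus> \<one>))"
definition qless :: "rat_e \<Rightarrow> rat_e \<Rightarrow> fm_e" (infix "<\<^sub>Q" 50) where
  "(p <\<^sub>Q q) = (\<^bold>\<not> (q \<le>\<^sub>Q p))"

definition with_inv_pow2 :: "num_e \<Rightarrow> (rat_e \<Rightarrow> fm_e) \<Rightarrow> fm_e" where
  \<comment> \<open>\<open>B e\<close> holds for the rational \<open>e = 2\<^sup>-\<^sup>k\<close>\<close>
  "with_inv_pow2 k B = (\<exists>\<^sub>N c. pow2 k (c \<oplus> \<one>) \<^bold>\<and> B (\<one>, \<zero>, c))"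

text \<open>Pairs of rationals, as codes of basic intervals.\<close>

type_synonym int_e = "rat_e \<times> rat_e"

fun icode :: "int_e \<Rightarrow> num_e" where "icode (p, q) = pair (qcode p) (qcode q)"

definition allI_e :: "(int_e \<Rightarrow> fm_e) \<Rightarrow> fm_e" (binder "\<forall>\<^sub>I" 10) where
  "allI_e B = (\<forall>\<^sub>Q p q. B (p, q))"
definition exI_e :: "(int_e \<Rightarrow> fm_e) \<Rightarrow> fm_e" (binder "\<exists>\<^sub>I" 10) where
  "exI_e B = (\<exists>\<^sub>Q p q. B (p, q))"

fun basic_R :: "int_e \<Rightarrow> fm_e" where "basic_R (p, q) = (p <\<^sub>Q q)"
fun meets_R :: "int_e \<Rightarrow> int_e \<Rightarrow> fm_e" where
  "meets_R (p, q) (p', q') = (p <\<^sub>Q q' \<^bold>\<and> p' <\<^sub>Q q)"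
fun subset_R :: "int_e \<Rightarrow> int_e \<Rightarrow> fm_e" where
  "subset_R (p, q) (p', q') = (p' \<le>\<^sub>Q p \<^bold>\<and> q \<le>\<^sub>Q q')"
fun len :: "int_e \<Rightarrow> rat_e" where "len (p, q) = q -\<^sub>Q p"
fun midpoint :: "int_e \<Rightarrow> rat_e" where "midpoint (p, q) = qhalf (p +\<^sub>Q q)"

fun basic_01 :: "int_e \<Rightarrow> fm_e" where
  \<comment> \<open>\<open>max p 0 < min q 1\<close>\<close>
  "basic_01 (p, q) = (p <\<^sub>Q q \<^bold>\<and> p <\<^sub>Q qone \<^bold>\<and> qzero <\<^sub>Q q)"
fun subset_01 :: "int_e \<Rightarrow> int_e \<Rightarrow> fm_e" where
  "subset_01 (p', q') (p, q) =
    ((p <\<^sub>Q qzero \<^bold>\<or> p \<le>\<^sub>Q p') \<^bold>\<and> (qone <\<^sub>Q q \<^bold>\<or> q' \<le>\<^sub>Q q))"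

section \<open>Real numbers\<close>

text \<open>
  A sequence of rationals is given by the formula \<open>R k q\<close> saying that \<open>q\<close> is its \<open>k\<close>-th entry;
  the formula may be membership in a set, in a slice of a set, or a definition.
\<close>

type_synonym seq_e = "num_e \<Rightarrow> rat_e \<Rightarrow> fm_e"

definition qeq_code :: "rat_e \<Rightarrow> rat_e \<Rightarrow> fm_e" where
  "qeq_code p q = (qcode p \<^bold>= qcode q)"

definition is_real :: "seq_e \<Rightarrow> fm_e" where
  "is_real R =
    ((\<forall>\<^sub>N k. \<exists>\<^sub>Q q. R k q \<^bold>\<and> (\<forall>\<^sub>Q q'. R k q' \<^bold>\<longrightarrow> qeq_code q' q)) \<^bold>\<and>
     (\<forall>\<^sub>N m n. \<forall>\<^sub>Q q q'. m \<^bold>\<le> n \<^bold>\<longrightarrow> R m q \<^bold>\<longrightarrow> R n q' \<^bold>\<longrightarrow>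
        with_inv_pow2 m (\<lambda>e. q \<le>\<^sub>Q q' +\<^sub>Q e \<^bold>\<and> q' \<le>\<^sub>Q q +\<^sub>Q e)))"

definition real_le :: "seq_e \<Rightarrow> seq_e \<Rightarrow> fm_e" (infix "\<le>\<^sub>R" 50) where
  "(R \<le>\<^sub>R R') = (\<forall>\<^sub>N k. \<forall>\<^sub>Q q q'. R k q \<^bold>\<longrightarrow> R' k q' \<^bold>\<longrightarrow>
      with_inv_pow2 k (\<lambda>e. q \<le>\<^sub>Q q' +\<^sub>Q (e +\<^sub>Q e)))"
definition real_less :: "seq_e \<Rightarrow> seq_e \<Rightarrow> fm_e" (infix "<\<^sub>R" 50) where
  "(R <\<^sub>R R') = (\<^bold>\<not> (R' \<le>\<^sub>R R))"
definition real_eq :: "seq_e \<Rightarrow> seq_e \<Rightarrow> fm_e" (infix "=\<^sub>R" 50) where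
  "(R =\<^sub>R R') = (\<forall>\<^sub>N k. \<forall>\<^sub>Q q q'. R k q \<^bold>\<longrightarrow> R' k q' \<^bold>\<longrightarrow>
      with_inv_pow2 k (\<lambda>e. q \<le>\<^sub>Q q' +\<^sub>Q (e +\<^sub>Q e) \<^bold>\<and> q' \<le>\<^sub>Q q +\<^sub>Q (e +\<^sub>Q e)))"

definition rconst :: "rat_e \<Rightarrow> seq_e" where "rconst p = (\<lambda>k q. qeq_code q p)"
definition rsub :: "seq_e \<Rightarrow> seq_e \<Rightarrow> seq_e" (infixl "-\<^sub>R" 65) where
  \<comment> \<open>shifting the index by one keeps the rate of convergence\<close>
  "R -\<^sub>R R' = (\<lambda>k q. \<exists>\<^sub>Q p p'. R (k \<oplus> \<one>) p \<^bold>\<and> R' (k \<oplus> \<one>) p' \<^bold>\<and> qeq_code q (p -\<^sub>Q p'))"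
definition rabs :: "seq_e \<Rightarrow> seq_e" where
  "rabs R = (\<lambda>k q. \<exists>\<^sub>Q p. R k p \<^bold>\<and>
      ((qzero \<le>\<^sub>Q p \<^bold>\<and> qeq_code q p) \<^bold>\<or> (p <\<^sub>Q qzero \<^bold>\<and> qeq_code q (qneg p))))"

definition in_01 :: "seq_e \<Rightarrow> fm_e" where
  "in_01 R = (rconst qzero \<le>\<^sub>R R \<^bold>\<and> R \<le>\<^sub>R rconst qone)"

fun in_U :: "seq_e \<Rightarrow> int_e \<Rightarrow> fm_e" where
  "in_U R (p, q) = (in_01 R \<^bold>\<and> rconst p <\<^sub>R R \<^bold>\<and> R <\<^sub>R rconst q)"

definition set_seq :: "set_e \<Rightarrow> seq_e" where
  "set_seq X = (\<lambda>k q. pair k (qcode q) \<^bold>\<in> X)"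
definition slice_seq :: "set_e \<Rightarrow> num_e \<Rightarrow> seq_e" where
  "slice_seq Z i = (\<lambda>k q. pair (pair i k) (qcode q) \<^bold>\<in> Z)"

definition real_set :: "set_e \<Rightarrow> fm_e" where
  "real_set X =
    ((\<forall>\<^sub>N n. n \<^bold>\<in> X \<^bold>\<longrightarrow> (\<exists>\<^sub>N k. \<exists>\<^sub>Q q. n \<^bold>= pair k (qcode q))) \<^bold>\<and> is_real (set_seq X))"

definition real_sequence :: "set_e \<Rightarrow> fm_e" where
  "real_sequence Z =
    ((\<forall>\<^sub>N n. n \<^bold>\<in> Z \<^bold>\<longrightarrow> (\<exists>\<^sub>N i k. \<exists>\<^sub>Q q. n \<^bold>= pair (pair i k) (qcode q))) \<^bold>\<and>
     (\<forall>\<^sub>N i. is_real (slice_seq Z i)))"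

definition finite_real_sequence :: "set_e \<Rightarrow> num_e \<Rightarrow> fm_e" where
  \<comment> \<open>\<open>Z\<close> is a sequence of \<open>s\<close> reals\<close>
  "finite_real_sequence Z s =
    ((\<forall>\<^sub>N n. n \<^bold>\<in> Z \<^bold>\<longrightarrow> (\<exists>\<^sub>N i k. \<exists>\<^sub>Q q. i \<^bold>< s \<^bold>\<and> n \<^bold>= pair (pair i k) (qcode q))) \<^bold>\<and>
     (\<forall>\<^sub>N i. i \<^bold>< s \<^bold>\<longrightarrow> is_real (slice_seq Z i)))"

section \<open>Continuous functions\<close>

text \<open>A set of pairs \<open>(U, V)\<close> of basic intervals, given by the formula defining membership.\<close>

type_synonym fun_e = "int_e \<Rightarrow> int_e \<Rightarrow> fm_e"

definition partial_continuous :: "fun_e \<Rightarrow> fm_e" where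
  "partial_continuous f =
    ((\<forall>\<^sub>I U V. f U V \<^bold>\<longrightarrow> basic_01 U \<^bold>\<and> basic_R V) \<^bold>\<and>
     (\<forall>\<^sub>I U V V'. f U V \<^bold>\<longrightarrow> f U V' \<^bold>\<longrightarrow> meets_R V V') \<^bold>\<and>
     (\<forall>\<^sub>I U V U'. f U V \<^bold>\<longrightarrow> basic_01 U' \<^bold>\<longrightarrow> subset_01 U' U \<^bold>\<longrightarrow> f U' V) \<^bold>\<and>
     (\<forall>\<^sub>I U V V'. f U V \<^bold>\<longrightarrow> basic_R V' \<^bold>\<longrightarrow> subset_R V V' \<^bold>\<longrightarrow> f U V'))"

definition witness :: "fun_e \<Rightarrow> seq_e \<Rightarrow> rat_e \<Rightarrow> int_e \<Rightarrow> fm_e" where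
  "witness f x \<epsilon> V = (\<exists>\<^sub>I U. f U V \<^bold>\<and> in_U x U \<^bold>\<and> len V \<le>\<^sub>Q \<epsilon>)"

definition in_domain :: "fun_e \<Rightarrow> seq_e \<Rightarrow> fm_e" where
  "in_domain f x = (\<forall>\<^sub>Q \<epsilon>. qzero <\<^sub>Q \<epsilon> \<^bold>\<longrightarrow> (\<exists>\<^sub>I V. witness f x \<epsilon> V))"

definition total_continuous :: "fun_e \<Rightarrow> fm_e" where
  "total_continuous f =
    (partial_continuous f \<^bold>\<and>
     (\<forall>\<^sub>S X. real_set X \<^bold>\<longrightarrow> in_01 (set_seq X) \<^bold>\<longrightarrow> in_domain f (set_seq X)))"

definition least_witness :: "fun_e \<Rightarrow> seq_e \<Rightarrow> rat_e \<Rightarrow> int_e \<Rightarrow> fm_e" where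
  "least_witness f x \<epsilon> V =
    (witness f x \<epsilon> V \<^bold>\<and> (\<forall>\<^sub>I V'. witness f x \<epsilon> V' \<^bold>\<longrightarrow> icode V \<^bold>\<le> icode V'))"

text \<open>
  The value \<open>f(x)\<close> is given by a defining formula for its entries. It is not assumed to exist as
  a set, since finding the least \<open>V\<close> need not be a computable operation.
\<close>

definition fun_value :: "fun_e \<Rightarrow> seq_e \<Rightarrow> seq_e" where
  "fun_value f x = (\<lambda>n q. with_inv_pow2 n (\<lambda>e.
      \<exists>\<^sub>I V. least_witness f x e V \<^bold>\<and> qeq_code q (midpoint V)))"

section \<open>Baire 1 functions\<close>

definition slice_fun :: "set_e \<Rightarrow> num_e \<Rightarrow> fun_e" where
  "slice_fun D m = (\<lambda>U V. pair m (pair (icode U) (icode V)) \<^bold>\<in> D)"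

definition eventually_e :: "(num_e \<Rightarrow> fm_e) \<Rightarrow> fm_e" where
  "eventually_e B = (\<exists>\<^sub>N k. \<forall>\<^sub>N m. k \<^bold>\<le> m \<^bold>\<longrightarrow> B m)"

definition baire1 :: "set_e \<Rightarrow> fm_e" where
  "baire1 D =
    ((\<forall>\<^sub>N n. n \<^bold>\<in> D \<^bold>\<longrightarrow> (\<exists>\<^sub>N m. \<exists>\<^sub>I U V. n \<^bold>= pair m (pair (icode U) (icode V)))) \<^bold>\<and>
     (\<forall>\<^sub>N m. total_continuous (slice_fun D m)) \<^bold>\<and>
     (\<forall>\<^sub>S X. real_set X \<^bold>\<longrightarrow> in_01 (set_seq X) \<^bold>\<longrightarrow>
       (\<forall>\<^sub>Q \<epsilon>. qzero <\<^sub>Q \<epsilon> \<^bold>\<longrightarrow>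
         (\<exists>\<^sub>N k. \<forall>\<^sub>N m n. k \<^bold>\<le> m \<^bold>\<longrightarrow> k \<^bold>\<le> n \<^bold>\<longrightarrow>
           rabs (fun_value (slice_fun D m) (set_seq X) -\<^sub>R fun_value (slice_fun D n) (set_seq X))
             \<le>\<^sub>R rconst \<epsilon>))))"

definition baire_ge :: "set_e \<Rightarrow> seq_e \<Rightarrow> seq_e \<Rightarrow> fm_e" where
  \<comment> \<open>\<open>f(x) \<ge> y\<close> for the Baire 1 function \<open>f\<close> coded by \<open>D\<close>\<close>
  "baire_ge D x y = (\<forall>\<^sub>Q q. rconst q <\<^sub>R y \<^bold>\<longrightarrow>
      eventually_e (\<lambda>m. rconst q <\<^sub>R fun_value (slice_fun D m) x))"
definition baire_le :: "set_e \<Rightarrow> seq_e \<Rightarrow> seq_e \<Rightarrow> fm_e" where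
  "baire_le D x y = (\<forall>\<^sub>Q q. y <\<^sub>R rconst q \<^bold>\<longrightarrow>
      eventually_e (\<lambda>m. fun_value (slice_fun D m) x <\<^sub>R rconst q))"
definition baire_gt :: "set_e \<Rightarrow> seq_e \<Rightarrow> seq_e \<Rightarrow> fm_e" where
  "baire_gt D x y = (\<^bold>\<not> baire_le D x y)"

definition baire1_gauge :: "set_e \<Rightarrow> fm_e" where
  "baire1_gauge D =
    (baire1 D \<^bold>\<and>
     (\<forall>\<^sub>S X. real_set X \<^bold>\<longrightarrow> in_01 (set_seq X) \<^bold>\<longrightarrow> baire_gt D (set_seq X) (rconst qzero)))"

section \<open>Tagged partitions and the two principles\<close>

text \<open>
  A tagged partition of size \<open>l\<close> is a sequence of \<open>2l + 1\<close> reals; entry \<open>2j\<close> is the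
  point \<open>x\<^sub>j\<close> and entry \<open>2j + 1\<close> is the tag \<open>t\<^sub>j\<close>.
\<close>

definition point :: "set_e \<Rightarrow> num_e \<Rightarrow> seq_e" where "point P j = slice_seq P (j \<oplus> j)"
definition tag :: "set_e \<Rightarrow> num_e \<Rightarrow> seq_e" where "tag P j = slice_seq P (j \<oplus> j \<oplus> \<one>)"

definition tagged_partition :: "set_e \<Rightarrow> num_e \<Rightarrow> fm_e" where
  "tagged_partition P l =
    (finite_real_sequence P (l \<oplus> l \<oplus> \<one>) \<^bold>\<and>
     point P \<zero> =\<^sub>R rconst qzero \<^bold>\<and> point P l =\<^sub>R rconst qone \<^bold>\<and>
     (\<forall>\<^sub>N j. j \<^bold>< l \<^bold>\<longrightarrow>
        point P j <\<^sub>R point P (j \<oplus> \<one>) \<^bold>\<and>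
        point P j \<le>\<^sub>R tag P j \<^bold>\<and> tag P j \<le>\<^sub>R point P (j \<oplus> \<one>)))"

definition fine :: "set_e \<Rightarrow> set_e \<Rightarrow> num_e \<Rightarrow> fm_e" where
  "fine D P l = (\<forall>\<^sub>N j. j \<^bold>< l \<^bold>\<longrightarrow>
      baire_ge D (tag P j) (tag P j -\<^sub>R point P j) \<^bold>\<and>
      baire_ge D (tag P j) (point P (j \<oplus> \<one>) -\<^sub>R tag P j))"

definition CL_B1 :: fm where
  "CL_B1 = sentence (\<forall>\<^sub>S D. baire1_gauge D \<^bold>\<longrightarrow>
      (\<exists>\<^sub>S P. \<exists>\<^sub>N l. tagged_partition P l \<^bold>\<and> fine D P l))"

definition cauchy_seq :: "set_e \<Rightarrow> fm_e" where
  "cauchy_seq Z = (\<forall>\<^sub>Q \<epsilon>. qzero <\<^sub>Q \<epsilon> \<^bold>\<longrightarrow>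
      (\<exists>\<^sub>N k. \<forall>\<^sub>N m n. k \<^bold>\<le> m \<^bold>\<longrightarrow> k \<^bold>\<le> n \<^bold>\<longrightarrow>
        rabs (slice_seq Z m -\<^sub>R slice_seq Z n) \<le>\<^sub>R rconst \<epsilon>))"

definition is_limit :: "set_e \<Rightarrow> seq_e \<Rightarrow> fm_e" where
  "is_limit Z y = (\<forall>\<^sub>Q \<epsilon>. qzero <\<^sub>Q \<epsilon> \<^bold>\<longrightarrow>
      eventually_e (\<lambda>n. rabs (slice_seq Z n -\<^sub>R y) \<le>\<^sub>R rconst \<epsilon>))"

definition SC :: fm where
  "SC = sentence (\<forall>\<^sub>S Z. real_sequence Z \<^bold>\<and> (\<forall>\<^sub>N n. in_01 (slice_seq Z n)) \<^bold>\<and> cauchy_seq Z \<^bold>\<longrightarrow>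
      (\<exists>\<^sub>S Y. real_set Y \<^bold>\<and> is_limit Z (set_seq Y)))"

end

theory Submission
  imports Defs "HOL-Library.Countable" "HOL-Computational_Algebra.Fraction_Field"
begin

text \<open>
  The derivation is obtained from a model. The calculus \<open>provable\<close> is complete: if \<open>RCA0\<close> did not
  prove \<open>CL_B1 \<longrightarrow> SC\<close>, a Henkin construction would give a maximal consistent theory containing
  \<open>RCA0\<close> and the negation of that implication, and its terms, modulo provable equality, would form a
  model with a number sort \<open>number\<close> and a family \<open>Sets\<close> of sets of numbers. It remains to show that
  \<open>CL_B1\<close> implies \<open>SC\<close> in this model, whose numbers may be nonstandard and where only induction for
  \<open>Sigma1\<close> predicates and comprehension for predicates that are \<open>Sigma1\<close> together with their
  complements are available (\<open>Sigma1_induct\<close>, \<open>Delta1_comprehension\<close>).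
  
  Since the numbers of the model form an ordered semiring (that of nonnegative integers of some ordered
  ring), its rationals form an ordered field, namely the field of fractions of the ring of differences.
  This gives a type \<open>rational\<close> on which linear arithmetic can be used. A logical relation \<open>fm_rel\<close>
  translates the formulas into statements about this type, one definition at a time.
  
  The mathematical argument runs as follows. Let \<open>Z\<close> be a Cauchy sequence of reals in \<open>[0,1]\<close> without a
  limit and let \<open>r n\<close> be the \<open>n\<close>-th rational approximation of its \<open>n\<close>-th member. The functions
  \<open>\<delta> n\<close> mapping \<open>x\<close> to \<open>\<bar>x - r n\<bar>\<close> have decidable codes and are pointwise Cauchy; because no \<open>x\<close> is a
  limit of \<open>r\<close>, they form a Baire 1 gauge (\<open>gauge_is_gauge\<close>). For the same reason every real lies strictly
  \<open>below\<close> or strictly \<open>above\<close> the virtual limit. In a fine partition, an interval whose left end point lies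
  below the virtual limit has its tag and then its right end point below it as well (\<open>below_step\<close>). As
  \<open>0\<close> is below the limit and \<open>1\<close> is not, walking through the partition gives a contradiction.
  
  Walking is an induction on the statement that the \<open>j\<close>-th point lies below the limit. That statement is
  \<open>\<Delta>\<^sub>2\<close>, and induction for it is not at hand. The points of the partition are however uniformly
  separated: that \<open>2\<^sup>-\<^sup>b\<close> bounds all gaps from below, for some \<open>b\<close>, is a case of \<open>\<Sigma>\<^sub>1\<close> collection
  (\<open>uniform_gap\<close>). Hence one rational approximation \<open>r N\<close> of the limit, compared with approximations of the
  points, decides the position of all points up to an error of one place. The induction of
  \<open>no_fine_partition\<close> is on this decidable approximate statement, and the error is repaired by a use of
  \<open>below_step\<close> in every step.
\<close>

section \<open>Substitution and provability\<close>

lemma sub_tm_Var [simp]: "sub_tm Var t = t"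
  by (induction t) auto

lemma sub_tm_comp: "sub_tm \<sigma> (sub_tm \<tau> t) = sub_tm (\<lambda>i. sub_tm \<sigma> (\<tau> i)) t"
  by (induction t) auto

lemma up_Var: "case_nat (Var 0) (\<lambda>i. lift_tm (Var i)) = Var"
  by (auto simp: fun_eq_iff lift_tm_def split: nat.split)

lemma up_ident: "case_nat 0 Suc = (\<lambda>i. i)"
  by (auto simp: fun_eq_iff split: nat.split)

lemma sub_Var_ident [simp]: "sub Var (\<lambda>i. i) \<phi> = \<phi>"
  by (induction \<phi>) (simp_all add: up_Var up_ident)

lemma sub_Var_id [simp]: "sub Var id \<phi> = \<phi>"
  by (simp add: id_def)

lemma sub_comp: "sub \<sigma> \<rho> (sub \<tau> \<kappa> \<phi>) = sub (\<lambda>i. sub_tm \<sigma> (\<tau> i)) (\<lambda>i. \<rho> (\<kappa> i)) \<phi>"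
proof (induction \<phi> arbitrary: \<sigma> \<rho> \<tau> \<kappa>)
  case (AllN \<phi>)
  have "(\<lambda>i. sub_tm (case_nat (Var 0) (\<lambda>i. lift_tm (\<sigma> i))) (case i of 0 \<Rightarrow> Var 0 | Suc i \<Rightarrow> lift_tm (\<tau> i)))
      = case_nat (Var 0) (\<lambda>i. lift_tm (sub_tm \<sigma> (\<tau> i)))"
    by (auto simp: fun_eq_iff lift_tm_def sub_tm_comp split: nat.split)
  then show ?case by (simp add: AllN.IH)
next
  case (AllS \<phi>)
  have "(\<lambda>i. (case_nat 0 (\<lambda>i. Suc (\<rho> i))) (case i of 0 \<Rightarrow> 0 | Suc i \<Rightarrow> Suc (\<kappa> i)))
      = case_nat 0 (\<lambda>i. Suc (\<rho> (\<kappa> i)))"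
    by (auto simp: fun_eq_iff split: nat.split)
  then show ?case by (simp add: AllS.IH)
qed (simp_all add: sub_tm_comp)

lemma sub_tm_below:
  "tm_below n t \<Longrightarrow> (\<And>i. i < n \<Longrightarrow> \<sigma> i = \<tau> i) \<Longrightarrow> sub_tm \<sigma> t = sub_tm \<tau> t"
  by (induction t) auto

lemma sub_below:
  "fm_below n m \<phi> \<Longrightarrow> (\<And>i. i < n \<Longrightarrow> \<sigma> i = \<tau> i) \<Longrightarrow> (\<And>i. i < m \<Longrightarrow> \<rho> i = \<kappa> i)
    \<Longrightarrow> sub \<sigma> \<rho> \<phi> = sub \<tau> \<kappa> \<phi>"
proof (induction \<phi> arbitrary: n m \<sigma> \<rho> \<tau> \<kappa>)
  case (AllN \<phi>)
  show ?case
    using AllN.prems by (auto intro!: AllN.IH[of "Suc n" m] split: nat.split)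
next
  case (AllS \<phi>)
  show ?case
    using AllS.prems by (auto intro!: AllS.IH[of n "Suc m"] split: nat.split)
next
  case (Imp \<phi>1 \<phi>2)
  then show ?case by (metis fm_below.simps(5) sub.simps(5))
qed (auto intro: sub_tm_below)

lemma tm_below_mono: "tm_below n t \<Longrightarrow> n \<le> n' \<Longrightarrow> tm_below n' t"
  by (induction t) auto

lemma fm_below_mono: "fm_below n m \<phi> \<Longrightarrow> n \<le> n' \<Longrightarrow> m \<le> m' \<Longrightarrow> fm_below n' m' \<phi>"
  by (induction \<phi> arbitrary: n m n' m') (auto intro: tm_below_mono)

lemma tm_below_exists: "\<exists>n. tm_below n t"
proof (induction t)
  case (Var i)
  then show ?case by (auto intro: exI[of _ "Suc i"])
next
  case (Add s t)
  then obtain n n' where "tm_below n s" "tm_below n' t" by blast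
  then show ?case by (auto intro!: exI[of _ "max n n'"] elim: tm_below_mono)
next
  case (Mul s t)
  then obtain n n' where "tm_below n s" "tm_below n' t" by blast
  then show ?case by (auto intro!: exI[of _ "max n n'"] elim: tm_below_mono)
qed auto

lemma fm_below_exists: "\<exists>n m. fm_below n m \<phi>"
proof (induction \<phi>)
  case (Eq s t)
  obtain n n' where "tm_below n s" "tm_below n' t" using tm_below_exists by blast
  then show ?case by (auto intro!: exI[of _ "max n n'"] elim: tm_below_mono)
next
  case (Less s t)
  obtain n n' where "tm_below n s" "tm_below n' t" using tm_below_exists by blast
  then show ?case by (auto intro!: exI[of _ "max n n'"] elim: tm_below_mono)
next
  case (In t X)
  then show ?case using tm_below_exists[of t] by auto
next
  case (Imp \<phi> \<psi>)
  then obtain n m n' m' where "fm_below n m \<phi>" "fm_below n' m' \<psi>" by blast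
  then have "fm_below (max n n') (max m m') (Imp \<phi> \<psi>)" by (auto elim: fm_below_mono)
  then show ?case by blast
next
  case (AllN \<phi>)
  then obtain n m where "fm_below n m \<phi>" by blast
  then have "fm_below n m (AllN \<phi>)" by (auto elim: fm_below_mono)
  then show ?case by blast
next
  case (AllS \<phi>)
  then obtain n m where "fm_below n m \<phi>" by blast
  then have "fm_below n m (AllS \<phi>)" by (auto elim: fm_below_mono)
  then show ?case by blast
qed auto

lemma finite_fm_below: "finite G \<Longrightarrow> \<exists>n. \<forall>\<phi>\<in>G. fm_below n n \<phi>"
proof (induction G rule: finite_induct)
  case (insert \<phi> G)
  then obtain n where n: "\<forall>\<phi>\<in>G. fm_below n n \<phi>" by blast
  obtain k l where "fm_below k l \<phi>" using fm_below_exists by blast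
  then have "fm_below (n + k + l) (n + k + l) \<phi>" by (rule fm_below_mono) auto
  moreover have "fm_below (n + k + l) (n + k + l) \<psi>" if "\<psi> \<in> G" for \<psi>
    using bspec[OF n that] by (rule fm_below_mono) auto
  ultimately show ?case by blast
qed auto

lemma provable_mono: "provable \<Gamma> \<phi> \<Longrightarrow> \<Gamma> \<subseteq> \<Delta> \<Longrightarrow> provable \<Delta> \<phi>"
proof (induction arbitrary: \<Delta> rule: provable.induct)
  case (ImpI \<phi> \<Gamma> \<psi>)
  then show ?case by (meson insert_mono provable.ImpI)
next
  case (RAA \<phi> \<Gamma>)
  then show ?case by (meson insert_mono provable.RAA)
next
  case (AllN_I \<Gamma> \<phi>)
  then show ?case by (meson image_mono provable.AllN_I)
next
  case (AllS_I \<Gamma> \<phi>)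
  then show ?case by (meson image_mono provable.AllS_I)
next
  case (ImpE \<Gamma> \<phi> \<psi>)
  then show ?case by (meson provable.ImpE)
next
  case (Eq_subst \<Gamma> s t \<phi>)
  then show ?case by (meson provable.Eq_subst)
qed (auto intro: provable.Assm provable.AllN_E provable.AllS_E provable.Eq_refl)

text \<open>
  Generalization is built into the calculus only for the variables with index 0. Applying a substitution
  to a whole derivation extends it to any fresh variable.
\<close>

lemma provable_sub: "provable \<Gamma> \<phi> \<Longrightarrow> provable (sub \<sigma> \<rho> ` \<Gamma>) (sub \<sigma> \<rho> \<phi>)"
proof (induction arbitrary: \<sigma> \<rho> rule: provable.induct)
  case (ImpI \<phi> \<Gamma> \<psi>)
  then show ?case by (auto intro: provable.ImpI)
next
  case (RAA \<phi> \<Gamma>)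
  have "provable (sub \<sigma> \<rho> ` insert (Neg \<phi>) \<Gamma>) Bot" using RAA.IH[of \<sigma> \<rho>] by simp
  then show ?case by (auto simp: Neg_def intro: provable.RAA)
next
  case (AllN_I \<Gamma> \<phi>)
  let ?\<sigma> = "case_nat (Var 0) (\<lambda>i. lift_tm (\<sigma> i))"
  have eq: "sub ?\<sigma> \<rho> (lift_N \<psi>) = lift_N (sub \<sigma> \<rho> \<psi>)" for \<psi>
    by (simp add: lift_N_def sub_comp lift_tm_def id_def)
  have "sub ?\<sigma> \<rho> ` lift_N ` \<Gamma> = lift_N ` sub \<sigma> \<rho> ` \<Gamma>"
    by (simp add: image_image eq)
  then show ?case using AllN_I.IH[of ?\<sigma> \<rho>] by (auto intro: provable.AllN_I)
next
  case (AllN_E \<Gamma> \<phi> t)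
  have "sub \<sigma> \<rho> (inst_N t \<phi>)
      = inst_N (sub_tm \<sigma> t) (sub (case_nat (Var 0) (\<lambda>i. lift_tm (\<sigma> i))) \<rho> \<phi>)"
    by (auto simp: inst_N_def sub_comp lift_tm_def sub_tm_comp id_def fun_eq_iff
        intro!: arg_cong[where f="\<lambda>f. sub f _ _"] split: nat.split)
  then show ?case using AllN_E.IH[of \<sigma> \<rho>] by (auto intro: provable.AllN_E)
next
  case (AllS_I \<Gamma> \<phi>)
  let ?\<rho> = "case_nat 0 (\<lambda>i. Suc (\<rho> i))"
  have eq: "sub \<sigma> ?\<rho> (lift_S \<psi>) = lift_S (sub \<sigma> \<rho> \<psi>)" for \<psi>
    by (simp add: lift_S_def sub_comp)
  have "sub \<sigma> ?\<rho> ` lift_S ` \<Gamma> = lift_S ` sub \<sigma> \<rho> ` \<Gamma>"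
    by (simp add: image_image eq)
  then show ?case using AllS_I.IH[of \<sigma> ?\<rho>] by (auto intro: provable.AllS_I)
next
  case (AllS_E \<Gamma> \<phi> X)
  have "sub \<sigma> \<rho> (inst_S X \<phi>) = inst_S (\<rho> X) (sub \<sigma> (case_nat 0 (\<lambda>i. Suc (\<rho> i))) \<phi>)"
    by (auto simp: inst_S_def sub_comp fun_eq_iff
        intro!: arg_cong[where f="\<lambda>f. sub _ f _"] split: nat.split)
  then show ?case using AllS_E.IH[of \<sigma> \<rho>] by (auto intro: provable.AllS_E)
next
  case (Eq_subst \<Gamma> s t \<phi>)
  have "sub \<sigma> \<rho> (inst_N u \<phi>)
      = inst_N (sub_tm \<sigma> u) (sub (case_nat (Var 0) (\<lambda>i. lift_tm (\<sigma> i))) \<rho> \<phi>)" for u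
    by (auto simp: inst_N_def sub_comp lift_tm_def sub_tm_comp id_def fun_eq_iff
        intro!: arg_cong[where f="\<lambda>f. sub f _ _"] split: nat.split)
  then show ?case using Eq_subst.IH[of \<sigma> \<rho>] by (auto intro: provable.Eq_subst)
next
  case (ImpE \<Gamma> \<phi> \<psi>)
  then show ?case by (metis provable.ImpE sub.simps(5))
qed (auto intro: provable.Assm provable.Eq_refl)

lemma provable_finite: "provable \<Gamma> \<phi> \<Longrightarrow> \<exists>\<Delta>. finite \<Delta> \<and> \<Delta> \<subseteq> \<Gamma> \<and> provable \<Delta> \<phi>"
proof (induction rule: provable.induct)
  case (Assm \<phi> \<Gamma>)
  then show ?case by (intro exI[of _ "{\<phi>}"]) (auto intro: provable.Assm)
next
  case (ImpI \<phi> \<Gamma> \<psi>)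
  then obtain \<Delta> where "finite \<Delta>" "\<Delta> \<subseteq> insert \<phi> \<Gamma>" "provable \<Delta> \<psi>" by blast
  then show ?case
    by (intro exI[of _ "\<Delta> - {\<phi>}"] conjI, simp, blast)
      (rule provable.ImpI, erule provable_mono, blast)
next
  case (RAA \<phi> \<Gamma>)
  then obtain \<Delta> where "finite \<Delta>" "\<Delta> \<subseteq> insert (Neg \<phi>) \<Gamma>" "provable \<Delta> Bot" by blast
  then show ?case
    by (intro exI[of _ "\<Delta> - {Neg \<phi>}"] conjI, simp, blast)
      (rule provable.RAA, erule provable_mono, blast)
next
  case (ImpE \<Gamma> \<phi> \<psi>)
  then obtain \<Delta> \<Delta>' where "finite \<Delta>" "\<Delta> \<subseteq> \<Gamma>" "provable \<Delta> (Imp \<phi> \<psi>)"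
    "finite \<Delta>'" "\<Delta>' \<subseteq> \<Gamma>" "provable \<Delta>' \<phi>" by blast
  then show ?case
    by (intro exI[of _ "\<Delta> \<union> \<Delta>'"] conjI, simp, blast)
      (rule provable.ImpE[of _ \<phi> \<psi>]; blast intro: provable_mono)
next
  case (Eq_subst \<Gamma> s t \<phi>)
  then obtain \<Delta> \<Delta>' where "finite \<Delta>" "\<Delta> \<subseteq> \<Gamma>" "provable \<Delta> (Eq s t)"
    "finite \<Delta>'" "\<Delta>' \<subseteq> \<Gamma>" "provable \<Delta>' (inst_N s \<phi>)" by blast
  then show ?case
    by (intro exI[of _ "\<Delta> \<union> \<Delta>'"] conjI, simp, blast)
      (rule provable.Eq_subst[of _ s t \<phi>]; blast intro: provable_mono)
next
  case (AllN_I \<Gamma> \<phi>)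
  then obtain \<Delta> where "finite \<Delta>" "\<Delta> \<subseteq> lift_N ` \<Gamma>" "provable \<Delta> \<phi>" by blast
  moreover from this obtain \<Delta>' where "finite \<Delta>'" "\<Delta>' \<subseteq> \<Gamma>" "\<Delta> = lift_N ` \<Delta>'"
    by (meson finite_subset_image)
  ultimately show ?case by (auto intro: provable.AllN_I exI[of _ \<Delta>'])
next
  case (AllS_I \<Gamma> \<phi>)
  then obtain \<Delta> where "finite \<Delta>" "\<Delta> \<subseteq> lift_S ` \<Gamma>" "provable \<Delta> \<phi>" by blast
  moreover from this obtain \<Delta>' where "finite \<Delta>'" "\<Delta>' \<subseteq> \<Gamma>" "\<Delta> = lift_S ` \<Delta>'"
    by (meson finite_subset_image)
  ultimately show ?case by (auto intro: provable.AllS_I exI[of _ \<Delta>'])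
next
  case (AllN_E \<Gamma> \<phi> t)
  then show ?case using provable.AllN_E[of _ \<phi> t] by blast
next
  case (AllS_E \<Gamma> \<phi> X)
  then show ?case using provable.AllS_E[of _ \<phi> X] by blast
next
  case (Eq_refl \<Gamma> t)
  show ?case using provable.Eq_refl[of "{}" t] by blast
qed

section \<open>Complete Henkin theories\<close>

definition closed_fm :: "fm \<Rightarrow> bool" where
  "closed_fm \<phi> \<longleftrightarrow> (\<forall>\<sigma> \<rho>. sub \<sigma> \<rho> \<phi> = \<phi>)"

lemma closed_fm_below: "fm_below 0 0 \<phi> \<Longrightarrow> closed_fm \<phi>"
  unfolding closed_fm_def by (metis not_less_zero sub_below sub_Var_id)

text \<open>
  Renaming a fresh variable to the one that \<open>AllN\<close> binds, and shifting all others, is a substitution that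
  turns the hypotheses into those of the generalization rule.
\<close>

lemma generalize_N:
  assumes T: "\<forall>\<phi>\<in>T. closed_fm \<phi>" and G: "\<forall>\<phi>\<in>G. fm_below y m \<phi>"
    and \<psi>: "fm_below y m (AllN \<psi>)" and pr: "provable (T \<union> G) (inst_N (Var y) \<psi>)"
  shows "provable (T \<union> G) (AllN \<psi>)"
proof (rule provable.AllN_I)
  let ?\<sigma> = "\<lambda>i. if i = y then Var 0 else Var (Suc i)"
  have "sub ?\<sigma> id (inst_N (Var y) \<psi>) = sub Var id \<psi>"
    unfolding inst_N_def sub_comp
    by (rule sub_below[of "Suc y" m]) (use \<psi> in \<open>auto split: nat.split\<close>)
  moreover have "sub ?\<sigma> id \<phi> = lift_N \<phi>" if "\<phi> \<in> T \<union> G" for \<phi>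
  proof (cases "\<phi> \<in> T")
    case True
    then show ?thesis using T by (simp add: closed_fm_def lift_N_def)
  next
    case False
    then show ?thesis using that G unfolding lift_N_def by (intro sub_below[of y m]) auto
  qed
  then have "sub ?\<sigma> id ` (T \<union> G) = lift_N ` (T \<union> G)" by (rule image_cong[OF refl])
  ultimately show "provable (lift_N ` (T \<union> G)) \<psi>"
    using provable_sub[OF pr, of ?\<sigma> id] by simp
qed

lemma generalize_S:
  assumes T: "\<forall>\<phi>\<in>T. closed_fm \<phi>" and G: "\<forall>\<phi>\<in>G. fm_below n y \<phi>"
    and \<psi>: "fm_below n y (AllS \<psi>)" and pr: "provable (T \<union> G) (inst_S y \<psi>)"
  shows "provable (T \<union> G) (AllS \<psi>)"
proof (rule provable.AllS_I)
  let ?\<rho> = "\<lambda>i. if i = y then 0 else Suc i"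
  have "sub Var ?\<rho> (inst_S y \<psi>) = sub Var id \<psi>"
    unfolding inst_S_def sub_comp
    by (rule sub_below[of n "Suc y"]) (use \<psi> in \<open>auto split: nat.split\<close>)
  moreover have "sub Var ?\<rho> \<phi> = lift_S \<phi>" if "\<phi> \<in> T \<union> G" for \<phi>
  proof (cases "\<phi> \<in> T")
    case True
    then show ?thesis using T by (simp add: closed_fm_def lift_S_def)
  next
    case False
    then show ?thesis using that G unfolding lift_S_def by (intro sub_below[of n y]) auto
  qed
  then have "sub Var ?\<rho> ` (T \<union> G) = lift_S ` (T \<union> G)" by (rule image_cong[OF refl])
  ultimately show "provable (lift_S ` (T \<union> G)) \<psi>"
    using provable_sub[OF pr, of Var ?\<rho>] by simp
qed

definition consistent :: "fm set \<Rightarrow> bool" where "consistent \<Gamma> \<longleftrightarrow> \<not> provable \<Gamma> Bot"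

lemma provable_iff_inconsistent: "provable \<Gamma> \<phi> \<longleftrightarrow> \<not> consistent (insert (Neg \<phi>) \<Gamma>)"
proof
  assume "provable \<Gamma> \<phi>"
  then have "provable (insert (Neg \<phi>) \<Gamma>) \<phi>" by (auto elim: provable_mono)
  moreover have "provable (insert (Neg \<phi>) \<Gamma>) (Imp \<phi> Bot)"
    by (rule provable.Assm) (simp add: Neg_def)
  ultimately show "\<not> consistent (insert (Neg \<phi>) \<Gamma>)"
    unfolding consistent_def by (blast intro: provable.ImpE)
qed (auto simp: consistent_def intro: provable.RAA)

lemma consistent_cases: "consistent \<Gamma> \<Longrightarrow> consistent (insert \<phi> \<Gamma>) \<or> consistent (insert (Neg \<phi>) \<Gamma>)"
  by (metis Neg_def consistent_def provable.ImpE provable.ImpI provable_iff_inconsistent)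

text \<open>One stage of the construction decides \<open>\<phi>\<close>, with a counterexample if \<open>\<phi>\<close> is a refuted
  universal statement. Keeping the stages finite keeps fresh variables available.\<close>

definition decides :: "fm set \<Rightarrow> fm \<Rightarrow> bool" where
  "decides G \<phi> \<longleftrightarrow> \<phi> \<in> G \<or>
    Neg \<phi> \<in> G \<and> (\<forall>\<psi>. \<phi> = AllN \<psi> \<longrightarrow> (\<exists>t. Neg (inst_N t \<psi>) \<in> G))
              \<and> (\<forall>\<psi>. \<phi> = AllS \<psi> \<longrightarrow> (\<exists>X. Neg (inst_S X \<psi>) \<in> G))"

lemma Henkin_step:
  assumes T: "\<forall>\<phi>\<in>T. closed_fm \<phi>" and fin: "finite G" and con: "consistent (T \<union> G)"
  shows "\<exists>G'. finite G' \<and> consistent (T \<union> G') \<and> G \<subseteq> G' \<and> decides G' \<phi>"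
proof (cases "consistent (T \<union> insert \<phi> G)")
  case True
  then show ?thesis using fin by (intro exI[of _ "insert \<phi> G"]) (auto simp: decides_def)
next
  case False
  define G1 where "G1 = insert (Neg \<phi>) G"
  have con1: "consistent (T \<union> G1)"
    using consistent_cases[OF con, of \<phi>] False by (simp add: G1_def)
  have fin1: "finite G1" using fin by (simp add: G1_def)
  obtain y where "\<forall>\<psi>\<in>insert \<phi> G1. fm_below y y \<psi>"
    using finite_fm_below fin1 by (meson finite.insertI)
  then have y: "fm_below y y \<phi>" "\<forall>\<psi>\<in>G1. fm_below y y \<psi>" by auto
  have np: "\<not> provable (T \<union> G1) \<phi>"
  proof
    assume "provable (T \<union> G1) \<phi>"
    moreover have "insert (Neg \<phi>) (T \<union> G1) = T \<union> G1" by (auto simp: G1_def)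
    ultimately show False using con1 by (simp add: provable_iff_inconsistent)
  qed
  show ?thesis
  proof (cases \<phi>)
    case (AllN \<psi>)
    have "\<not> provable (T \<union> G1) (inst_N (Var y) \<psi>)"
      using generalize_N[OF T y(2)] y(1) np AllN by blast
    then show ?thesis using fin1 AllN
      by (intro exI[of _ "insert (Neg (inst_N (Var y) \<psi>)) G1"])
        (auto simp: decides_def provable_iff_inconsistent G1_def)
  next
    case (AllS \<psi>)
    have "\<not> provable (T \<union> G1) (inst_S y \<psi>)"
      using generalize_S[OF T y(2)] y(1) np AllS by blast
    then show ?thesis using fin1 AllS
      by (intro exI[of _ "insert (Neg (inst_S y \<psi>)) G1"])
        (auto simp: decides_def provable_iff_inconsistent G1_def)
  qed (use con1 fin1 in \<open>auto intro!: exI[of _ G1] simp: decides_def G1_def\<close>)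
qed

instance tm :: countable by countable_datatype
instance fm :: countable by countable_datatype

text \<open>
  Only \<open>T\<close> has to consist of sentences: the finitely many formulas of \<open>G\<close> leave fresh variables, so they
  may have parameters.
\<close>

lemma Henkin_extension:
  assumes T: "\<forall>\<phi>\<in>T. closed_fm \<phi>" and fin: "finite G" and con: "consistent (T \<union> G)"
  shows "\<exists>H. T \<union> G \<subseteq> H \<and> consistent H \<and> (\<forall>\<phi>. decides H \<phi>)"
proof -
  have "\<exists>g. \<forall>n. (finite (g n) \<and> consistent (T \<union> g n) \<and> G \<subseteq> g n) \<and>
      (g n \<subseteq> g (Suc n) \<and> decides (g (Suc n)) (from_nat n))"
  proof (rule dependent_nat_choice)
    show "\<exists>G'. finite G' \<and> consistent (T \<union> G') \<and> G \<subseteq> G'" using con fin by blast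
  next
    fix G1 n assume "finite G1 \<and> consistent (T \<union> G1) \<and> G \<subseteq> G1"
    then show "\<exists>G'. (finite G' \<and> consistent (T \<union> G') \<and> G \<subseteq> G') \<and>
        G1 \<subseteq> G' \<and> decides G' (from_nat n)"
      using Henkin_step[OF T, of G1 "from_nat n"] by (meson order_trans)
  qed
  then obtain g where g: "\<And>n. consistent (T \<union> g n)" "\<And>n. g n \<subseteq> g (Suc n)"
    "\<And>n. decides (g (Suc n)) (from_nat n)" "\<And>n. G \<subseteq> g n" by blast
  have chain: "m \<le> n \<Longrightarrow> g m \<subseteq> g n" for m n by (rule lift_Suc_mono_le[of g, OF g(2)])
  define H where "H = T \<union> (\<Union>n. g n)"
  have "\<exists>n. \<Delta> \<subseteq> T \<union> g n" if "finite \<Delta>" "\<Delta> \<subseteq> H" for \<Delta>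
    using that
  proof (induction \<Delta> rule: finite_induct)
    case (insert \<phi> \<Delta>)
    then obtain n where "\<Delta> \<subseteq> T \<union> g n" by blast
    moreover obtain m where "\<phi> \<in> T \<union> g m" using insert.prems by (auto simp: H_def)
    ultimately have "insert \<phi> \<Delta> \<subseteq> T \<union> g (max m n)"
      using chain[of m "max m n"] chain[of n "max m n"] by auto
    then show ?case by blast
  qed auto
  then have "consistent H"
    unfolding consistent_def using g(1) by (meson consistent_def provable_finite provable_mono)
  moreover have "decides H \<phi>" for \<phi>
    using g(3)[of "to_nat \<phi>"] by (auto simp: decides_def H_def)
  moreover have "T \<union> G \<subseteq> H" using g(4)[of 0] by (auto simp: H_def)
  ultimately show ?thesis by blast
qed

section \<open>Evaluation and soundness\<close>

primrec eval_tm :: "(nat \<Rightarrow> 'a::{zero,one,plus,times}) \<Rightarrow> tm \<Rightarrow> 'a" where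
  "eval_tm v (Var i) = v i"
| "eval_tm v Zero = 0"
| "eval_tm v One = 1"
| "eval_tm v (Add s t) = eval_tm v s + eval_tm v t"
| "eval_tm v (Mul s t) = eval_tm v s * eval_tm v t"

text \<open>
  Henkin semantics: the set quantifiers range over the members of \<open>S\<close>.
\<close>

primrec eval :: "'a set set \<Rightarrow> (nat \<Rightarrow> 'a::{zero,one,plus,times,ord}) \<Rightarrow> (nat \<Rightarrow> 'a set) \<Rightarrow> fm \<Rightarrow> bool"
where
  "eval S v V Bot \<longleftrightarrow> False"
| "eval S v V (Eq s t) \<longleftrightarrow> eval_tm v s = eval_tm v t"
| "eval S v V (Less s t) \<longleftrightarrow> eval_tm v s < eval_tm v t"
| "eval S v V (In t X) \<longleftrightarrow> eval_tm v t \<in> V X"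
| "eval S v V (Imp \<phi> \<psi>) \<longleftrightarrow> (eval S v V \<phi> \<longrightarrow> eval S v V \<psi>)"
| "eval S v V (AllN \<phi>) \<longleftrightarrow> (\<forall>x. eval S (case_nat x v) V \<phi>)"
| "eval S v V (AllS \<phi>) \<longleftrightarrow> (\<forall>X\<in>S. eval S v (case_nat X V) \<phi>)"

lemma eval_connectives [simp]:
  "eval S v V (Neg \<phi>) \<longleftrightarrow> \<not> eval S v V \<phi>"
  "eval S v V (And \<phi> \<psi>) \<longleftrightarrow> eval S v V \<phi> \<and> eval S v V \<psi>"
  "eval S v V (Or \<phi> \<psi>) \<longleftrightarrow> eval S v V \<phi> \<or> eval S v V \<psi>"
  "eval S v V (Iff \<phi> \<psi>) \<longleftrightarrow> (eval S v V \<phi> \<longleftrightarrow> eval S v V \<psi>)"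
  "eval S v V (ExN \<phi>) \<longleftrightarrow> (\<exists>x. eval S (case_nat x v) V \<phi>)"
  "eval S v V (ExS \<phi>) \<longleftrightarrow> (\<exists>X\<in>S. eval S v (case_nat X V) \<phi>)"
  by (auto simp: Neg_def And_def Or_def Iff_def ExN_def ExS_def)

lemma eval_sub_tm: "eval_tm v (sub_tm \<sigma> t) = eval_tm (\<lambda>i. eval_tm v (\<sigma> i)) t"
  by (induction t) auto

lemma eval_lift_tm [simp]: "eval_tm (case_nat x v) (lift_tm t) = eval_tm v t"
  by (simp add: lift_tm_def eval_sub_tm)

lemma eval_sub: "eval S v V (sub \<sigma> \<rho> \<phi>) = eval S (\<lambda>i. eval_tm v (\<sigma> i)) (\<lambda>i. V (\<rho> i)) \<phi>"
proof (induction \<phi> arbitrary: \<sigma> \<rho> v V)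
  case (AllN \<phi>)
  have "(\<lambda>i. eval_tm (case_nat x v) (case i of 0 \<Rightarrow> Var 0 | Suc i \<Rightarrow> lift_tm (\<sigma> i)))
      = case_nat x (\<lambda>i. eval_tm v (\<sigma> i))" for x
    by (auto simp: fun_eq_iff split: nat.split)
  then show ?case by (simp add: AllN.IH)
next
  case (AllS \<phi>)
  have "(\<lambda>i. case_nat X V (case i of 0 \<Rightarrow> 0 | Suc i \<Rightarrow> Suc (\<rho> i))) = case_nat X (\<lambda>i. V (\<rho> i))" for X
    by (auto simp: fun_eq_iff split: nat.split)
  then show ?case by (simp add: AllS.IH)
qed (simp_all add: eval_sub_tm)

lemma eval_lift_inst:
  "eval S (case_nat x v) V (lift_N \<phi>) = eval S v V \<phi>"
  "eval S v (case_nat X V) (lift_S \<phi>) = eval S v V \<phi>"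
  "eval S v V (inst_N t \<phi>) = eval S (case_nat (eval_tm v t) v) V \<phi>"
  "eval S v V (inst_S Y \<phi>) = eval S v (case_nat (V Y) V) \<phi>"
proof -
  have [simp]: "(\<lambda>i. eval_tm v (case_nat t Var i)) = case_nat (eval_tm v t) v"
    "(\<lambda>i. V (case_nat Y id i)) = case_nat (V Y) V"
    by (auto simp: fun_eq_iff split: nat.split)
  show "eval S (case_nat x v) V (lift_N \<phi>) = eval S v V \<phi>"
    "eval S v (case_nat X V) (lift_S \<phi>) = eval S v V \<phi>"
    "eval S v V (inst_N t \<phi>) = eval S (case_nat (eval_tm v t) v) V \<phi>"
    "eval S v V (inst_S Y \<phi>) = eval S v (case_nat (V Y) V) \<phi>"
    by (simp_all add: lift_N_def lift_S_def inst_N_def inst_S_def eval_sub)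
qed

lemma eval_tm_below: "tm_below n t \<Longrightarrow> (\<And>i. i < n \<Longrightarrow> v i = w i) \<Longrightarrow> eval_tm v t = eval_tm w t"
  by (induction t) auto

lemma eval_below:
  "fm_below n m \<phi> \<Longrightarrow> (\<And>i. i < n \<Longrightarrow> v i = w i) \<Longrightarrow> (\<And>i. i < m \<Longrightarrow> V i = W i)
    \<Longrightarrow> eval S v V \<phi> = eval S w W \<phi>"
proof (induction \<phi> arbitrary: n m v V w W)
  case (AllN \<phi>)
  have "eval S (case_nat x v) V \<phi> = eval S (case_nat x w) W \<phi>" for x
    by (rule AllN.IH[of "Suc n" m]) (use AllN.prems in \<open>auto split: nat.split\<close>)
  then show ?case by simp
next
  case (AllS \<phi>)
  have "eval S v (case_nat X V) \<phi> = eval S w (case_nat X W) \<phi>" for X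
    by (rule AllS.IH[of n "Suc m"]) (use AllS.prems in \<open>auto split: nat.split\<close>)
  then show ?case by simp
next
  case (Imp \<phi> \<psi>)
  then have "eval S v V \<phi> = eval S w W \<phi>" "eval S v V \<psi> = eval S w W \<psi>"
    using Imp.IH[of n m v w V W] by simp_all
  then show ?case by simp
next
  case (Eq s t)
  then have "eval_tm v s = eval_tm w s" "eval_tm v t = eval_tm w t"
    by (auto intro: eval_tm_below)
  then show ?case by simp
next
  case (Less s t)
  then have "eval_tm v s = eval_tm w s" "eval_tm v t = eval_tm w t"
    by (auto intro: eval_tm_below)
  then show ?case by simp
next
  case (In t X)
  then have "eval_tm v t = eval_tm w t" by (auto intro: eval_tm_below)
  then show ?case using In by simp
qed auto

lemma soundness:
  assumes "provable \<Gamma> \<phi>" and "\<And>i. V i \<in> S" and "\<And>\<psi>. \<psi> \<in> \<Gamma> \<Longrightarrow> eval S v V \<psi>"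
  shows "eval S v V \<phi>"
  using assms
proof (induction arbitrary: v V rule: provable.induct)
  case (Assm \<phi> \<Gamma>)
  then show ?case by blast
next
  case (ImpI \<phi> \<Gamma> \<psi>)
  have "eval S v V \<psi>" if "eval S v V \<phi>"
    by (rule ImpI.IH) (use that ImpI.prems in blast)+
  then show ?case by simp
next
  case (ImpE \<Gamma> \<phi> \<psi>)
  then have "eval S v V (Imp \<phi> \<psi>)" "eval S v V \<phi>" by blast+
  then show ?case by simp
next
  case (RAA \<phi> \<Gamma>)
  have "eval S v V Bot" if "eval S v V (Neg \<phi>)"
    by (rule RAA.IH) (use that RAA.prems in blast)+
  then show ?case by auto
next
  case (AllN_I \<Gamma> \<phi>)
  have "eval S (case_nat x v) V \<phi>" for x
    by (rule AllN_I.IH) (use AllN_I.prems in \<open>auto simp: eval_lift_inst\<close>)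
  then show ?case by simp
next
  case (AllN_E \<Gamma> \<phi> t)
  then have "eval S v V (AllN \<phi>)" by blast
  then show ?case by (simp add: eval_lift_inst)
next
  case (AllS_I \<Gamma> \<phi>)
  have "eval S v (case_nat X V) \<phi>" if "X \<in> S" for X
    by (rule AllS_I.IH) (use that AllS_I.prems in \<open>auto simp: eval_lift_inst split: nat.split\<close>)
  then show ?case by simp
next
  case (AllS_E \<Gamma> \<phi> X)
  then have "eval S v V (AllS \<phi>)" by blast
  then show ?case using AllS_E.prems(1) by (simp add: eval_lift_inst)
next
  case (Eq_refl \<Gamma> t)
  show ?case by simp
next
  case (Eq_subst \<Gamma> s t \<phi>)
  then have "eval S v V (Eq s t)" "eval S v V (inst_N s \<phi>)" by blast+
  then show ?case by (simp add: eval_lift_inst)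
qed

lemma closure_below: "fm_below n m \<phi> \<Longrightarrow> fm_below 0 0 ((AllS ^^ m) ((AllN ^^ n) \<phi>))"
proof -
  have N: "fm_below n m \<phi> \<Longrightarrow> fm_below 0 m ((AllN ^^ n) \<phi>)" for n m \<phi>
    by (induction n arbitrary: \<phi>) (simp_all add: funpow_swap1[of AllN] funpow_swap1[of AllS])
  have S: "fm_below 0 m \<phi> \<Longrightarrow> fm_below 0 0 ((AllS ^^ m) \<phi>)" for m \<phi>
    by (induction m arbitrary: \<phi>) (simp_all add: funpow_swap1[of AllN] funpow_swap1[of AllS])
  assume "fm_below n m \<phi>"
  from S[OF N[OF this]] show ?thesis .
qed

lemma eval_closure:
  assumes "eval S v V ((AllS ^^ m) ((AllN ^^ n) \<phi>))" and "fm_below n m \<phi>" and "\<And>i. W i \<in> S"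
  shows "eval S w W \<phi>"
proof -
  have N: "eval S v V ((AllN ^^ n) \<phi>) \<Longrightarrow> fm_below n m \<phi> \<Longrightarrow> eval S w V \<phi>" for n m \<phi> v w V
  proof (induction n arbitrary: \<phi> w)
    case 0
    have "eval S v V \<phi> = eval S w V \<phi>" by (rule eval_below[OF 0(2)]) auto
    then show ?case using 0(1) by simp
  next
    case (Suc n)
    have "eval S (\<lambda>i. w (Suc i)) V (AllN \<phi>)"
      using Suc.prems by - (rule Suc.IH, auto simp: funpow_swap1[of AllN] funpow_swap1[of AllS])
    then have "eval S (case_nat (w 0) (\<lambda>i. w (Suc i))) V \<phi>" by simp
    moreover have "case_nat (w 0) (\<lambda>i. w (Suc i)) = w"
      by (auto simp: fun_eq_iff split: nat.split)
    ultimately show ?case by simp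
  qed
  have S: "eval S v V ((AllS ^^ m) \<phi>) \<Longrightarrow> fm_below 0 m \<phi> \<Longrightarrow> (\<And>i. W i \<in> S) \<Longrightarrow> eval S v W \<phi>"
    for m \<phi> V W
  proof (induction m arbitrary: \<phi> W)
    case 0
    have "eval S v V \<phi> = eval S v W \<phi>" by (rule eval_below[OF 0(2)]) auto
    then show ?case using 0(1) by simp
  next
    case (Suc m)
    have "eval S v (\<lambda>i. W (Suc i)) (AllS \<phi>)"
      using Suc.prems by - (rule Suc.IH, auto simp: funpow_swap1[of AllN] funpow_swap1[of AllS])
    then have "eval S v (case_nat (W 0) (\<lambda>i. W (Suc i))) \<phi>" using Suc.prems(3) by simp
    moreover have "case_nat (W 0) (\<lambda>i. W (Suc i)) = W"
      by (auto simp: fun_eq_iff split: nat.split)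
    ultimately show ?case by simp
  qed
  have "fm_below 0 m ((AllN ^^ n) \<phi>)"
    using assms(2) by (induction n arbitrary: \<phi>) (auto simp: funpow_swap1[of AllN])
  from N[OF S[OF assms(1) this assms(3)] assms(2)] show ?thesis .
qed

lemmas e_defs = zero_e_def one_e_def add_e_def mul_e_def eq_e_def less_e_def in_e_def neg_e_def
  and_e_def or_e_def imp_e_def iff_e_def allN_e_def exN_e_def allS_e_def exS_e_def le_e_def
  sentence_def

lemma basic_axioms_below: "\<phi> \<in> basic_axioms \<Longrightarrow> fm_below 0 0 \<phi>"
  unfolding basic_axioms_def
  by (auto simp: e_defs Neg_def And_def Or_def Iff_def)

lemma RCA0_closed: "\<phi> \<in> RCA0 \<Longrightarrow> closed_fm \<phi>"
  unfolding RCA0_def universal_closures_def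
  by (auto intro: closed_fm_below basic_axioms_below closure_below)

lemma eval_induction_ax:
  "eval S v V (induction_ax \<phi>) \<longleftrightarrow>
    (eval S (case_nat 0 v) V \<phi> \<and>
      (\<forall>x. eval S (case_nat x v) V \<phi> \<longrightarrow> eval S (case_nat (x + 1) v) V \<phi>)
     \<longrightarrow> (\<forall>x. eval S (case_nat x v) V \<phi>))"
proof -
  have [simp]: "(\<lambda>i. eval_tm (case_nat x v) (case i of 0 \<Rightarrow> Add (Var 0) One | Suc x \<Rightarrow> Var (Suc x)))
      = case_nat (x + 1) v" for x
    by (auto simp: fun_eq_iff split: nat.split)
  show ?thesis by (simp add: induction_ax_def eval_lift_inst eval_sub)
qed

lemma eval_comprehension_ax:
  "eval S v V (comprehension_ax \<phi> \<psi>) \<longleftrightarrow>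
    ((\<forall>x. eval S (case_nat x v) V \<phi> = eval S (case_nat x v) V \<psi>) \<longrightarrow>
     (\<exists>X\<in>S. \<forall>x. x \<in> X \<longleftrightarrow> eval S (case_nat x v) V \<phi>))"
  by (simp add: comprehension_ax_def eval_lift_inst)

text \<open>
  The standard model shows the consistency of \<open>RCA0\<close>, so that a Henkin theory extending it exists outright.
\<close>

lemma RCA0_standard:
  fixes v :: "nat \<Rightarrow> nat"
  assumes "\<phi> \<in> RCA0"
  shows "eval UNIV v V \<phi>"
proof -
  have N: "(\<And>(v :: nat \<Rightarrow> nat) V. eval UNIV v V \<phi>) \<Longrightarrow> eval UNIV v V ((AllN ^^ n) \<phi>)"
    for n \<phi> and v :: "nat \<Rightarrow> nat" and V
    by (induction n arbitrary: v V) auto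
  have S: "(\<And>(v :: nat \<Rightarrow> nat) V. eval UNIV v V \<phi>) \<Longrightarrow> eval UNIV v V ((AllS ^^ n) \<phi>)"
    for n \<phi> and v :: "nat \<Rightarrow> nat" and V
    by (induction n arbitrary: v V) auto
  have "eval UNIV v V \<phi>" if "\<phi> \<in> basic_axioms" for v :: "nat \<Rightarrow> nat" and V
    using that unfolding basic_axioms_def
    by (auto simp: e_defs algebra_simps)
  moreover have "eval UNIV v V (induction_ax \<psi>)" for v :: "nat \<Rightarrow> nat" and V \<psi>
    unfolding eval_induction_ax
  proof (intro impI allI)
    fix x
    assume "eval UNIV (case_nat 0 v) V \<psi> \<and>
      (\<forall>x. eval UNIV (case_nat x v) V \<psi> \<longrightarrow> eval UNIV (case_nat (x + 1) v) V \<psi>)"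
    then show "eval UNIV (case_nat x v) V \<psi>" by (induction x) auto
  qed
  moreover have "eval UNIV v V (comprehension_ax \<psi> \<chi>)" for v :: "nat \<Rightarrow> nat" and V \<psi> \<chi>
    unfolding eval_comprehension_ax
    by (auto intro: exI[of _ "{x. eval UNIV (case_nat x v) V \<psi>}"])
  ultimately show ?thesis
    using assms unfolding RCA0_def universal_closures_def by (auto intro!: S N)
qed

lemma RCA0_consistent: "consistent RCA0"
  unfolding consistent_def
  using soundness[of RCA0 Bot "\<lambda>_. {} :: nat set" UNIV "\<lambda>_. 0"] RCA0_standard by auto

section \<open>The model\<close>

text \<open>
  A type cannot be defined inside a proof by contradiction. The Henkin theory is therefore chosen once and
  for all: one that refutes the implication if that is possible, and any extension of \<open>RCA0\<close> otherwise.
\<close>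

definition H :: "fm set" where
  "H = (SOME H. RCA0 \<subseteq> H \<and> consistent H \<and> (\<forall>\<phi>. decides H \<phi>) \<and>
          (\<not> provable RCA0 (Imp CL_B1 SC) \<longrightarrow> Neg (Imp CL_B1 SC) \<in> H))"

lemma H: "RCA0 \<subseteq> H" "consistent H" "decides H \<phi>"
  "\<not> provable RCA0 (Imp CL_B1 SC) \<Longrightarrow> Neg (Imp CL_B1 SC) \<in> H"
proof -
  let ?G = "if provable RCA0 (Imp CL_B1 SC) then {} else {Neg (Imp CL_B1 SC)}"
  have "consistent (RCA0 \<union> ?G)"
    using RCA0_consistent by (auto simp: provable_iff_inconsistent)
  then have "\<exists>H. RCA0 \<union> ?G \<subseteq> H \<and> consistent H \<and> (\<forall>\<phi>. decides H \<phi>)"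
    using Henkin_extension[of RCA0 ?G] RCA0_closed by simp
  then obtain H0 where "RCA0 \<union> ?G \<subseteq> H0 \<and> consistent H0 \<and> (\<forall>\<phi>. decides H0 \<phi>)"
    by blast
  then have "\<exists>H. RCA0 \<subseteq> H \<and> consistent H \<and> (\<forall>\<phi>. decides H \<phi>) \<and>
          (\<not> provable RCA0 (Imp CL_B1 SC) \<longrightarrow> Neg (Imp CL_B1 SC) \<in> H)"
    by (intro exI[of _ H0]) auto
  from someI_ex[OF this] show "RCA0 \<subseteq> H" "consistent H" "decides H \<phi>"
    "\<not> provable RCA0 (Imp CL_B1 SC) \<Longrightarrow> Neg (Imp CL_B1 SC) \<in> H"
    unfolding H_def by blast+
qed

lemma H_Neg: "Neg \<phi> \<in> H \<longleftrightarrow> \<phi> \<notin> H"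
proof
  assume a: "Neg \<phi> \<in> H"
  show "\<phi> \<notin> H"
  proof
    assume "\<phi> \<in> H"
    then have "provable H \<phi>" by (rule provable.Assm)
    then show False using H(2) a by (simp add: provable_iff_inconsistent insert_absorb)
  qed
next
  assume "\<phi> \<notin> H"
  then show "Neg \<phi> \<in> H" using H(3)[of \<phi>] by (auto simp: decides_def)
qed

lemma H_provable: "provable H \<phi> \<longleftrightarrow> \<phi> \<in> H"
  using H_Neg H(2) by (metis insert_absorb provable.Assm provable_iff_inconsistent)

lemma H_Bot: "Bot \<notin> H"
  using H(2) H_provable by (simp add: consistent_def)

lemma H_Imp: "Imp \<phi> \<psi> \<in> H \<longleftrightarrow> (\<phi> \<in> H \<longrightarrow> \<psi> \<in> H)"
proof
  assume "Imp \<phi> \<psi> \<in> H"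
  then show "\<phi> \<in> H \<longrightarrow> \<psi> \<in> H" using provable.ImpE[of H \<phi> \<psi>] by (simp add: H_provable)
next
  assume a: "\<phi> \<in> H \<longrightarrow> \<psi> \<in> H"
  have "provable (insert \<phi> H) \<psi>"
  proof (cases "\<phi> \<in> H")
    case True
    then show ?thesis using a by (auto intro: provable.Assm)
  next
    case False
    then have n: "Neg \<phi> \<in> H" by (simp add: H_Neg)
    have "provable (insert (Neg \<psi>) (insert \<phi> H)) Bot"
      by (rule provable.ImpE[of _ \<phi>]) (use n in \<open>auto intro!: provable.Assm simp: Neg_def\<close>)
    then show ?thesis by (rule provable.RAA)
  qed
  then have "provable H (Imp \<phi> \<psi>)" by (rule provable.ImpI)
  then show "Imp \<phi> \<psi> \<in> H" by (simp add: H_provable)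
qed

lemma H_AllN: "AllN \<phi> \<in> H \<longleftrightarrow> (\<forall>t. inst_N t \<phi> \<in> H)"
proof
  assume "AllN \<phi> \<in> H"
  then show "\<forall>t. inst_N t \<phi> \<in> H" using provable.AllN_E[of H \<phi>] by (simp add: H_provable)
next
  assume "\<forall>t. inst_N t \<phi> \<in> H"
  then show "AllN \<phi> \<in> H" using H(3)[of "AllN \<phi>"] by (auto simp: decides_def H_Neg)
qed

lemma H_AllS: "AllS \<phi> \<in> H \<longleftrightarrow> (\<forall>X. inst_S X \<phi> \<in> H)"
proof
  assume "AllS \<phi> \<in> H"
  then show "\<forall>X. inst_S X \<phi> \<in> H" using provable.AllS_E[of H \<phi>] by (simp add: H_provable)
next
  assume "\<forall>X. inst_S X \<phi> \<in> H"
  then show "AllS \<phi> \<in> H" using H(3)[of "AllS \<phi>"] by (auto simp: decides_def H_Neg)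
qed

lemma H_Eq_refl: "Eq t t \<in> H"
  using provable.Eq_refl[of H t] by (simp add: H_provable)

lemma H_Eq_subst: "Eq s t \<in> H \<Longrightarrow> inst_N s \<phi> \<in> H \<Longrightarrow> inst_N t \<phi> \<in> H"
  using provable.Eq_subst[of H s t \<phi>] by (simp add: H_provable)

lemma inst_lift_tm [simp]: "sub_tm (case_nat t Var) (lift_tm s) = s"
  by (simp add: lift_tm_def sub_tm_comp)

lemma H_Eq_sym: "Eq s t \<in> H \<Longrightarrow> Eq t s \<in> H"
  using H_Eq_subst[of s t "Eq (Var 0) (lift_tm s)"] by (simp add: inst_N_def H_Eq_refl)

lemma H_Eq_trans: "Eq s t \<in> H \<Longrightarrow> Eq t u \<in> H \<Longrightarrow> Eq s u \<in> H"
  using H_Eq_subst[of t u "Eq (lift_tm s) (Var 0)"] by (simp add: inst_N_def)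

quotient_type number = tm / "\<lambda>s t. Eq s t \<in> H"
  by (rule equivpI) (auto simp: reflp_def symp_def transp_def H_Eq_refl
      intro: H_Eq_sym H_Eq_trans)

lemma H_Add_cong: "Eq s s' \<in> H \<Longrightarrow> Eq t t' \<in> H \<Longrightarrow> Eq (Add s t) (Add s' t') \<in> H"
  using H_Eq_subst[of s s' "Eq (Add (lift_tm s) (lift_tm t)) (Add (Var 0) (lift_tm t))"]
    H_Eq_subst[of t t' "Eq (Add (lift_tm s) (lift_tm t)) (Add (lift_tm s') (Var 0))"]
  by (simp add: inst_N_def H_Eq_refl)

lemma H_Mul_cong: "Eq s s' \<in> H \<Longrightarrow> Eq t t' \<in> H \<Longrightarrow> Eq (Mul s t) (Mul s' t') \<in> H"
  using H_Eq_subst[of s s' "Eq (Mul (lift_tm s) (lift_tm t)) (Mul (Var 0) (lift_tm t))"]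
    H_Eq_subst[of t t' "Eq (Mul (lift_tm s) (lift_tm t)) (Mul (lift_tm s') (Var 0))"]
  by (simp add: inst_N_def H_Eq_refl)

lemma H_Less_cong: "Eq s s' \<in> H \<Longrightarrow> Eq t t' \<in> H \<Longrightarrow> Less s t \<in> H \<Longrightarrow> Less s' t' \<in> H"
  using H_Eq_subst[of s s' "Less (Var 0) (lift_tm t)"] H_Eq_subst[of t t' "Less (lift_tm s') (Var 0)"]
  by (simp add: inst_N_def)

lemma H_In_cong: "Eq s s' \<in> H \<Longrightarrow> In s X \<in> H \<Longrightarrow> In s' X \<in> H"
  using H_Eq_subst[of s s' "In (Var 0) X"] by (simp add: inst_N_def)

instantiation number :: "{zero, one, plus, times, ord}"
begin

lift_definition zero_number :: number is Zero .
lift_definition one_number :: number is One .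
lift_definition plus_number :: "number \<Rightarrow> number \<Rightarrow> number" is Add by (rule H_Add_cong)
lift_definition times_number :: "number \<Rightarrow> number \<Rightarrow> number" is Mul by (rule H_Mul_cong)
lift_definition less_number :: "number \<Rightarrow> number \<Rightarrow> bool" is "\<lambda>s t. Less s t \<in> H"
  by (meson H_Less_cong H_Eq_sym)
definition less_eq_number :: "number \<Rightarrow> number \<Rightarrow> bool" where
  "less_eq_number x y \<longleftrightarrow> x < y \<or> x = y"

instance ..

end

lift_definition element :: "number \<Rightarrow> nat \<Rightarrow> bool" is "\<lambda>t X. In t X \<in> H"
  by (meson H_In_cong H_Eq_sym)

definition extension :: "nat \<Rightarrow> number set" where "extension X = {x. element x X}"

definition Sets :: "number set set" where "Sets = range extension"

lemma eval_tm_model: "eval_tm (\<lambda>i. abs_number (\<sigma> i)) t = abs_number (sub_tm \<sigma> t)"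
  by (induction t) (simp_all add: zero_number.abs_eq one_number.abs_eq plus_number.abs_eq
      times_number.abs_eq)

text \<open>
  Every number of the model is the class of a term and every set the extension of a variable. Substituting
  these representatives turns satisfaction into membership in \<open>H\<close>; the Henkin witnesses handle the quantifiers.
\<close>

lemma truth:
  "sub \<sigma> \<rho> \<phi> \<in> H \<longleftrightarrow> eval Sets (\<lambda>i. abs_number (\<sigma> i)) (\<lambda>i. extension (\<rho> i)) \<phi>"
proof (induction \<phi> arbitrary: \<sigma> \<rho>)
  case Bot
  then show ?case by (simp add: H_Bot)
next
  case (Eq s t)
  then show ?case by (simp add: eval_tm_model number.abs_eq_iff)
next
  case (Less s t)
  then show ?case by (simp add: eval_tm_model less_number.abs_eq)
next
  case (In t X)
  then show ?case by (simp add: eval_tm_model extension_def element.abs_eq)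
next
  case (Imp \<phi> \<psi>)
  then show ?case by (simp add: H_Imp)
next
  case (AllN \<phi>)
  have 1: "inst_N t (sub (case_nat (Var 0) (\<lambda>i. lift_tm (\<sigma> i))) \<rho> \<phi>) = sub (case_nat t \<sigma>) \<rho> \<phi>" for t
    by (auto simp: inst_N_def sub_comp fun_eq_iff
        intro!: arg_cong[where f="\<lambda>f. sub f _ _"] split: nat.split)
  have 2: "(\<lambda>i. abs_number (case_nat t \<sigma> i)) = case_nat (abs_number t) (\<lambda>i. abs_number (\<sigma> i))" for t
    by (auto simp: fun_eq_iff split: nat.split)
  have "(\<forall>t. P (abs_number t)) \<longleftrightarrow> (\<forall>x. P x)" for P
    by (metis Quotient_abs_rep[OF Quotient_number])
  then show ?case by (simp add: H_AllN 1 AllN.IH 2)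
next
  case (AllS \<phi>)
  have 1: "inst_S X (sub \<sigma> (case_nat 0 (\<lambda>i. Suc (\<rho> i))) \<phi>) = sub \<sigma> (case_nat X \<rho>) \<phi>" for X
    by (auto simp: inst_S_def sub_comp fun_eq_iff
        intro!: arg_cong[where f="\<lambda>f. sub _ f _"] split: nat.split)
  have 2: "(\<lambda>i. extension (case_nat X \<rho> i)) = case_nat (extension X) (\<lambda>i. extension (\<rho> i))" for X
    by (auto simp: fun_eq_iff split: nat.split)
  show ?case by (simp add: H_AllS 1 AllS.IH 2 Sets_def)
qed

lemma RCA0_model: "\<phi> \<in> RCA0 \<Longrightarrow> \<exists>v V. eval Sets v V \<phi>"
  using truth[of Var id \<phi>] H(1) by auto

lemma basic_axiom_model:
  assumes a: "\<phi> \<in> basic_axioms"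
  shows "eval Sets v V \<phi>"
proof -
  obtain w W where "eval Sets w W \<phi>" using a RCA0_model[of \<phi>] by (auto simp: RCA0_def)
  moreover have "eval Sets w W \<phi> = eval Sets v V \<phi>"
    by (rule eval_below[OF basic_axioms_below[OF a]]) auto
  ultimately show ?thesis by simp
qed

lemma closure_model:
  assumes "\<phi> \<in> A" "universal_closures A \<subseteq> RCA0" "\<And>i. V i \<in> Sets"
  shows "eval Sets v V \<phi>"
proof -
  obtain n m where b: "fm_below n m \<phi>" using fm_below_exists by blast
  then have "(AllS ^^ m) ((AllN ^^ n) \<phi>) \<in> RCA0"
    using assms by (auto simp: universal_closures_def)
  then obtain w W where "eval Sets w W ((AllS ^^ m) ((AllN ^^ n) \<phi>))" using RCA0_model by blast
  then show ?thesis by (rule eval_closure[OF _ b assms(3)])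
qed

lemma induction_model:
  assumes "is_Sigma1 \<phi>" and "\<And>i. V i \<in> Sets" and "eval Sets (case_nat 0 v) V \<phi>"
    and "\<And>x. eval Sets (case_nat x v) V \<phi> \<Longrightarrow> eval Sets (case_nat (x + 1) v) V \<phi>"
  shows "eval Sets (case_nat x v) V \<phi>"
  using closure_model[of "induction_ax \<phi>" "{induction_ax \<phi> | \<phi>. is_Sigma1 \<phi>}" V v] assms
  by (auto simp: eval_induction_ax RCA0_def)

lemma comprehension_model:
  assumes "is_Sigma1 \<phi>" "is_Pi1 \<psi>" and "\<And>i. V i \<in> Sets"
    and "\<And>x. eval Sets (case_nat x v) V \<phi> = eval Sets (case_nat x v) V \<psi>"
  shows "{x. eval Sets (case_nat x v) V \<phi>} \<in> Sets"
proof -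
  have "eval Sets v V (comprehension_ax \<phi> \<psi>)"
    by (rule closure_model[of _ "{comprehension_ax \<phi> \<psi> | \<phi> \<psi>. is_Sigma1 \<phi> \<and> is_Pi1 \<psi>}"])
      (use assms in \<open>auto simp: RCA0_def\<close>)
  then obtain X where "X \<in> Sets" "\<forall>x. x \<in> X \<longleftrightarrow> eval Sets (case_nat x v) V \<phi>"
    using assms(4) by (auto simp: eval_comprehension_ax)
  then have "{x. eval Sets (case_nat x v) V \<phi>} = X" "X \<in> Sets" by auto
  then show ?thesis by simp
qed

lemma basic_axioms_model:
  fixes m n :: number
  shows "n + 1 \<noteq> 0" "m + 1 = n + 1 \<Longrightarrow> m = n" "m + 0 = m" "m + (n + 1) = m + n + 1"
    "m * 0 = 0" "m * (n + 1) = m * n + m" "\<not> m < 0" "m < n + 1 \<longleftrightarrow> m < n \<or> m = n"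
proof -
  have *: "\<forall>\<phi>\<in>basic_axioms. eval Sets v V \<phi>" for v V by (simp add: basic_axiom_model)
  show "n + 1 \<noteq> 0" "m + 1 = n + 1 \<Longrightarrow> m = n" "m + 0 = m" "m + (n + 1) = m + n + 1"
    "m * 0 = 0" "m * (n + 1) = m * n + m" "\<not> m < 0" "m < n + 1 \<longleftrightarrow> m < n \<or> m = n"
    using * unfolding basic_axioms_def by (simp_all add: e_defs)
qed

section \<open>Definable predicates\<close>

lemma bounded_fm_sub: "bounded_fm \<phi> \<Longrightarrow> bounded_fm (sub \<sigma> \<rho> \<phi>)"
proof (induction arbitrary: \<sigma> \<rho> rule: bounded_fm.induct)
  case (6 \<phi> t)
  have "sub_tm (case_nat (Var 0) (\<lambda>i. lift_tm (\<sigma> i))) (lift_tm t) = lift_tm (sub_tm \<sigma> t)"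
    by (simp add: lift_tm_def sub_tm_comp)
  then show ?case by (simp add: 6 bounded_fm.intros)
next
  case (7 \<phi> t)
  have "sub_tm (case_nat (Var 0) (\<lambda>i. lift_tm (\<sigma> i))) (lift_tm t) = lift_tm (sub_tm \<sigma> t)"
    by (simp add: lift_tm_def sub_tm_comp)
  moreover have "bounded_fm (ExN (And (Less (Var 0) (lift_tm (sub_tm \<sigma> t))) (sub \<sigma>' \<rho> \<phi>)))" for \<sigma>'
    by (intro bounded_fm.intros 7)
  ultimately show ?case by (simp add: ExN_def And_def Neg_def)
qed (auto intro: bounded_fm.intros)

text \<open>
  The model is countable, so that a single valuation can name all of its elements. In \<open>mix v\<close> the odd
  variables carry these fixed parameters and the even ones the arguments \<open>v\<close>; together with \<open>extension\<close>,
  which names all sets, this allows definability with parameters to be stated for predicates on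
  \<open>v\<close> alone, without bookkeeping of the parameters that a formula uses. An argument bound by a quantifier is
  always \<open>v 0\<close>, and the closure rules below have the form in which higher-order unification applies them.
\<close>

definition param :: "nat \<Rightarrow> number" where "param n = abs_number (from_nat n)"

lemma param_surj: "\<exists>n. x = param n"
  unfolding param_def
  by (metis Quotient_abs_rep[OF Quotient_number] from_nat_to_nat)

definition mix :: "(nat \<Rightarrow> number) \<Rightarrow> nat \<Rightarrow> number" where
  "mix v i = (if even i then v (i div 2) else param (i div 2))"

definition polynomial :: "((nat \<Rightarrow> number) \<Rightarrow> number) \<Rightarrow> bool" where
  "polynomial f \<longleftrightarrow> (\<exists>t. \<forall>v. f v = eval_tm (mix v) t)"

definition Delta0 :: "((nat \<Rightarrow> number) \<Rightarrow> bool) \<Rightarrow> bool" where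
  "Delta0 P \<longleftrightarrow> (\<exists>\<theta>. bounded_fm \<theta> \<and> (\<forall>v. P v \<longleftrightarrow> eval Sets (mix v) extension \<theta>))"

definition Sigma1 :: "((nat \<Rightarrow> number) \<Rightarrow> bool) \<Rightarrow> bool" where
  "Sigma1 P \<longleftrightarrow> (\<exists>Q. Delta0 (\<lambda>v. Q (v 0) (\<lambda>i. v (Suc i))) \<and> (\<forall>v. P v \<longleftrightarrow> (\<exists>x. Q x v)))"

lemma polynomial_var: "polynomial (\<lambda>v. v i)"
  unfolding polynomial_def by (intro exI[of _ "Var (2 * i)"]) (simp add: mix_def)

lemma polynomial_const: "polynomial (\<lambda>v. c)"
proof -
  obtain n where "c = param n" using param_surj by blast
  then show ?thesis
    unfolding polynomial_def by (intro exI[of _ "Var (2 * n + 1)"]) (simp add: mix_def)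
qed

lemma polynomial_add: "polynomial f \<Longrightarrow> polynomial g \<Longrightarrow> polynomial (\<lambda>v. f v + g v)"
  unfolding polynomial_def by (metis eval_tm.simps(4))

lemma polynomial_mult: "polynomial f \<Longrightarrow> polynomial g \<Longrightarrow> polynomial (\<lambda>v. f v * g v)"
  unfolding polynomial_def by (metis eval_tm.simps(5))

lemmas polynomial_intros = polynomial_var polynomial_const polynomial_add polynomial_mult

lemma Delta0_eq: "polynomial f \<Longrightarrow> polynomial g \<Longrightarrow> Delta0 (\<lambda>v. f v = g v)"
  unfolding polynomial_def Delta0_def by (metis bounded_fm.intros(2) eval.simps(2))

lemma Delta0_less: "polynomial f \<Longrightarrow> polynomial g \<Longrightarrow> Delta0 (\<lambda>v. f v < g v)"
  unfolding polynomial_def Delta0_def by (metis bounded_fm.intros(3) eval.simps(3))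

lemma Delta0_mem: "polynomial f \<Longrightarrow> X \<in> Sets \<Longrightarrow> Delta0 (\<lambda>v. f v \<in> X)"
  unfolding polynomial_def Delta0_def Sets_def by (metis bounded_fm.intros(4) eval.simps(4) rangeE)

lemma Delta0_False: "Delta0 (\<lambda>v. False)"
  unfolding Delta0_def by (metis bounded_fm.intros(1) eval.simps(1))

lemma Delta0_imp: "Delta0 P \<Longrightarrow> Delta0 Q \<Longrightarrow> Delta0 (\<lambda>v. P v \<longrightarrow> Q v)"
  unfolding Delta0_def by (metis bounded_fm.intros(5) eval.simps(5))

lemma Delta0_not: "Delta0 P \<Longrightarrow> Delta0 (\<lambda>v. \<not> P v)"
  using Delta0_imp[OF _ Delta0_False] by simp

lemma Delta0_True: "Delta0 (\<lambda>v. True)"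
  using Delta0_not[OF Delta0_False] by simp

lemma Delta0_or: "Delta0 P \<Longrightarrow> Delta0 Q \<Longrightarrow> Delta0 (\<lambda>v. P v \<or> Q v)"
  using Delta0_imp[OF Delta0_not] by (simp add: disj_imp)

lemma Delta0_and: "Delta0 P \<Longrightarrow> Delta0 Q \<Longrightarrow> Delta0 (\<lambda>v. P v \<and> Q v)"
  using Delta0_not[OF Delta0_imp[OF _ Delta0_not]] by simp

lemma Delta0_le: "polynomial f \<Longrightarrow> polynomial g \<Longrightarrow> Delta0 (\<lambda>v. f v \<le> g v)"
  unfolding less_eq_number_def by (intro Delta0_or Delta0_less Delta0_eq)

lemma Delta0_subst:
  assumes "Delta0 P" and "\<And>i. polynomial (\<lambda>v. g v i)"
  shows "Delta0 (\<lambda>v. P (g v))"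
proof -
  obtain \<theta> where \<theta>: "bounded_fm \<theta>" "\<And>v. P v \<longleftrightarrow> eval Sets (mix v) extension \<theta>"
    using assms(1) by (auto simp: Delta0_def)
  obtain t where t: "\<And>i v. g v i = eval_tm (mix v) (t i)"
    using assms(2) unfolding polynomial_def by metis
  let ?\<sigma> = "\<lambda>i. if even i then t (i div 2) else Var i"
  have "(\<lambda>i. eval_tm (mix v) (?\<sigma> i)) = mix (g v)" for v
    by (auto simp: fun_eq_iff t mix_def)
  then have "P (g v) \<longleftrightarrow> eval Sets (mix v) extension (sub ?\<sigma> id \<theta>)" for v
    by (simp only: eval_sub \<theta>(2) id_apply)
  then show ?thesis unfolding Delta0_def using bounded_fm_sub[OF \<theta>(1)] by blast
qed

text \<open>
  A quantifier puts its variable at index 0 and shifts all others, whereas \<open>mix (case_nat x v)\<close> leaves the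
  parameters in place. This renaming mediates between the two.
\<close>

definition unmix :: "nat \<Rightarrow> tm" where
  "unmix i = (if i = 0 then Var 0 else if even i then Var (i - 1) else Var (Suc i))"

lemma eval_unmix:
  "eval Sets (case_nat x (mix v)) extension (sub unmix id \<theta>)
    = eval Sets (mix (case_nat x v)) extension \<theta>"
proof -
  have "eval_tm (case_nat x (mix v)) (unmix i) = mix (case_nat x v) i" for i
  proof (cases "i = 0 \<or> odd i")
    case True
    then show ?thesis by (auto simp: unmix_def mix_def)
  next
    case False
    then obtain j where "i = 2 * Suc j" by (metis evenE not0_implies_Suc mult_zero_right)
    then show ?thesis by (simp add: unmix_def mix_def)
  qed
  then show ?thesis by (simp add: eval_sub)
qed

lemma Delta0_ball:
  assumes "Delta0 (\<lambda>v. P (v 0) (\<lambda>i. v (Suc i)))" and "polynomial f"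
  shows "Delta0 (\<lambda>v. \<forall>x<f v. P x v)"
proof -
  obtain \<theta> where \<theta>: "bounded_fm \<theta>" "\<And>v. P (v 0) (\<lambda>i. v (Suc i)) \<longleftrightarrow> eval Sets (mix v) extension \<theta>"
    using assms(1) by (auto simp: Delta0_def)
  have P: "P x v \<longleftrightarrow> eval Sets (case_nat x (mix v)) extension (sub unmix id \<theta>)" for x v
    using \<theta>(2)[of "case_nat x v"] by (simp add: eval_unmix)
  obtain t where t: "\<And>v. f v = eval_tm (mix v) t"
    using assms(2) by (auto simp: polynomial_def)
  show ?thesis
    unfolding Delta0_def
    by (intro exI[of _ "AllN (Imp (Less (Var 0) (lift_tm t)) (sub unmix id \<theta>))"] conjI
        bounded_fm.intros bounded_fm_sub \<theta>(1)) (simp add: P t)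
qed

lemma Delta0_bex:
  "Delta0 (\<lambda>v. P (v 0) (\<lambda>i. v (Suc i))) \<Longrightarrow> polynomial f \<Longrightarrow> Delta0 (\<lambda>v. \<exists>x<f v. P x v)"
  using Delta0_not[OF Delta0_ball[of "\<lambda>x v. \<not> P x v", OF Delta0_not]] by simp

lemma Sigma1_Delta0: "Delta0 P \<Longrightarrow> Sigma1 P"
  unfolding Sigma1_def
  by (rule exI[of _ "\<lambda>x. P"]) (simp add: Delta0_subst[OF _ polynomial_var])

lemma Sigma1_ex_Delta0:
  "Delta0 (\<lambda>v. P (v 0) (\<lambda>i. v (Suc i))) \<Longrightarrow> Sigma1 (\<lambda>v. \<exists>x. P x v)"
  unfolding Sigma1_def by blast

lemma Sigma1_or: "Sigma1 P \<Longrightarrow> Sigma1 Q \<Longrightarrow> Sigma1 (\<lambda>v. P v \<or> Q v)"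
  unfolding Sigma1_def
proof (elim exE conjE)
  fix P' Q'
  assume "Delta0 (\<lambda>v. P' (v 0) (\<lambda>i. v (Suc i)))" "\<forall>v. P v \<longleftrightarrow> (\<exists>x. P' x v)"
    "Delta0 (\<lambda>v. Q' (v 0) (\<lambda>i. v (Suc i)))" "\<forall>v. Q v \<longleftrightarrow> (\<exists>x. Q' x v)"
  then show "\<exists>R. Delta0 (\<lambda>v. R (v 0) (\<lambda>i. v (Suc i))) \<and> (\<forall>v. (P v \<or> Q v) \<longleftrightarrow> (\<exists>x. R x v))"
    by (intro exI[of _ "\<lambda>x v. P' x v \<or> Q' x v"]) (auto intro: Delta0_or)
qed

text \<open>
  The valuation on the right, apart from its value at 0, does not depend on \<open>x\<close>, as the axiom schemes require.
\<close>

lemma mix_case_nat: "mix (case_nat x (\<lambda>_. 0)) = case_nat x (\<lambda>i. mix (\<lambda>_. 0) (Suc i))"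
  by (auto simp: fun_eq_iff mix_def split: nat.split)

lemma Sigma1_formula:
  assumes "Sigma1 (\<lambda>v. P (v 0))"
  obtains \<theta> where "bounded_fm \<theta>"
    "\<And>x. P x \<longleftrightarrow> eval Sets (case_nat x (\<lambda>i. mix (\<lambda>_. 0) (Suc i))) extension (ExN \<theta>)"
proof -
  obtain Q where Q: "Delta0 (\<lambda>v. Q (v 0) (\<lambda>i. v (Suc i)))" "\<And>v. P (v 0) \<longleftrightarrow> (\<exists>x. Q x v)"
    using assms by (auto simp: Sigma1_def)
  then obtain \<theta> where \<theta>: "bounded_fm \<theta>"
    "\<And>v. Q (v 0) (\<lambda>i. v (Suc i)) \<longleftrightarrow> eval Sets (mix v) extension \<theta>"
    by (auto simp: Delta0_def)
  have "Q y v \<longleftrightarrow> eval Sets (case_nat y (mix v)) extension (sub unmix id \<theta>)" for y v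
    using \<theta>(2)[of "case_nat y v"] by (simp add: eval_unmix)
  then have "P x \<longleftrightarrow> eval Sets (mix (case_nat x (\<lambda>_. 0))) extension (ExN (sub unmix id \<theta>))" for x
    using Q(2)[of "case_nat x (\<lambda>_. 0)"] by simp
  then show ?thesis using that[OF bounded_fm_sub[OF \<theta>(1), of unmix id]] by (simp only: mix_case_nat)
qed

lemma extension_Sets: "extension i \<in> Sets"
  by (simp add: Sets_def)

lemma Sigma1_induct:
  assumes "Sigma1 (\<lambda>v. P (v 0))" and "P 0" and "\<And>x. P x \<Longrightarrow> P (x + 1)"
  shows "P x"
proof -
  obtain \<theta> where \<theta>: "bounded_fm \<theta>"
    "\<And>x. P x \<longleftrightarrow> eval Sets (case_nat x (\<lambda>i. mix (\<lambda>_. 0) (Suc i))) extension (ExN \<theta>)"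
    using Sigma1_formula[OF assms(1)] by blast
  show ?thesis
    unfolding \<theta>(2)
    by (rule induction_model) (use \<theta> assms extension_Sets in \<open>auto simp: is_Sigma1_def simp del: eval_connectives\<close>)
qed

lemma Delta1_comprehension:
  assumes "Sigma1 (\<lambda>v. P (v 0))" and "Sigma1 (\<lambda>v. \<not> P (v 0))"
  shows "{x. P x} \<in> Sets"
proof -
  let ?w = "\<lambda>i. mix (\<lambda>_. 0) (Suc i)"
  obtain \<theta> where \<theta>: "bounded_fm \<theta>" "\<And>x. P x \<longleftrightarrow> eval Sets (case_nat x ?w) extension (ExN \<theta>)"
    using Sigma1_formula[OF assms(1)] by blast
  obtain \<chi> where \<chi>: "bounded_fm \<chi>" "\<And>x. \<not> P x \<longleftrightarrow> eval Sets (case_nat x ?w) extension (ExN \<chi>)"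
    using Sigma1_formula[OF assms(2)] by blast
  have "eval Sets (case_nat x ?w) extension (ExN \<theta>)
      = eval Sets (case_nat x ?w) extension (AllN (Neg \<chi>))" for x
    using \<theta>(2)[of x] \<chi>(2)[of x] by auto
  moreover have "is_Sigma1 (ExN \<theta>)" "is_Pi1 (AllN (Neg \<chi>))"
    using \<theta>(1) \<chi>(1) by (auto simp: is_Sigma1_def is_Pi1_def Neg_def intro: bounded_fm.intros)
  ultimately have "{x. eval Sets (case_nat x ?w) extension (ExN \<theta>)} \<in> Sets"
    by (intro comprehension_model[of "ExN \<theta>" "AllN (Neg \<chi>)"]) (auto simp: extension_Sets)
  then show ?thesis by (simp only: \<theta>(2))
qed

lemmas Delta0_induct = Sigma1_induct[OF Sigma1_Delta0]

lemmas Delta0_basic = Delta0_eq Delta0_less Delta0_le Delta0_mem Delta0_False Delta0_True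
  Delta0_not Delta0_or Delta0_and Delta0_imp

section \<open>The numbers form an ordered semiring\<close>

lemma number_cases: "x = 0 \<or> (\<exists>y :: number. x = y + 1)"
proof -
  have "Sigma1 (\<lambda>v. v 0 = 0 \<or> (\<exists>y. v 0 = y + 1))"
    by (intro Sigma1_or Sigma1_ex_Delta0 Sigma1_Delta0 Delta0_basic polynomial_intros)
  from Sigma1_induct[of "\<lambda>x. x = 0 \<or> (\<exists>y. x = y + 1)", OF this] show ?thesis by blast
qed

named_theorems number_simps
lemmas [number_simps] = basic_axioms_model(3-6)

lemma number_add_0 [number_simps]: "0 + n = (n::number)"
  by (rule Delta0_induct, intro Delta0_basic polynomial_intros)
    (simp_all add: number_simps)

lemma number_add_Suc: "(m + 1) + n = (m + n) + (1::number)"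
  by (rule Delta0_induct[of "\<lambda>n. (m + 1) + n = (m + n) + 1" n],
      intro Delta0_basic polynomial_intros)
    (simp_all add: number_simps)

lemma number_add_assoc: "(a + b) + c = a + (b + (c::number))"
  by (rule Delta0_induct[of "\<lambda>c. (a + b) + c = a + (b + c)" c],
      intro Delta0_basic polynomial_intros)
    (simp_all add: number_simps)

lemma number_add_commute: "a + b = b + (a::number)"
  by (rule Delta0_induct[of "\<lambda>a. a + b = b + a" a], intro Delta0_basic polynomial_intros)
    (simp_all add: number_simps number_add_Suc[of _ b])

lemma number_mult_0 [number_simps]: "0 * n = (0::number)"
  by (rule Delta0_induct[of "\<lambda>n. 0 * n = 0" n], intro Delta0_basic polynomial_intros)
    (simp_all add: number_simps)

lemma number_mult_Suc [number_simps]: "(m + 1) * n = m * n + (n::number)"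
proof (rule Delta0_induct[of "\<lambda>n. (m + 1) * n = m * n + n" n])
  fix n assume "(m + 1) * n = m * n + n"
  then have "(m + 1) * (n + 1) = (m * n + n) + (m + 1)" by (simp add: number_simps)
  also have "\<dots> = m * (n + 1) + (n + 1)"
    by (simp only: number_simps) (metis number_add_assoc number_add_commute)
  finally show "(m + 1) * (n + 1) = m * (n + 1) + (n + 1)" .
qed (intro Delta0_basic polynomial_intros, simp add: number_simps)

lemma number_mult_1 [number_simps]: "m * 1 = (m::number)"
  using basic_axioms_model(6)[of m 0] by (simp only: number_add_0 basic_axioms_model(5))

lemma number_mult_commute: "a * b = b * (a::number)"
  by (rule Delta0_induct[of "\<lambda>a. a * b = b * a" a], intro Delta0_basic polynomial_intros)
    (simp_all add: number_simps)

lemma number_distrib: "a * (b + c) = a * b + a * (c::number)"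
  by (rule Delta0_induct[of "\<lambda>c. a * (b + c) = a * b + a * c" c],
      intro Delta0_basic polynomial_intros)
    (simp_all add: number_simps number_add_assoc[symmetric])

lemma number_mult_assoc: "(a * b) * c = a * (b * (c::number))"
  by (rule Delta0_induct[of "\<lambda>c. (a * b) * c = a * (b * c)" c],
      intro Delta0_basic polynomial_intros)
    (simp_all add: number_simps number_distrib)

lemma number_add_cancel: "a + c = b + c \<Longrightarrow> a = (b::number)"
  by (rule mp, rule Delta0_induct[of "\<lambda>c. a + c = b + c \<longrightarrow> a = b" c],
      intro Delta0_basic polynomial_intros)
    (auto simp: number_simps dest: basic_axioms_model(2))

lemma number_add_eq_0: "a + b = 0 \<Longrightarrow> b = (0::number)"
  using number_cases[of b] basic_axioms_model(1) by (auto simp: number_simps)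

text \<open>
  Order is existence of a difference. From this, cancellation and totality give all order axioms.
\<close>

lemma number_less_iff: "x < y \<longleftrightarrow> (\<exists>z :: number. y = x + z + 1)"
proof
  have "Sigma1 (\<lambda>v. \<not> x < v 0 \<or> (\<exists>z. v 0 = x + z + 1))"
    by (intro Sigma1_or Sigma1_ex_Delta0 Sigma1_Delta0 Delta0_basic polynomial_intros)
  then have "\<not> x < y \<or> (\<exists>z. y = x + z + 1)"
  proof (rule Sigma1_induct)
    show "\<not> x < 0 \<or> (\<exists>z. 0 = x + z + 1)" using basic_axioms_model(7) by blast
  next
    fix y assume IH: "\<not> x < y \<or> (\<exists>z. y = x + z + 1)"
    show "\<not> x < y + 1 \<or> (\<exists>z. y + 1 = x + z + 1)"
    proof (cases "x = y")
      case True
      then have "y + 1 = x + 0 + 1" by (simp add: number_simps)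
      then show ?thesis by blast
    next
      case False
      then show ?thesis using IH by (metis basic_axioms_model(4,8))
    qed
  qed
  then show "x < y \<Longrightarrow> \<exists>z. y = x + z + 1" by blast
next
  have "x < x + z + 1" for z
    by (rule Delta0_induct[of "\<lambda>z. x < x + z + 1" z], intro Delta0_basic polynomial_intros)
      (auto simp: number_simps basic_axioms_model(8))
  then show "\<exists>z. y = x + z + 1 \<Longrightarrow> x < y" by blast
qed

lemma number_le_iff: "x \<le> y \<longleftrightarrow> (\<exists>z :: number. y = x + z)"
proof
  assume "x \<le> y"
  then show "\<exists>z. y = x + z"
    unfolding less_eq_number_def number_less_iff
    by (metis basic_axioms_model(3) number_add_assoc)
next
  assume "\<exists>z. y = x + z"
  then obtain z where "y = x + z" by blast
  then show "x \<le> y"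
    using number_cases[of z] unfolding less_eq_number_def number_less_iff
    by (auto simp: number_simps)
qed

lemma number_le_linear: "x \<le> y \<or> y \<le> (x::number)"
proof (rule Delta0_induct[of "\<lambda>y. x \<le> y \<or> y \<le> x" y])
  show "Delta0 (\<lambda>v. x \<le> v 0 \<or> v 0 \<le> x)" by (intro Delta0_basic polynomial_intros)
  show "x \<le> 0 \<or> 0 \<le> x" by (metis number_le_iff number_add_0)
next
  fix y assume "x \<le> y \<or> y \<le> x"
  then consider "x \<le> y" | "y < x" by (auto simp: less_eq_number_def)
  then show "x \<le> y + 1 \<or> y + 1 \<le> x"
  proof cases
    case 1
    then show ?thesis by (metis number_le_iff number_add_assoc)
  next
    case 2
    then obtain z where "x = y + z + 1" by (auto simp: number_less_iff)
    then have "x = y + 1 + z" by (simp add: number_add_Suc[of y z])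
    then show ?thesis using number_le_iff by blast
  qed
qed

lemma number_le_antisym: "x \<le> y \<Longrightarrow> y \<le> x \<Longrightarrow> x = (y::number)"
proof -
  assume "x \<le> y" "y \<le> x"
  then obtain a b where "y = x + a" "x = y + b" by (auto simp: number_le_iff)
  then have "0 + x = (a + b) + x"
    by (metis number_add_0 number_add_assoc number_add_commute)
  then have "a + b = 0" using number_add_cancel by metis
  then have "b = 0" by (rule number_add_eq_0)
  then show "x = y" using \<open>x = y + b\<close> by (simp add: number_simps)
qed

lemma number_add_left_mono: "a \<le> b \<Longrightarrow> c + a \<le> c + (b::number)"
  unfolding number_le_iff by (metis number_add_assoc)

lemma number_less_le: "(a < b) = (a \<le> b \<and> \<not> b \<le> (a::number))"
proof
  assume "a < b"
  moreover have "\<not> b \<le> a"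
  proof
    assume "b \<le> a"
    moreover have "a \<le> b" using \<open>a < b\<close> by (simp add: less_eq_number_def)
    ultimately have "b = a" by (rule number_le_antisym)
    moreover obtain z where "b = a + z + 1" using \<open>a < b\<close> number_less_iff by blast
    moreover have "(z + 1) + a = a + z + 1"
      by (metis number_add_assoc number_add_commute)
    ultimately have "(z + 1) + a = 0 + a" by (metis number_add_0)
    then have "z + 1 = 0" by (rule number_add_cancel)
    then show False by (simp add: basic_axioms_model(1))
  qed
  ultimately show "a \<le> b \<and> \<not> b \<le> a" by (simp add: less_eq_number_def)
qed (auto simp: less_eq_number_def)

instantiation number :: linordered_semidom
begin

definition minus_number :: "number \<Rightarrow> number \<Rightarrow> number" where
  "minus_number x y = (if y \<le> x then THE z. x = y + z else 0)"

lemma number_minus: "(y + z) - y = (z::number)"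
proof -
  have "y \<le> y + z" using number_le_iff by blast
  moreover have "(THE w. y + z = y + w) = z"
    by (rule the_equality) (auto dest: number_add_cancel simp: number_add_commute[of y])
  ultimately show ?thesis by (simp add: minus_number_def)
qed

lemma number_minus_0: "\<not> y \<le> x \<Longrightarrow> x - y = (0::number)"
  by (simp add: minus_number_def)

instance
proof
  fix a b c :: number
  show "(a < b) = (a \<le> b \<and> \<not> b \<le> a)" by (rule number_less_le)
  show "a \<le> a" by (simp add: less_eq_number_def)
  show "a \<le> b \<Longrightarrow> b \<le> c \<Longrightarrow> a \<le> c" by (metis number_le_iff number_add_assoc)
  show "a \<le> b \<Longrightarrow> b \<le> a \<Longrightarrow> a = b" by (rule number_le_antisym)
  show "a \<le> b \<or> b \<le> a" by (rule number_le_linear)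
  show "a + b + c = a + (b + c)" by (rule number_add_assoc)
  show "a + b = b + a" by (rule number_add_commute)
  show "0 + a = a" by (rule number_add_0)
  show "a * b * c = a * (b * c)" by (rule number_mult_assoc)
  show "a * b = b * a" by (rule number_mult_commute)
  show "1 * a = a" by (metis number_mult_Suc number_mult_0 number_add_0)
  show "0 * a = 0" by (rule number_mult_0)
  show "a * 0 = 0" by (rule basic_axioms_model(5))
  show "(a + b) * c = a * c + b * c" by (metis number_distrib number_mult_commute)
  show "a * (b + c) = a * b + a * c" by (rule number_distrib)
  show "(0::number) \<noteq> 1" by (metis basic_axioms_model(1) number_add_0)
  show "a + b - a = b" by (rule number_minus)
  show sub: "a - b - c = a - (b + c)"
  proof (cases "b + c \<le> a")
    case True
    then obtain z where "a = b + c + z" by (auto simp: number_le_iff)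
    then show ?thesis by (metis number_minus number_add_assoc)
  next
    case False
    have "\<not> c \<le> a - b \<or> a - b = 0 \<and> c = 0 \<and> \<not> b \<le> a"
    proof (cases "b \<le> a")
      case True
      then obtain z where "a = b + z" by (auto simp: number_le_iff)
      then show ?thesis using False number_minus[of b z] number_add_left_mono[of c z b] by auto
    next
      case b: False
      have "c \<le> 0 \<Longrightarrow> c = 0" by (metis number_le_iff number_le_antisym number_add_0)
      then show ?thesis using b by (auto simp: number_minus_0)
    qed
    moreover have "(0::number) - 0 = 0" using number_minus[of 0 0] by (simp add: number_simps)
    ultimately show ?thesis using False by (auto simp: number_minus_0)
  qed
  show mono: "a \<le> b \<Longrightarrow> c + a \<le> c + b" by (rule number_add_left_mono)
  have strict: "a < b \<Longrightarrow> 0 < c \<Longrightarrow> c * a < c * b" for a b c :: number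
  proof -
    assume "a < b" "0 < c"
    then obtain z w where "b = a + z + 1" "c = 0 + w + 1" by (auto simp: number_less_iff)
    then have "c * b = c * a + c * z + c" and c: "c = w + 1"
      by (simp_all add: number_distrib basic_axioms_model(6) number_add_0 number_mult_1)
    moreover have "c * a + c * z + (w + 1) = c * a + (c * z + w) + 1"
      by (simp add: basic_axioms_model(4) number_add_assoc[symmetric])
    ultimately have "c * b = c * a + (c * z + w) + 1" by simp
    then show "c * a < c * b" using number_less_iff by blast
  qed
  then show "a < b \<Longrightarrow> 0 < c \<Longrightarrow> c * a < c * b" .
  have nz: "0 < x \<or> x = 0" for x :: number
    using number_le_iff[of 0 x] number_add_0 by (auto simp: less_eq_number_def)
  show "a \<noteq> 0 \<Longrightarrow> b \<noteq> 0 \<Longrightarrow> a * b \<noteq> 0"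
    using strict[of 0 b a] nz[of a] nz[of b] basic_axioms_model(7)[of "a * b"]
    by (auto simp: basic_axioms_model(5) number_less_le)
  show "a * (b - c) = a * b - a * c"
  proof (cases "c \<le> b")
    case True
    then obtain z where "b = c + z" by (auto simp: number_le_iff)
    then show ?thesis by (simp add: number_minus number_distrib)
  next
    case False
    then have "b < c" using number_le_linear[of b c] number_less_le[of b c] by blast
    then have "\<not> a * c \<le> a * b \<or> a = 0"
      using strict[of b c a] nz[of a] number_less_le[of "a * b" "a * c"] by blast
    then show ?thesis
      using False number_minus[of 0 0]
      by (auto simp: number_minus_0 basic_axioms_model(5) number_mult_0 number_add_0)
  qed
  show "(0::number) < 1" using nz[of 1] basic_axioms_model(1)[of 0] by (simp add: number_simps)
  show "b \<le> a \<Longrightarrow> a - b + b = a"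
    by (metis number_le_iff number_minus number_add_commute)
qed

end

lemma number_ge_0 [simp]: "0 \<le> (x::number)"
  using number_le_iff[of 0 x] by simp

lemma number_less_add_1 [simp]: "x < y + 1 \<longleftrightarrow> x \<le> (y::number)"
  by (simp add: basic_axioms_model(8) less_eq_number_def)

lemma number_pos: "0 < x \<longleftrightarrow> (\<exists>y :: number. x = y + 1)"
  by (simp add: number_less_iff)

lemma Delta0_bex_le:
  "Delta0 (\<lambda>v. P (v 0) (\<lambda>i. v (Suc i))) \<Longrightarrow> polynomial f \<Longrightarrow> Delta0 (\<lambda>v. \<exists>x\<le>f v. P x v)"
  using Delta0_bex[of P "\<lambda>v. f v + 1"] by (simp add: polynomial_intros)

text \<open>Two unbounded witnesses can be bounded by a single one.\<close>

lemma Sigma1_ex: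
  assumes "Sigma1 (\<lambda>v. P (v 0) (\<lambda>i. v (Suc i)))"
  shows "Sigma1 (\<lambda>v. \<exists>x. P x v)"
proof -
  obtain Q where Q: "Delta0 (\<lambda>v. Q (v 0) (\<lambda>i. v (Suc i)))"
    "\<And>v. P (v 0) (\<lambda>i. v (Suc i)) \<longleftrightarrow> (\<exists>y. Q y v)"
    using assms by (auto simp: Sigma1_def)
  define g :: "(nat \<Rightarrow> number) \<Rightarrow> nat \<Rightarrow> number"
    where "g u = case_nat (u 0) (case_nat (u 1) (\<lambda>i. u (Suc (Suc (Suc i)))))" for u
  have "polynomial (\<lambda>u. g u i)" for i
    by (cases i rule: nat.exhaust; cases "i - 1" rule: nat.exhaust)
      (auto simp: g_def intro: polynomial_var)
  from Delta0_subst[OF Q(1), of g, OF this]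
  have "Delta0 (\<lambda>u. Q (u 0) (case_nat (u 1) (\<lambda>i. u (Suc (Suc (Suc i))))))"
    by (simp add: g_def)
  then have "Delta0 (\<lambda>v. \<exists>x\<le>v 0. \<exists>y\<le>v 0. Q y (case_nat x (\<lambda>i. v (Suc i))))"
    by (intro Delta0_bex_le polynomial_intros) simp
  then have "Sigma1 (\<lambda>v. \<exists>z. \<exists>x\<le>z. \<exists>y\<le>z. Q y (case_nat x v))"
    by (rule Sigma1_ex_Delta0)
  moreover have "(\<exists>x. P x v) \<longleftrightarrow> (\<exists>z. \<exists>x\<le>z. \<exists>y\<le>z. Q y (case_nat x v))" for v
  proof
    assume "\<exists>x. P x v"
    then obtain x y where "Q y (case_nat x v)" using Q(2)[of "case_nat x v" for x] by auto
    then show "\<exists>z. \<exists>x\<le>z. \<exists>y\<le>z. Q y (case_nat x v)" by (meson linear order_refl)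
  next
    assume "\<exists>z. \<exists>x\<le>z. \<exists>y\<le>z. Q y (case_nat x v)"
    then show "\<exists>x. P x v" using Q(2)[of "case_nat x v" for x] by auto
  qed
  ultimately show ?thesis by simp
qed

section \<open>The ring of differences and the field of rationals\<close>

text \<open>
  The pair \<open>(a, b)\<close> stands for the difference of \<open>a\<close> and \<open>b\<close>.
\<close>

definition diff_rel :: "'a::linordered_semidom \<times> 'a \<Rightarrow> 'a \<times> 'a \<Rightarrow> bool" where
  "diff_rel p q \<longleftrightarrow> fst p + snd q = fst q + snd p"

quotient_type (overloaded) 'a difference = "'a::linordered_semidom \<times> 'a" / diff_rel
  morphisms representative class_of
proof (rule equivpI)
  show "reflp (diff_rel :: 'a \<times> 'a \<Rightarrow> _)" "symp (diff_rel :: 'a \<times> 'a \<Rightarrow> _)"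
    by (auto simp: reflp_def symp_def diff_rel_def)
  show "transp (diff_rel :: 'a \<times> 'a \<Rightarrow> _)"
  proof (rule transpI)
    fix p q r :: "'a \<times> 'a"
    assume "diff_rel p q" "diff_rel q r"
    then have "(fst p + snd r) + (fst q + snd q) = (fst r + snd p) + (fst q + snd q)"
      unfolding diff_rel_def by (metis add.commute add.left_commute)
    then show "diff_rel p r" unfolding diff_rel_def by (rule add_right_imp_eq)
  qed
qed

lemma less_witness:
  fixes a b :: "'a::linordered_semidom"
  assumes "a < b"
  obtains c where "b = a + c" "0 < c"
proof (rule that[of "b - a"])
  show b: "b = a + (b - a)" using assms by simp
  have "a + 0 < a + (b - a)" using assms by (simp only: b[symmetric] add_0_right)
  then show "0 < b - a" by (simp only: add_less_cancel_left)
qed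

instantiation difference :: (linordered_semidom) linordered_idom
begin

lift_definition zero_difference :: "'a difference" is "(0, 0)" .
lift_definition one_difference :: "'a difference" is "(1, 0)" .
lift_definition plus_difference :: "'a difference \<Rightarrow> 'a difference \<Rightarrow> 'a difference"
  is "\<lambda>(a, b) (c, d). (a + c, b + d)"
  by (auto simp: diff_rel_def) (metis add.commute add.left_commute)
lift_definition uminus_difference :: "'a difference \<Rightarrow> 'a difference" is "\<lambda>(a, b). (b, a)"
  by (auto simp: diff_rel_def add.commute)
definition minus_difference :: "'a difference \<Rightarrow> 'a difference \<Rightarrow> 'a difference" where
  "minus_difference p q = p + - q"
lift_definition times_difference :: "'a difference \<Rightarrow> 'a difference \<Rightarrow> 'a difference"
  is "\<lambda>(a, b) (c, d). (a * c + b * d, a * d + b * c)"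
proof clarify
  fix a b a' b' c d c' d' :: 'a
  assume "diff_rel (a, b) (a', b')" "diff_rel (c, d) (c', d')"
  then have 1: "a + b' = a' + b" and 2: "c + d' = c' + d" by (auto simp: diff_rel_def)
  have "(a * c + b * d + (a' * d' + b' * c')) + (a' * c + b' * c + a' * d + b' * d)
      = c * (a + b') + d * (a' + b) + a' * (c + d') + b' * (c' + d)"
    by (simp add: algebra_simps)
  also have "\<dots> = c * (a' + b) + d * (a + b') + a' * (c' + d) + b' * (c + d')"
    by (simp only: 1 2)
  also have "\<dots> = (a' * c' + b' * d' + (a * d + b * c)) + (a' * c + b' * c + a' * d + b' * d)"
    by (simp add: algebra_simps)
  finally show "diff_rel (a * c + b * d, a * d + b * c) (a' * c' + b' * d', a' * d' + b' * c')"
    unfolding diff_rel_def by (simp add: add_right_imp_eq)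
qed
lift_definition less_eq_difference :: "'a difference \<Rightarrow> 'a difference \<Rightarrow> bool"
  is "\<lambda>(a, b) (c, d). a + d \<le> c + b"
proof clarify
  fix a b a' b' c d c' d' :: 'a
  assume "diff_rel (a, b) (a', b')" "diff_rel (c, d) (c', d')"
  then have 1: "a + b' = a' + b" and 2: "c + d' = c' + d" by (auto simp: diff_rel_def)
  have "a + d \<le> c + b \<longleftrightarrow> (a + d) + (b' + d') \<le> (c + b) + (b' + d')" by simp
  also have "(a + d) + (b' + d') = (a' + d') + (b + d)" using 1 by (metis add.assoc add.commute)
  also have "(c + b) + (b' + d') = (c' + b') + (b + d)" using 2 by (metis add.assoc add.commute)
  also have "(a' + d') + (b + d) \<le> (c' + b') + (b + d) \<longleftrightarrow> a' + d' \<le> c' + b'" by simp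
  finally show "(a + d \<le> c + b) = (a' + d' \<le> c' + b')" .
qed
definition less_difference :: "'a difference \<Rightarrow> 'a difference \<Rightarrow> bool" where
  "less_difference p q \<longleftrightarrow> \<not> q \<le> p"
definition absolute_difference: "abs (p :: 'a difference) = (if p < 0 then - p else p)"
definition sgn_difference :: "'a difference \<Rightarrow> 'a difference" where
  "sgn_difference p = (if p = 0 then 0 else if 0 < p then 1 else - 1)"

instance
proof
  fix p q r :: "'a difference"
  show "p + q + r = p + (q + r)"
    by transfer (auto simp: diff_rel_def algebra_simps)
  show "p + q = q + p"
    by transfer (auto simp: diff_rel_def algebra_simps)
  show "0 + p = p"
    by transfer (auto simp: diff_rel_def algebra_simps)
  show "- p + p = 0"
    by transfer (auto simp: diff_rel_def algebra_simps)
  show "p - q = p + - q" by (simp add: minus_difference_def)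
  show "p * q * r = p * (q * r)"
    by transfer (auto simp: diff_rel_def algebra_simps)
  show "p * q = q * p"
    by transfer (auto simp: diff_rel_def algebra_simps)
  show "1 * p = p"
    by transfer (auto simp: diff_rel_def algebra_simps)
  show "(p + q) * r = p * r + q * r"
    by transfer (auto simp: diff_rel_def algebra_simps)
  show "p + q - p = q" "p - q - r = p - (q + r)"
    unfolding minus_difference_def by (transfer; auto simp: diff_rel_def algebra_simps)+
  show "0 * p = 0" "p * 0 = 0"
    by (transfer; auto simp: diff_rel_def algebra_simps)+
  show "(0 :: 'a difference) \<noteq> 1"
    by transfer (auto simp: diff_rel_def)
  show total: "p \<le> q \<or> q \<le> p" for p q :: "'a difference"
    by transfer auto
  show "p < q \<longleftrightarrow> p \<le> q \<and> \<not> q \<le> p"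
    using total[of p q] by (auto simp: less_difference_def)
  show "p \<le> p" by transfer auto
  show "p \<le> q \<Longrightarrow> q \<le> r \<Longrightarrow> p \<le> r"
  proof (transfer, clarify)
    fix a b c d e f :: 'a
    assume "a + d \<le> c + b" "c + f \<le> e + d"
    then have "(a + d) + (c + f) \<le> (c + b) + (e + d)" by (rule add_mono)
    then have "(a + f) + (c + d) \<le> (e + b) + (c + d)" by (simp add: algebra_simps)
    then show "a + f \<le> e + b" by simp
  qed
  show "p \<le> q \<Longrightarrow> q \<le> p \<Longrightarrow> p = q"
    by transfer (auto simp: diff_rel_def algebra_simps)
  show "p \<le> q \<Longrightarrow> r + p \<le> r + q"
    by transfer (auto simp: algebra_simps)
  show "p < q \<Longrightarrow> 0 < r \<Longrightarrow> r * p < r * q"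
    unfolding less_difference_def
  proof (transfer, clarsimp simp: not_le)
    fix a b c d e f :: 'a
    assume 1: "c + b < a + d" and 2: "f < e"
      and 3: "e * a + f * b + (e * d + f * c) \<le> e * c + f * d + (e * b + f * a)"
    obtain x where x: "a + d = c + b + x" "0 < x" using less_witness[OF 1] .
    obtain y where y: "e = f + y" "0 < y" using less_witness[OF 2] .
    have "(f + y) * s + f * (s + x) < (f + y) * (s + x) + f * s" for s
      using x(2) y(2) by (simp add: algebra_simps)
    then have "e * (c + b) + f * (a + d) < e * (a + d) + f * (c + b)"
      by (simp only: x(1) y(1))
    then have "e * c + f * d + (e * b + f * a) < e * a + f * b + (e * d + f * c)"
      by (simp add: algebra_simps)
    then show False using 3 by simp
  qed
  show "\<bar>p\<bar> = (if p < 0 then - p else p)" by (rule absolute_difference)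
  show "sgn p = (if p = 0 then 0 else if 0 < p then 1 else - 1)" by (rule sgn_difference_def)
qed

end

type_synonym rational = "number difference fract"

definition rat_of :: "number \<Rightarrow> rational" where
  "rat_of x = Fract (class_of (x, 0)) 1"

lemma rat_of_simps [simp]:
  "rat_of 0 = 0" "rat_of 1 = 1" "rat_of (x + y) = rat_of x + rat_of y"
  "rat_of (x * y) = rat_of x * rat_of y"
proof -
  show "rat_of 0 = 0" "rat_of 1 = 1"
    by (simp_all add: rat_of_def Zero_fract_def One_fract_def zero_difference.abs_eq
        one_difference.abs_eq)
  have "class_of (x, 0) + class_of (y, 0) = class_of (x + y, 0)"
    "class_of (x, 0) * class_of (y, 0) = class_of (x * y, 0)"
    by (simp_all add: plus_difference.abs_eq times_difference.abs_eq)
  then show "rat_of (x + y) = rat_of x + rat_of y" "rat_of (x * y) = rat_of x * rat_of y"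
    by (simp_all add: rat_of_def)
qed

lemma rat_of_le [simp]: "rat_of x \<le> rat_of y \<longleftrightarrow> x \<le> y"
  by (simp add: rat_of_def less_eq_difference.abs_eq)

lemma rat_of_less [simp]: "rat_of x < rat_of y \<longleftrightarrow> x < y"
  by (simp add: less_le_not_le)

lemma rat_of_nonneg [simp]: "0 \<le> rat_of x"
  using rat_of_le[of 0 x] by simp

lemma class_of_cases: obtains a b where "p = class_of (a, b)"
  using that Quotient_abs_rep[OF Quotient_difference, of p] by (metis prod.collapse)

lemma class_of_Fract: "Fract (class_of (a, b)) 1 = rat_of a - rat_of b"
proof -
  have "class_of (a, 0) - class_of (b, 0) = class_of (a, b)"
    by (simp add: minus_difference_def uminus_difference.abs_eq plus_difference.abs_eq)
  then show ?thesis by (simp add: rat_of_def)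
qed

lemma rational_cases:
  fixes q :: rational
  obtains a b c where "q = (rat_of a - rat_of b) / (rat_of c + 1)"
proof (induction q rule: fract_induct_pos)
  case (Fract m n)
  obtain a b where m: "m = class_of (a, b)" using class_of_cases .
  obtain c d where n: "n = class_of (c, d)" using class_of_cases .
  have "class_of (c, d) > class_of (0, 0)"
    using Fract.hyps n by (simp add: zero_difference.abs_eq)
  then have "d < c"
    by (simp add: less_difference_def less_eq_difference.abs_eq not_le)
  then obtain e where "c = d + e" "0 < e" by (rule less_witness)
  then obtain k where k: "c = d + (k + 1)" by (auto simp: number_pos)
  have "Fract m n = Fract m 1 / Fract n 1" by simp
  also have "\<dots> = (rat_of a - rat_of b) / (rat_of k + 1)"
    by (simp add: m n class_of_Fract k del: divide_fract)
  finally show ?case by (rule Fract.prems)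
qed

section \<open>Meaning of the formulas\<close>

definition tpair :: "number \<Rightarrow> number \<Rightarrow> number" where "tpair s t = (s + t) * (s + t) + s"

text \<open>
  \<open>tpair s t\<close> lies between the squares of \<open>s + t\<close> and \<open>s + t + 1\<close>, so it determines first \<open>s + t\<close>
  and then \<open>s\<close>.
\<close>

lemma tpair_inject [simp]: "tpair a b = tpair c d \<longleftrightarrow> a = c \<and> b = d"
proof
  have *: "x * x + a < y * y + c" if "a \<le> x" "x < y" for x y a c :: number
  proof -
    have "x + 1 \<le> y" using that(2) by (metis linorder_not_less number_less_add_1)
    then have "(x + 1) * (x + 1) \<le> y * y" by (intro mult_mono) auto
    moreover have "(x + 1) * (x + 1) = x * x + x + x + 1" by (simp add: algebra_simps)
    moreover have "x * x + a \<le> x * x + x + x"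
      using that(1) by (metis add.assoc add_left_mono add_increasing2 number_ge_0)
    ultimately have "x * x + a + 1 \<le> y * y"
      by (metis add_right_mono order_trans)
    also have "\<dots> \<le> y * y + c" by simp
    finally show ?thesis by (metis number_less_add_1 linorder_not_less)
  qed
  assume eq: "tpair a b = tpair c d"
  have "a + b = c + d"
  proof (rule linorder_cases[of "a + b" "c + d"])
    assume "a + b < c + d"
    then show ?thesis using *[of a "a + b" "c + d" c] eq by (simp add: tpair_def)
  next
    assume "c + d < a + b"
    then show ?thesis using *[of c "c + d" "a + b" a] eq by (simp add: tpair_def)
  qed
  then show "a = c \<and> b = d" using eq by (auto simp: tpair_def)
qed auto

lemma le_tpair1: "a \<le> tpair a b"
  by (simp add: tpair_def)

lemma le_tpair2: "b \<le> tpair a b"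
proof -
  have "x \<le> x * x" for x :: number
  proof (cases "x = 0")
    case False
    then have "1 \<le> x" using number_cases[of x] by auto
    then show ?thesis using mult_left_mono[of 1 x x] by simp
  qed simp
  then have "a + b \<le> (a + b) * (a + b)" .
  then show ?thesis
    unfolding tpair_def by (meson add_increasing add_increasing2 number_ge_0 order_trans order_refl)
qed

type_synonym triple = "number \<times> number \<times> number"
type_synonym interval = "triple \<times> triple"

definition tcode :: "triple \<Rightarrow> number" where
  "tcode q = tpair (tpair (fst q) (fst (snd q))) (snd (snd q))"

lemma tcode_inject [simp]: "tcode p = tcode q \<longleftrightarrow> p = q"
  by (auto simp: tcode_def prod_eq_iff)

definition intcode :: "interval \<Rightarrow> number" where
  "intcode u = tpair (tcode (fst u)) (tcode (snd u))"

lemma intcode_inject [simp]: "intcode u = intcode w \<longleftrightarrow> u = w"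
  by (auto simp: intcode_def prod_eq_iff)

definition val :: "triple \<Rightarrow> rational" where
  "val q = (rat_of (fst q) - rat_of (fst (snd q))) / (rat_of (snd (snd q)) + 1)"

lemma rat_of_add_1_pos [simp]: "0 < rat_of c + 1" "rat_of c + 1 \<noteq> 0" "1 + rat_of c \<noteq> 0"
  by (metis add_nonneg_pos rat_of_nonneg zero_less_one order_less_irrefl add.commute)+

lemma val_surj: obtains q where "val q = r"
proof -
  obtain a b c where "r = (rat_of a - rat_of b) / (rat_of c + 1)" by (rule rational_cases)
  then have "val (a, b, c) = r" by (simp add: val_def)
  then show ?thesis by (rule that)
qed

lemma val_le_iff:
  "val (a, b, c) \<le> val (a', b', c') \<longleftrightarrow> a * (c' + 1) + b' * (c + 1) \<le> a' * (c + 1) + b * (c' + 1)"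
proof -
  have "val (a, b, c) \<le> val (a', b', c') \<longleftrightarrow>
    (rat_of a - rat_of b) * (rat_of c' + 1) \<le> (rat_of a' - rat_of b') * (rat_of c + 1)"
    unfolding val_def by (simp add: pos_divide_le_eq pos_le_divide_eq)
  also have "\<dots> \<longleftrightarrow> rat_of (a * (c' + 1) + b' * (c + 1)) \<le> rat_of (a' * (c + 1) + b * (c' + 1))"
    unfolding rat_of_simps by (auto simp: algebra_simps)
  finally show ?thesis by (simp only: rat_of_le)
qed

definition tadd :: "triple \<Rightarrow> triple \<Rightarrow> triple" where
  "tadd p q = (fst p * (snd (snd q) + 1) + fst q * (snd (snd p) + 1),
    fst (snd p) * (snd (snd q) + 1) + fst (snd q) * (snd (snd p) + 1),
    snd (snd p) * snd (snd q) + snd (snd p) + snd (snd q))"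
definition tneg :: "triple \<Rightarrow> triple" where "tneg p = (fst (snd p), fst p, snd (snd p))"
definition thalf :: "triple \<Rightarrow> triple" where
  "thalf p = (fst p, fst (snd p), snd (snd p) + snd (snd p) + 1)"

lemma val_tneg [simp]: "val (tneg p) = - val p"
  by (simp add: val_def tneg_def diff_divide_distrib)

lemma val_tadd [simp]: "val (tadd p q) = val p + val q"
proof (cases p; cases q)
  fix a b c a' b' c' assume [simp]: "p = (a, b, c)" "q = (a', b', c')"
  have "rat_of (c * c' + c + c') + 1 = (rat_of c + 1) * (rat_of c' + 1)"
    by (simp add: algebra_simps)
  then show ?thesis by (simp add: val_def tadd_def add_frac_eq algebra_simps)
qed

lemma val_thalf [simp]: "val (thalf p) = val p / 2"
proof -
  have "rat_of (c + c + 1) + 1 = (rat_of c + 1) * 2" for c by simp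
  then show ?thesis by (simp add: val_def thalf_def)
qed

subsection \<open>Contexts\<close>

text \<open>
  Expressions are functions of the numbers of enclosing binders, and such a function is meaningful only if
  it refers to the same variable at all greater depths. The relations below build this in, in the
  manner of a Kripke logical relation: an expression denotes a value in a context if it does so in all
  contexts that extend it by further bound variables. Formulas (\<open>fm_rel\<close>) are evaluated at one context.
\<close>

type_synonym ctx = "nat \<times> nat \<times> (nat \<Rightarrow> number) \<times> (nat \<Rightarrow> number set)"

definition extends :: "ctx \<Rightarrow> ctx \<Rightarrow> bool" where
  "extends c c' \<longleftrightarrow> (case c of (d, e, v, V) \<Rightarrow> case c' of (d', e', v', V') \<Rightarrow>
    (\<exists>k l. d' = d + k \<and> e' = e + l \<and> (\<forall>i. v' (i + k) = v i) \<and> (\<forall>i. V' (i + l) = V i)))"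

definition push_num :: "number \<Rightarrow> ctx \<Rightarrow> ctx" where
  "push_num x c = (case c of (d, e, v, V) \<Rightarrow> (Suc d, e, case_nat x v, V))"
definition push_set :: "number set \<Rightarrow> ctx \<Rightarrow> ctx" where
  "push_set X c = (case c of (d, e, v, V) \<Rightarrow> (d, Suc e, v, case_nat X V))"
definition push_rat :: "triple \<Rightarrow> ctx \<Rightarrow> ctx" where
  "push_rat q c = push_num (snd (snd q)) (push_num (fst (snd q)) (push_num (fst q) c))"
definition push_int :: "interval \<Rightarrow> ctx \<Rightarrow> ctx" where
  "push_int u c = push_rat (snd u) (push_rat (fst u) c)"

definition num_at :: "nat \<Rightarrow> num_e" where "num_at d = (\<lambda>d'. Var (d' - Suc d))"
definition set_at :: "nat \<Rightarrow> set_e" where "set_at e = (\<lambda>e'. e' - Suc e)"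
definition rat_at :: "nat \<Rightarrow> rat_e" where
  "rat_at d = (num_at d, num_at (Suc d), num_at (Suc (Suc d)))"
definition int_at :: "nat \<Rightarrow> int_e" where "int_at d = (rat_at d, rat_at (Suc (Suc (Suc d))))"

definition num_rel :: "ctx \<Rightarrow> num_e \<Rightarrow> number \<Rightarrow> bool" where
  "num_rel c s x \<longleftrightarrow> (\<forall>d e v V. extends c (d, e, v, V) \<longrightarrow> eval_tm v (s d) = x)"
definition set_rel :: "ctx \<Rightarrow> set_e \<Rightarrow> number set \<Rightarrow> bool" where
  "set_rel c s X \<longleftrightarrow> (\<forall>d e v V. extends c (d, e, v, V) \<longrightarrow> V (s e) = X)"
definition rat_rel :: "ctx \<Rightarrow> rat_e \<Rightarrow> triple \<Rightarrow> bool" where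
  "rat_rel c p q \<longleftrightarrow> num_rel c (fst p) (fst q) \<and> num_rel c (fst (snd p)) (fst (snd q)) \<and>
    num_rel c (snd (snd p)) (snd (snd q))"
text \<open>
  Comparisons depend only on the values of the triples, whereas codes depend on the triples themselves;
  hence the two relations for rationals.
\<close>

definition val_rel :: "ctx \<Rightarrow> rat_e \<Rightarrow> rational \<Rightarrow> bool" where
  "val_rel c p r \<longleftrightarrow> (\<exists>q. rat_rel c p q \<and> val q = r)"
definition int_rel :: "ctx \<Rightarrow> int_e \<Rightarrow> interval \<Rightarrow> bool" where
  "int_rel c U u \<longleftrightarrow> rat_rel c (fst U) (fst u) \<and> rat_rel c (snd U) (snd u)"
definition fm_rel :: "ctx \<Rightarrow> fm_e \<Rightarrow> bool \<Rightarrow> bool" where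
  "fm_rel c A P \<longleftrightarrow> (case c of (d, e, v, V) \<Rightarrow> eval Sets v V (A d e) \<longleftrightarrow> P)"
definition seq_rel :: "ctx \<Rightarrow> seq_e \<Rightarrow> (number \<Rightarrow> triple \<Rightarrow> bool) \<Rightarrow> bool" where
  "seq_rel c R r \<longleftrightarrow> (\<forall>c' k x p q. extends c c' \<longrightarrow> num_rel c' k x \<longrightarrow> rat_rel c' p q \<longrightarrow>
    fm_rel c' (R k p) (r x q))"
definition fun_rel :: "ctx \<Rightarrow> fun_e \<Rightarrow> (interval \<Rightarrow> interval \<Rightarrow> bool) \<Rightarrow> bool" where
  "fun_rel c F f \<longleftrightarrow> (\<forall>c' U u W w. extends c c' \<longrightarrow> int_rel c' U u \<longrightarrow> int_rel c' W w \<longrightarrow>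
    fm_rel c' (F U W) (f u w))"

lemma extends_refl: "extends c c"
  by (auto simp: extends_def)

lemma extends_trans: "extends c c' \<Longrightarrow> extends c' c'' \<Longrightarrow> extends c c''"
proof (cases c; cases c'; cases c'')
  fix d e v V d' e' v' V' d'' e'' v'' V''
  assume *: "extends c c'" "extends c' c''" "c = (d, e, v, V)" "c' = (d', e', v', V')"
    "c'' = (d'', e'', v'', V'')"
  then obtain k l k' l' where "d' = d + k" "e' = e + l" "\<forall>i. v' (i + k) = v i"
    "\<forall>i. V' (i + l) = V i" "d'' = d' + k'" "e'' = e' + l'" "\<forall>i. v'' (i + k') = v' i"
    "\<forall>i. V'' (i + l') = V' i"
    by (auto simp: extends_def)
  then show ?thesis
    using * by (auto simp: extends_def add.assoc[symmetric] intro!: exI[of _ "k + k'"] exI[of _ "l + l'"])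
qed

lemma extends_num: "extends c c' \<Longrightarrow> extends c (push_num x c')"
  by (rule extends_trans, assumption)
    (auto simp: extends_def push_num_def split: prod.split intro!: exI[of _ 1])
lemma extends_set: "extends c c' \<Longrightarrow> extends c (push_set X c')"
  by (rule extends_trans, assumption)
    (auto simp: extends_def push_set_def split: prod.split intro!: exI[of _ 1])
lemma extends_rat: "extends c c' \<Longrightarrow> extends c (push_rat q c')"
  by (simp add: push_rat_def extends_num)
lemma extends_int: "extends c c' \<Longrightarrow> extends c (push_int u c')"
  by (simp add: push_int_def extends_rat)

lemmas extends_intros = extends_refl extends_num extends_set extends_rat extends_int

lemma num_rel_ext: "num_rel c s x \<Longrightarrow> extends c c' \<Longrightarrow> num_rel c' s x"
  unfolding num_rel_def by (meson extends_trans)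
lemma set_rel_ext: "set_rel c s x \<Longrightarrow> extends c c' \<Longrightarrow> set_rel c' s x"
  unfolding set_rel_def by (meson extends_trans)
lemma rat_rel_ext: "rat_rel c s x \<Longrightarrow> extends c c' \<Longrightarrow> rat_rel c' s x"
  unfolding rat_rel_def by (blast intro: num_rel_ext)
lemma int_rel_ext: "int_rel c s x \<Longrightarrow> extends c c' \<Longrightarrow> int_rel c' s x"
  unfolding int_rel_def by (blast intro: rat_rel_ext)
lemma seq_rel_ext: "seq_rel c s x \<Longrightarrow> extends c c' \<Longrightarrow> seq_rel c' s x"
  unfolding seq_rel_def by (meson extends_trans)
lemma fun_rel_ext: "fun_rel c s x \<Longrightarrow> extends c c' \<Longrightarrow> fun_rel c' s x"
  unfolding fun_rel_def by (meson extends_trans)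

lemma seq_relD: "seq_rel c R r \<Longrightarrow> extends c c' \<Longrightarrow> num_rel c' k x \<Longrightarrow> rat_rel c' p q
    \<Longrightarrow> fm_rel c' (R k p) (r x q)"
  unfolding seq_rel_def by blast
lemma fun_relD: "fun_rel c F f \<Longrightarrow> extends c c' \<Longrightarrow> int_rel c' U u \<Longrightarrow> int_rel c' W w
    \<Longrightarrow> fm_rel c' (F U W) (f u w)"
  unfolding fun_rel_def by blast

lemma seq_relI: "(\<And>c' k x p q. extends c c' \<Longrightarrow> num_rel c' k x \<Longrightarrow> rat_rel c' p q
    \<Longrightarrow> fm_rel c' (R k p) (r x q)) \<Longrightarrow> seq_rel c R r"
  by (simp add: seq_rel_def)
lemma fun_relI: "(\<And>c' U u W w. extends c c' \<Longrightarrow> int_rel c' U u \<Longrightarrow> int_rel c' W w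
    \<Longrightarrow> fm_rel c' (F U W) (f u w)) \<Longrightarrow> fun_rel c F f"
  by (simp add: fun_rel_def)

lemma num_rel_at: "num_rel (push_num x c) (num_at (fst c)) x"
proof -
  have "v k = x" if "\<forall>i. v (i + k) = case_nat x w i" for v w :: "nat \<Rightarrow> number" and k
    using spec[OF that, of 0] by simp
  then show ?thesis
    by (auto simp: num_rel_def num_at_def extends_def push_num_def split: prod.split)
qed

lemma set_rel_at: "set_rel (push_set X c) (set_at (fst (snd c))) X"
  by (auto simp only: set_rel_def set_at_def extends_def push_set_def split: prod.split)
    (auto dest!: spec[of _ 0])

lemma fst_push_num: "fst (push_num x c) = Suc (fst c)"
  by (simp add: push_num_def split: prod.split)

lemma rat_rel_at: "rat_rel (push_rat q c) (rat_at (fst c)) q"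
  using num_rel_at[of "fst q" c] num_rel_at[of "fst (snd q)" "push_num (fst q) c"]
    num_rel_at[of "snd (snd q)" "push_num (fst (snd q)) (push_num (fst q) c)"]
  by (auto simp: rat_rel_def rat_at_def push_rat_def fst_push_num
      intro: num_rel_ext extends_intros)

lemma fst_push_rat: "fst (push_rat q c) = Suc (Suc (Suc (fst c)))"
  by (simp add: push_rat_def fst_push_num)

lemma int_rel_at: "int_rel (push_int u c) (int_at (fst c)) u"
proof -
  have "rat_rel (push_rat q (push_rat p c)) (rat_at (fst c)) p" for p q
    using rat_rel_at by (rule rat_rel_ext) (intro extends_intros)
  moreover have "rat_rel (push_rat q (push_rat p c)) (rat_at (Suc (Suc (Suc (fst c))))) q" for p q
    using rat_rel_at[of q "push_rat p c"] by (simp add: fst_push_rat)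
  ultimately show ?thesis by (simp add: int_rel_def int_at_def push_int_def)
qed

subsection \<open>Connectives and quantifiers\<close>

named_theorems rel

lemma num_rel_ops [rel]:
  "num_rel c \<zero> 0" "num_rel c \<one> 1"
  "num_rel c s x \<Longrightarrow> num_rel c t y \<Longrightarrow> num_rel c (s \<oplus> t) (x + y)"
  "num_rel c s x \<Longrightarrow> num_rel c t y \<Longrightarrow> num_rel c (s \<otimes> t) (x * y)"
  by (auto simp: num_rel_def zero_e_def one_e_def add_e_def mul_e_def)

lemma num_rel_here: "num_rel (d, e, v, V) s x \<Longrightarrow> eval_tm v (s d) = x"
  unfolding num_rel_def using extends_refl by blast
lemma set_rel_here: "set_rel (d, e, v, V) s x \<Longrightarrow> V (s e) = x"
  unfolding set_rel_def using extends_refl by blast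

lemma fm_rel_atoms [rel]:
  "num_rel c s x \<Longrightarrow> num_rel c t y \<Longrightarrow> fm_rel c (s \<^bold>= t) (x = y)"
  "num_rel c s x \<Longrightarrow> num_rel c t y \<Longrightarrow> fm_rel c (s \<^bold>< t) (x < y)"
  "num_rel c s x \<Longrightarrow> num_rel c t y \<Longrightarrow> fm_rel c (s \<^bold>\<le> t) (x \<le> y)"
  "num_rel c s x \<Longrightarrow> set_rel c A X \<Longrightarrow> fm_rel c (s \<^bold>\<in> A) (x \<in> X)"
  by (cases c; auto simp: fm_rel_def eq_e_def less_e_def le_e_def in_e_def or_e_def order_le_less
      dest!: num_rel_here set_rel_here)+

lemma fm_rel_connectives [rel]:
  "fm_rel c A P \<Longrightarrow> fm_rel c (\<^bold>\<not> A) (\<not> P)"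
  "fm_rel c A P \<Longrightarrow> fm_rel c B Q \<Longrightarrow> fm_rel c (A \<^bold>\<and> B) (P \<and> Q)"
  "fm_rel c A P \<Longrightarrow> fm_rel c B Q \<Longrightarrow> fm_rel c (A \<^bold>\<or> B) (P \<or> Q)"
  "fm_rel c A P \<Longrightarrow> fm_rel c B Q \<Longrightarrow> fm_rel c (A \<^bold>\<longrightarrow> B) (P \<longrightarrow> Q)"
  by (cases c; simp add: fm_rel_def neg_e_def and_e_def or_e_def imp_e_def)+

lemma fm_rel_numN [rel]:
  "(\<And>x. fm_rel (push_num x c) (B (num_at (fst c))) (P x)) \<Longrightarrow> fm_rel c (allN_e B) (\<forall>x. P x)"
  "(\<And>x. fm_rel (push_num x c) (B (num_at (fst c))) (P x)) \<Longrightarrow> fm_rel c (exN_e B) (\<exists>x. P x)"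
  by (cases c; simp add: fm_rel_def allN_e_def exN_e_def push_num_def num_at_def)+

lemma fm_rel_setS [rel]:
  "(\<And>X. fm_rel (push_set X c) (B (set_at (fst (snd c)))) (P X)) \<Longrightarrow>
    fm_rel c (allS_e B) (\<forall>X\<in>Sets. P X)"
  "(\<And>X. fm_rel (push_set X c) (B (set_at (fst (snd c)))) (P X)) \<Longrightarrow>
    fm_rel c (exS_e B) (\<exists>X\<in>Sets. P X)"
  by (cases c; simp add: fm_rel_def allS_e_def exS_e_def push_set_def set_at_def)+

lemma all_triple: "(\<forall>q :: triple. P q) \<longleftrightarrow> (\<forall>a b c. P (a, b, c))" by auto
lemma all_interval: "(\<forall>u :: interval. P u) \<longleftrightarrow> (\<forall>p q. P (p, q))" by auto
lemma ex_interval: "(\<exists>u :: interval. P u) \<longleftrightarrow> (\<exists>p q. P (p, q))" by auto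
lemma ex_triple: "(\<exists>q :: triple. P q) \<longleftrightarrow> (\<exists>a b c. P (a, b, c))" by auto

lemma fm_rel_ratQ [rel]:
  "(\<And>q. fm_rel (push_rat q c) (B (rat_at (fst c))) (P q)) \<Longrightarrow> fm_rel c (allQ_e B) (\<forall>q. P q)"
  "(\<And>q. fm_rel (push_rat q c) (B (rat_at (fst c))) (P q)) \<Longrightarrow> fm_rel c (exQ_e B) (\<exists>q. P q)"
proof -
  assume "\<And>q. fm_rel (push_rat q c) (B (rat_at (fst c))) (P q)"
  from this[of "(x, y, z)" for x y z]
  have *: "fm_rel (push_num z (push_num y (push_num x c)))
      (B (num_at (fst c), num_at (fst (push_num x c)), num_at (fst (push_num y (push_num x c)))))
      (P (x, y, z))" for x y z
    by (simp add: push_rat_def rat_at_def fst_push_num)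
  show "fm_rel c (allQ_e B) (\<forall>q. P q)" "fm_rel c (exQ_e B) (\<exists>q. P q)"
    unfolding allQ_e_def exQ_e_def all_triple ex_triple by (intro fm_rel_numN *)+
qed

lemma fm_rel_intI [rel]:
  "(\<And>u. fm_rel (push_int u c) (B (int_at (fst c))) (P u)) \<Longrightarrow> fm_rel c (allI_e B) (\<forall>u. P u)"
  "(\<And>u. fm_rel (push_int u c) (B (int_at (fst c))) (P u)) \<Longrightarrow> fm_rel c (exI_e B) (\<exists>u. P u)"
proof -
  assume "\<And>u. fm_rel (push_int u c) (B (int_at (fst c))) (P u)"
  from this[of "(p, q)" for p q] have *: "fm_rel (push_rat q (push_rat p c))
      (B (rat_at (fst c), rat_at (fst (push_rat p c)))) (P (p, q))"
    for p q by (simp add: push_int_def int_at_def fst_push_rat)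
  show "fm_rel c (allI_e B) (\<forall>u. P u)" "fm_rel c (exI_e B) (\<exists>u. P u)"
    unfolding allI_e_def exI_e_def all_interval ex_interval
    by (intro fm_rel_ratQ *)+
qed

subsection \<open>Rationals and intervals\<close>

lemma num_rel_pair [rel]: "num_rel c s x \<Longrightarrow> num_rel c t y \<Longrightarrow> num_rel c (pair s t) (tpair x y)"
  unfolding pair_def tpair_def by (intro rel)

lemma num_rel_qcode [rel]: "rat_rel c p q \<Longrightarrow> num_rel c (qcode p) (tcode q)"
  by (cases p) (auto simp: rat_rel_def tcode_def intro!: rel)

lemma num_rel_icode [rel]: "int_rel c U u \<Longrightarrow> num_rel c (icode U) (intcode u)"
proof -
  obtain p q where U: "U = (p, q)" by (cases U) blast
  assume "int_rel c U u"
  then have "rat_rel c p (fst u)" "rat_rel c q (snd u)" by (simp_all add: int_rel_def U)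
  then show "num_rel c (icode U) (intcode u)" unfolding U icode.simps intcode_def by (intro rel)
qed

lemma rat_rel_ops [rel]:
  "rat_rel c p q \<Longrightarrow> rat_rel c p' q' \<Longrightarrow> rat_rel c (p +\<^sub>Q p') (tadd q q')"
  "rat_rel c p q \<Longrightarrow> rat_rel c (qneg p) (tneg q)"
  "rat_rel c p q \<Longrightarrow> rat_rel c p' q' \<Longrightarrow> rat_rel c (p -\<^sub>Q p') (tadd q (tneg q'))"
  "rat_rel c p q \<Longrightarrow> rat_rel c (qhalf p) (thalf q)"
  by (cases p; cases p'; simp add: rat_rel_def tadd_def tneg_def thalf_def qsub_def; intro conjI rel;
      simp)+

lemma rat_rel_const [rel]:
  "rat_rel c qzero (0, 0, 0)" "rat_rel c qone (1, 0, 0)"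
  "num_rel c s x \<Longrightarrow> rat_rel c (\<one>, \<zero>, s) (1, 0, x)"
  by (auto simp: rat_rel_def qzero_def qone_def intro: rel)

lemma val_const [simp]: "val (0, 0, 0) = 0" "val (1, 0, 0) = 1"
  by (simp_all add: val_def)

lemma val_rel_ops [rel]:
  "rat_rel c p q \<Longrightarrow> val_rel c p (val q)"
  "val_rel c p r \<Longrightarrow> val_rel c p' r' \<Longrightarrow> val_rel c (p +\<^sub>Q p') (r + r')"
  "val_rel c p r \<Longrightarrow> val_rel c p' r' \<Longrightarrow> val_rel c (p -\<^sub>Q p') (r - r')"
  "val_rel c qzero 0" "val_rel c qone 1"
proof -
  show "rat_rel c p q \<Longrightarrow> val_rel c p (val q)"
    unfolding val_rel_def by blast
  show "val_rel c p r \<Longrightarrow> val_rel c p' r' \<Longrightarrow> val_rel c (p +\<^sub>Q p') (r + r')"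
    unfolding val_rel_def by (metis rat_rel_ops(1) val_tadd)
  show "val_rel c p r \<Longrightarrow> val_rel c p' r' \<Longrightarrow> val_rel c (p -\<^sub>Q p') (r - r')"
    unfolding val_rel_def by (metis rat_rel_ops(3) val_tadd val_tneg add_uminus_conv_diff)
  show "val_rel c qzero 0" "val_rel c qone 1"
    unfolding val_rel_def by (metis rat_rel_const(1,2) val_const)+
qed

lemma fm_rel_rat [rel]:
  "val_rel c p r \<Longrightarrow> val_rel c p' r' \<Longrightarrow> fm_rel c (p \<le>\<^sub>Q p') (r \<le> r')"
  "val_rel c p r \<Longrightarrow> val_rel c p' r' \<Longrightarrow> fm_rel c (p <\<^sub>Q p') (r < r')"
  "rat_rel c p q \<Longrightarrow> rat_rel c p' q' \<Longrightarrow> fm_rel c (qeq_code p p') (q = q')"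
proof -
  show le: "val_rel c p r \<Longrightarrow> val_rel c p' r' \<Longrightarrow> fm_rel c (p \<le>\<^sub>Q p') (r \<le> r')" for p p' r r'
    by (cases p; cases p') (auto simp: val_rel_def rat_rel_def val_le_iff intro!: rel)
  show "val_rel c p r \<Longrightarrow> val_rel c p' r' \<Longrightarrow> fm_rel c (p <\<^sub>Q p') (r < r')"
    using fm_rel_connectives(1)[OF le[of p' r' p r]] by (simp add: qless_def not_le)
  show "rat_rel c p q \<Longrightarrow> rat_rel c p' q' \<Longrightarrow> fm_rel c (qeq_code p p') (q = q')"
    using fm_rel_atoms(1)[OF num_rel_qcode num_rel_qcode, of c p q p' q'] by (simp add: qeq_code_def)
qed

text \<open>
  The constants prefixed with \<open>sem\<close> are the readings of the corresponding definitions in the model, with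
  comparisons of rationals expressed in the field \<open>rational\<close>. Each comes with its rule for \<open>fm_rel\<close>,
  \<open>seq_rel\<close> or \<open>fun_rel\<close>, proved by following the structure of the definition.
\<close>

lemmas rel_ext = num_rel_ext set_rel_ext rat_rel_ext int_rel_ext seq_rel_ext fun_rel_ext
lemmas [rel] = extends_intros num_rel_ext[OF num_rel_at] set_rel_ext[OF set_rel_at] rat_rel_ext[OF rat_rel_at]
  int_rel_ext[OF int_rel_at]

lemmas seq_rules = seq_relD seq_rel_ext
lemmas fun_rules = fun_relD fun_rel_ext

definition sem_pow2 :: "number \<Rightarrow> number \<Rightarrow> bool" where
  "sem_pow2 k m \<longleftrightarrow> (\<exists>F\<in>Sets.
      (\<forall>n. n \<in> F \<longrightarrow> (\<exists>i j. n = tpair i j)) \<and>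
      (\<forall>i. \<exists>j. tpair i j \<in> F \<and> (\<forall>j'. tpair i j' \<in> F \<longrightarrow> j' = j)) \<and>
      tpair 0 1 \<in> F \<and>
      (\<forall>i j. tpair i j \<in> F \<longrightarrow> tpair (i + 1) (j + j) \<in> F) \<and>
      tpair k m \<in> F)"
definition sem_inv_pow2 :: "number \<Rightarrow> (triple \<Rightarrow> bool) \<Rightarrow> bool" where
  "sem_inv_pow2 k P \<longleftrightarrow> (\<exists>c. sem_pow2 k (c + 1) \<and> P (1, 0, c))"

lemma fm_rel_pow2 [rel]:
  "num_rel c k x \<Longrightarrow> num_rel c m y \<Longrightarrow> fm_rel c (pow2 k m) (sem_pow2 x y)"
  unfolding pow2_def sem_pow2_def
  by (assumption | rule rel | erule rel_ext)+

lemma fm_rel_inv_pow2 [rel]: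
  "num_rel c k x \<Longrightarrow>
    (\<And>z. fm_rel (push_num z c) (B (\<one>, \<zero>, num_at (fst c))) (P (1, 0, z))) \<Longrightarrow>
    fm_rel c (with_inv_pow2 k B) (sem_inv_pow2 x P)"
  unfolding with_inv_pow2_def sem_inv_pow2_def
  by (assumption | rule rel | erule rel_ext)+

type_synonym sequence = "number \<Rightarrow> triple \<Rightarrow> bool"
type_synonym interval_map = "interval \<Rightarrow> interval \<Rightarrow> bool"

definition sem_meets_R :: "interval \<Rightarrow> interval \<Rightarrow> bool" where
  "sem_meets_R u w \<longleftrightarrow> val (fst u) < val (snd w) \<and> val (fst w) < val (snd u)"
definition sem_subset_R :: "interval \<Rightarrow> interval \<Rightarrow> bool" where
  "sem_subset_R u w \<longleftrightarrow> val (fst w) \<le> val (fst u) \<and> val (snd u) \<le> val (snd w)"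
definition sem_basic_01 :: "interval \<Rightarrow> bool" where
  "sem_basic_01 u \<longleftrightarrow> val (fst u) < val (snd u) \<and> val (fst u) < 1 \<and> 0 < val (snd u)"
definition sem_subset_01 :: "interval \<Rightarrow> interval \<Rightarrow> bool" where
  "sem_subset_01 u w \<longleftrightarrow> (val (fst w) < 0 \<or> val (fst w) \<le> val (fst u)) \<and>
    (1 < val (snd w) \<or> val (snd u) \<le> val (snd w))"

lemma int_relE:
  assumes "int_rel c U u"
  obtains p q where "U = (p, q)" "rat_rel c p (fst u)" "rat_rel c q (snd u)"
  using assms by (cases U) (auto simp only: int_rel_def fst_conv snd_conv)

lemma fm_rel_intervals [rel]:
  "int_rel c U u \<Longrightarrow> fm_rel c (basic_R U) (val (fst u) < val (snd u))"
  "int_rel c U u \<Longrightarrow> fm_rel c (basic_01 U) (sem_basic_01 u)"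
  "int_rel c U u \<Longrightarrow> int_rel c W w \<Longrightarrow> fm_rel c (meets_R U W) (sem_meets_R u w)"
  "int_rel c U u \<Longrightarrow> int_rel c W w \<Longrightarrow> fm_rel c (subset_R U W) (sem_subset_R u w)"
  "int_rel c U u \<Longrightarrow> int_rel c W w \<Longrightarrow> fm_rel c (subset_01 U W) (sem_subset_01 u w)"
  "int_rel c U u \<Longrightarrow> val_rel c (len U) (val (snd u) - val (fst u))"
  "int_rel c U u \<Longrightarrow> rat_rel c (midpoint U) (thalf (tadd (fst u) (snd u)))"
  by (elim int_relE, hypsubst,
      simp only: basic_R.simps basic_01.simps meets_R.simps subset_R.simps subset_01.simps
        len.simps midpoint.simps sem_basic_01_def sem_meets_R_def sem_subset_R_def sem_subset_01_def,
      (assumption | rule rel)+)+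

definition sem_is_real :: "sequence \<Rightarrow> bool" where
  "sem_is_real R \<longleftrightarrow>
    (\<forall>k. \<exists>q. R k q \<and> (\<forall>q'. R k q' \<longrightarrow> q' = q)) \<and>
    (\<forall>m n q q'. m \<le> n \<longrightarrow> R m q \<longrightarrow> R n q' \<longrightarrow>
      sem_inv_pow2 m (\<lambda>e. val q \<le> val q' + val e \<and> val q' \<le> val q + val e))"

lemma rel_is_real [rel]:
  assumes R: "seq_rel c R r"
  shows "fm_rel c (is_real R) (sem_is_real r)"
  unfolding is_real_def sem_is_real_def
  by ((assumption | rule rel seq_rules[OF R] | erule rel_ext extends_trans)+)

definition sem_real_le :: "sequence \<Rightarrow> sequence \<Rightarrow> bool" where
  "sem_real_le R R' \<longleftrightarrow> (\<forall>k q q'. R k q \<longrightarrow> R' k q' \<longrightarrow>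
      sem_inv_pow2 k (\<lambda>e. val q \<le> val q' + (val e + val e)))"

lemma rel_real_le [rel]:
  assumes R: "seq_rel c R r" and R': "seq_rel c R' r'"
  shows "fm_rel c (R \<le>\<^sub>R R') (sem_real_le r r')"
  unfolding real_le_def sem_real_le_def
  by ((assumption | rule rel seq_rules[OF R] seq_rules[OF R'] | erule rel_ext extends_trans)+)

definition sem_real_less :: "sequence \<Rightarrow> sequence \<Rightarrow> bool" where
  "sem_real_less R R' \<longleftrightarrow> \<not> sem_real_le R' R"

lemma rel_real_less [rel]:
  assumes R: "seq_rel c R r" and R': "seq_rel c R' r'"
  shows "fm_rel c (R <\<^sub>R R') (sem_real_less r r')"
  unfolding real_less_def sem_real_less_def
  by ((assumption | rule rel seq_rules[OF R] seq_rules[OF R'] | erule rel_ext extends_trans)+)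

definition sem_real_eq :: "sequence \<Rightarrow> sequence \<Rightarrow> bool" where
  "sem_real_eq R R' \<longleftrightarrow> (\<forall>k q q'. R k q \<longrightarrow> R' k q' \<longrightarrow>
      sem_inv_pow2 k (\<lambda>e. val q \<le> val q' + (val e + val e) \<and> val q' \<le> val q + (val e + val e)))"

lemma rel_real_eq [rel]:
  assumes R: "seq_rel c R r" and R': "seq_rel c R' r'"
  shows "fm_rel c (R =\<^sub>R R') (sem_real_eq r r')"
  unfolding real_eq_def sem_real_eq_def
  by ((assumption | rule rel seq_rules[OF R] seq_rules[OF R'] | erule rel_ext extends_trans)+)

definition sem_rconst :: "triple \<Rightarrow> sequence" where
  "sem_rconst p = (\<lambda>k q. q = p)"

lemma rel_rconst [rel]:
  assumes p: "rat_rel c p q"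
  shows "seq_rel c (rconst p) (sem_rconst q)"
  unfolding rconst_def sem_rconst_def
  by (rule seq_relI, (assumption | rule rel rat_rel_ext[OF p] | erule rel_ext extends_trans)+)

definition sem_rsub :: "sequence \<Rightarrow> sequence \<Rightarrow> sequence" where
  "sem_rsub R R' = (\<lambda>k q. \<exists>p p'. R (k + 1) p \<and> R' (k + 1) p' \<and> q = tadd p (tneg p'))"

lemma rel_rsub [rel]:
  assumes R: "seq_rel c R r" and R': "seq_rel c R' r'"
  shows "seq_rel c (R -\<^sub>R R') (sem_rsub r r')"
  unfolding rsub_def sem_rsub_def
  by (rule seq_relI, (assumption | rule rel seq_rules[OF R] seq_rules[OF R'] | erule rel_ext extends_trans)+)

definition sem_rabs :: "sequence \<Rightarrow> sequence" where
  "sem_rabs R = (\<lambda>k q. \<exists>p. R k p \<and> (0 \<le> val p \<and> q = p \<or> val p < 0 \<and> q = tneg p))"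

lemma rel_rabs [rel]:
  assumes R: "seq_rel c R r"
  shows "seq_rel c (rabs R) (sem_rabs r)"
  unfolding rabs_def sem_rabs_def
  by (rule seq_relI, (assumption | rule rel seq_rules[OF R] | erule rel_ext extends_trans)+)

definition sem_in_01 :: "sequence \<Rightarrow> bool" where
  "sem_in_01 R \<longleftrightarrow> sem_real_le (sem_rconst (0, 0, 0)) R \<and> sem_real_le R (sem_rconst (1, 0, 0))"

lemma rel_in_01 [rel]:
  assumes R: "seq_rel c R r"
  shows "fm_rel c (in_01 R) (sem_in_01 r)"
  unfolding in_01_def sem_in_01_def
  by ((assumption | rule rel seq_rules[OF R] | erule rel_ext extends_trans)+)

definition sem_in_U :: "sequence \<Rightarrow> interval \<Rightarrow> bool" where
  "sem_in_U R u \<longleftrightarrow> sem_in_01 R \<and> sem_real_less (sem_rconst (fst u)) R \<and>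
    sem_real_less R (sem_rconst (snd u))"

lemma rel_in_U [rel]:
  assumes "seq_rel c R r" and "int_rel c U u"
  shows "fm_rel c (in_U R U) (sem_in_U r u)"
  using assms
  by (elim int_relE, hypsubst, simp only: in_U.simps sem_in_U_def) (assumption | rule rel)+

definition sem_set_seq :: "number set \<Rightarrow> sequence" where
  "sem_set_seq X = (\<lambda>k q. tpair k (tcode q) \<in> X)"

lemma rel_set_seq [rel]:
  assumes X: "set_rel c X A"
  shows "seq_rel c (set_seq X) (sem_set_seq A)"
  unfolding set_seq_def sem_set_seq_def
  by (rule seq_relI, (assumption | rule rel set_rel_ext[OF X] | erule rel_ext extends_trans)+)

definition sem_slice_seq :: "number set \<Rightarrow> number \<Rightarrow> sequence" where
  "sem_slice_seq Z i = (\<lambda>k q. tpair (tpair i k) (tcode q) \<in> Z)"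

lemma rel_slice_seq [rel]:
  assumes X: "set_rel c X A" and i: "num_rel c i x"
  shows "seq_rel c (slice_seq X i) (sem_slice_seq A x)"
  unfolding slice_seq_def sem_slice_seq_def
  by (rule seq_relI, (assumption | rule rel set_rel_ext[OF X] num_rel_ext[OF i] | erule rel_ext extends_trans)+)

definition sem_real_set :: "number set \<Rightarrow> bool" where
  "sem_real_set X \<longleftrightarrow> (\<forall>n. n \<in> X \<longrightarrow> (\<exists>k q. n = tpair k (tcode q))) \<and> sem_is_real (sem_set_seq X)"

lemma rel_real_set [rel]:
  assumes X: "set_rel c X A"
  shows "fm_rel c (real_set X) (sem_real_set A)"
  unfolding real_set_def sem_real_set_def
  by ((assumption | rule rel set_rel_ext[OF X] | erule rel_ext extends_trans)+)

definition sem_real_sequence :: "number set \<Rightarrow> bool" where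
  "sem_real_sequence Z \<longleftrightarrow> (\<forall>n. n \<in> Z \<longrightarrow> (\<exists>i k q. n = tpair (tpair i k) (tcode q))) \<and>
    (\<forall>i. sem_is_real (sem_slice_seq Z i))"

lemma rel_real_sequence [rel]:
  assumes X: "set_rel c X A"
  shows "fm_rel c (real_sequence X) (sem_real_sequence A)"
  unfolding real_sequence_def sem_real_sequence_def
  by ((assumption | rule rel set_rel_ext[OF X] | erule rel_ext extends_trans)+)

definition sem_finite_real_sequence :: "number set \<Rightarrow> number \<Rightarrow> bool" where
  "sem_finite_real_sequence Z s \<longleftrightarrow>
    (\<forall>n. n \<in> Z \<longrightarrow> (\<exists>i k q. i < s \<and> n = tpair (tpair i k) (tcode q))) \<and>
    (\<forall>i. i < s \<longrightarrow> sem_is_real (sem_slice_seq Z i))"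

lemma rel_finite_real_sequence [rel]:
  assumes X: "set_rel c X A" and i: "num_rel c i x"
  shows "fm_rel c (finite_real_sequence X i) (sem_finite_real_sequence A x)"
  unfolding finite_real_sequence_def sem_finite_real_sequence_def
  by ((assumption | rule rel set_rel_ext[OF X] num_rel_ext[OF i] | erule rel_ext extends_trans)+)

definition sem_partial_continuous :: "interval_map \<Rightarrow> bool" where
  "sem_partial_continuous f \<longleftrightarrow>
    (\<forall>u w. f u w \<longrightarrow> sem_basic_01 u \<and> val (fst w) < val (snd w)) \<and>
    (\<forall>u w w'. f u w \<longrightarrow> f u w' \<longrightarrow> sem_meets_R w w') \<and>
    (\<forall>u w u'. f u w \<longrightarrow> sem_basic_01 u' \<longrightarrow> sem_subset_01 u' u \<longrightarrow> f u' w) \<and>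
    (\<forall>u w w'. f u w \<longrightarrow> val (fst w') < val (snd w') \<longrightarrow> sem_subset_R w w' \<longrightarrow> f u w')"

lemma rel_partial_continuous [rel]:
  assumes F: "fun_rel c F f"
  shows "fm_rel c (partial_continuous F) (sem_partial_continuous f)"
  unfolding partial_continuous_def sem_partial_continuous_def
  by ((assumption | rule rel fun_rules[OF F] | erule rel_ext extends_trans)+)

definition sem_witness :: "interval_map \<Rightarrow> sequence \<Rightarrow> rational \<Rightarrow> interval \<Rightarrow> bool" where
  "sem_witness f x \<epsilon> w \<longleftrightarrow> (\<exists>u. f u w \<and> sem_in_U x u \<and> val (snd w) - val (fst w) \<le> \<epsilon>)"

lemma rel_witness [rel]:
  assumes F: "fun_rel c F f" and R: "seq_rel c R r" and e: "rat_rel c e q" and W: "int_rel c W w"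
  shows "fm_rel c (witness F R e W) (sem_witness f r (val q) w)"
  unfolding witness_def sem_witness_def
  by (assumption | rule rel fun_relD[OF F] seq_rel_ext[OF R] rat_rel_ext[OF e]
      int_rel_ext[OF W])+

definition sem_in_domain :: "interval_map \<Rightarrow> sequence \<Rightarrow> bool" where
  "sem_in_domain f x \<longleftrightarrow> (\<forall>\<epsilon>. 0 < val \<epsilon> \<longrightarrow> (\<exists>w. sem_witness f x (val \<epsilon>) w))"

lemma rel_in_domain [rel]:
  assumes F: "fun_rel c F f" and R: "seq_rel c R r"
  shows "fm_rel c (in_domain F R) (sem_in_domain f r)"
  unfolding in_domain_def sem_in_domain_def
  by ((assumption | rule rel fun_rules[OF F] seq_rules[OF R] | erule rel_ext extends_trans)+)

definition sem_total_continuous :: "interval_map \<Rightarrow> bool" where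
  "sem_total_continuous f \<longleftrightarrow> sem_partial_continuous f \<and>
    (\<forall>X\<in>Sets. sem_real_set X \<longrightarrow> sem_in_01 (sem_set_seq X) \<longrightarrow> sem_in_domain f (sem_set_seq X))"

lemma rel_total_continuous [rel]:
  assumes F: "fun_rel c F f"
  shows "fm_rel c (total_continuous F) (sem_total_continuous f)"
  unfolding total_continuous_def sem_total_continuous_def
  by ((assumption | rule rel fun_rules[OF F] | erule rel_ext extends_trans)+)

definition sem_least_witness :: "interval_map \<Rightarrow> sequence \<Rightarrow> triple \<Rightarrow> interval \<Rightarrow> bool" where
  "sem_least_witness f x \<epsilon> w \<longleftrightarrow> sem_witness f x (val \<epsilon>) w \<and>
    (\<forall>w'. sem_witness f x (val \<epsilon>) w' \<longrightarrow> intcode w \<le> intcode w')"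

lemma rel_least_witness [rel]:
  assumes F: "fun_rel c F f" and R: "seq_rel c R r" and e: "rat_rel c e q" and W: "int_rel c W w"
  shows "fm_rel c (least_witness F R e W) (sem_least_witness f r q w)"
  unfolding least_witness_def sem_least_witness_def
  by ((assumption | rule rel fun_rules[OF F] seq_rules[OF R] rat_rel_ext[OF e] int_rel_ext[OF W] | erule rel_ext extends_trans)+)

definition sem_fun_value :: "interval_map \<Rightarrow> sequence \<Rightarrow> sequence" where
  "sem_fun_value f x = (\<lambda>n q. sem_inv_pow2 n (\<lambda>e.
      \<exists>w. sem_least_witness f x e w \<and> q = thalf (tadd (fst w) (snd w))))"

lemma rel_fun_value [rel]:
  assumes F: "fun_rel c F f" and R: "seq_rel c R r"
  shows "seq_rel c (fun_value F R) (sem_fun_value f r)"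
  unfolding fun_value_def sem_fun_value_def
  by (rule seq_relI, (assumption | rule rel fun_rules[OF F] seq_rules[OF R] | erule rel_ext extends_trans)+)

definition sem_slice_fun :: "number set \<Rightarrow> number \<Rightarrow> interval_map" where
  "sem_slice_fun D m = (\<lambda>u w. tpair m (tpair (intcode u) (intcode w)) \<in> D)"

lemma rel_slice_fun [rel]:
  assumes D: "set_rel c D E" and m: "num_rel c m x"
  shows "fun_rel c (slice_fun D m) (sem_slice_fun E x)"
  unfolding slice_fun_def sem_slice_fun_def
  by (rule fun_relI, (assumption | rule rel set_rel_ext[OF D] num_rel_ext[OF m] | erule rel_ext extends_trans)+)

lemma rel_eventually [rel]:
  "(\<And>k m. fm_rel (push_num m (push_num k c)) (B (num_at (fst (push_num k c)))) (P m)) \<Longrightarrow>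
    fm_rel c (eventually_e B) (\<exists>k. \<forall>m. k \<le> m \<longrightarrow> P m)"
  unfolding eventually_e_def
  by (rule rel, rule rel, rule rel, (rule rel)+)

definition sem_baire1 :: "number set \<Rightarrow> bool" where
  "sem_baire1 D \<longleftrightarrow>
    (\<forall>n. n \<in> D \<longrightarrow> (\<exists>m u w. n = tpair m (tpair (intcode u) (intcode w)))) \<and>
    (\<forall>m. sem_total_continuous (sem_slice_fun D m)) \<and>
    (\<forall>X\<in>Sets. sem_real_set X \<longrightarrow> sem_in_01 (sem_set_seq X) \<longrightarrow>
      (\<forall>\<epsilon>. 0 < val \<epsilon> \<longrightarrow> (\<exists>k. \<forall>m n. k \<le> m \<longrightarrow> k \<le> n \<longrightarrow>
        sem_real_le (sem_rabs (sem_rsub (sem_fun_value (sem_slice_fun D m) (sem_set_seq X))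
          (sem_fun_value (sem_slice_fun D n) (sem_set_seq X)))) (sem_rconst \<epsilon>))))"

lemma rel_baire1 [rel]:
  assumes D: "set_rel c D E"
  shows "fm_rel c (baire1 D) (sem_baire1 E)"
  unfolding baire1_def sem_baire1_def
  by ((assumption | rule rel set_rel_ext[OF D] | erule rel_ext extends_trans)+)

definition sem_baire_ge :: "number set \<Rightarrow> sequence \<Rightarrow> sequence \<Rightarrow> bool" where
  "sem_baire_ge D x y \<longleftrightarrow> (\<forall>q. sem_real_less (sem_rconst q) y \<longrightarrow>
    (\<exists>k. \<forall>m. k \<le> m \<longrightarrow> sem_real_less (sem_rconst q) (sem_fun_value (sem_slice_fun D m) x)))"

lemma rel_baire_ge [rel]:
  assumes D: "set_rel c D E" and R: "seq_rel c R r" and R': "seq_rel c R' r'"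
  shows "fm_rel c (baire_ge D R R') (sem_baire_ge E r r')"
  unfolding baire_ge_def sem_baire_ge_def
  by ((assumption | rule rel set_rel_ext[OF D] seq_rules[OF R] seq_rules[OF R'] | erule rel_ext extends_trans)+)

definition sem_baire_le :: "number set \<Rightarrow> sequence \<Rightarrow> sequence \<Rightarrow> bool" where
  "sem_baire_le D x y \<longleftrightarrow> (\<forall>q. sem_real_less y (sem_rconst q) \<longrightarrow>
    (\<exists>k. \<forall>m. k \<le> m \<longrightarrow> sem_real_less (sem_fun_value (sem_slice_fun D m) x) (sem_rconst q)))"

lemma rel_baire_le [rel]:
  assumes D: "set_rel c D E" and R: "seq_rel c R r" and R': "seq_rel c R' r'"
  shows "fm_rel c (baire_le D R R') (sem_baire_le E r r')"
  unfolding baire_le_def sem_baire_le_def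
  by ((assumption | rule rel set_rel_ext[OF D] seq_rules[OF R] seq_rules[OF R'] | erule rel_ext extends_trans)+)

definition sem_baire1_gauge :: "number set \<Rightarrow> bool" where
  "sem_baire1_gauge D \<longleftrightarrow> sem_baire1 D \<and>
    (\<forall>X\<in>Sets. sem_real_set X \<longrightarrow> sem_in_01 (sem_set_seq X) \<longrightarrow>
      \<not> sem_baire_le D (sem_set_seq X) (sem_rconst (0, 0, 0)))"

lemma rel_baire1_gauge [rel]:
  assumes D: "set_rel c D E"
  shows "fm_rel c (baire1_gauge D) (sem_baire1_gauge E)"
  unfolding baire_gt_def baire1_gauge_def sem_baire1_gauge_def
  by ((assumption | rule rel set_rel_ext[OF D] | erule rel_ext extends_trans)+)

lemma rel_point_tag [rel]:
  "set_rel c X A \<Longrightarrow> num_rel c j x \<Longrightarrow> seq_rel c (point X j) (sem_slice_seq A (x + x))"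
  "set_rel c X A \<Longrightarrow> num_rel c j x \<Longrightarrow> seq_rel c (tag X j) (sem_slice_seq A (x + x + 1))"
  unfolding point_def tag_def by (assumption | rule rel)+

definition sem_tagged_partition :: "number set \<Rightarrow> number \<Rightarrow> bool" where
  "sem_tagged_partition P l \<longleftrightarrow> sem_finite_real_sequence P (l + l + 1) \<and>
    sem_real_eq (sem_slice_seq P (0 + 0)) (sem_rconst (0, 0, 0)) \<and>
    sem_real_eq (sem_slice_seq P (l + l)) (sem_rconst (1, 0, 0)) \<and>
    (\<forall>j. j < l \<longrightarrow>
      sem_real_less (sem_slice_seq P (j + j)) (sem_slice_seq P ((j + 1) + (j + 1))) \<and>
      sem_real_le (sem_slice_seq P (j + j)) (sem_slice_seq P (j + j + 1)) \<and>
      sem_real_le (sem_slice_seq P (j + j + 1)) (sem_slice_seq P ((j + 1) + (j + 1))))"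

lemma rel_tagged_partition [rel]:
  assumes X: "set_rel c X A" and i: "num_rel c i x"
  shows "fm_rel c (tagged_partition X i) (sem_tagged_partition A x)"
  unfolding tagged_partition_def sem_tagged_partition_def
  by ((assumption | rule rel set_rel_ext[OF X] num_rel_ext[OF i] | erule rel_ext extends_trans)+)

definition sem_fine :: "number set \<Rightarrow> number set \<Rightarrow> number \<Rightarrow> bool" where
  "sem_fine D P l \<longleftrightarrow> (\<forall>j. j < l \<longrightarrow>
    sem_baire_ge D (sem_slice_seq P (j + j + 1))
      (sem_rsub (sem_slice_seq P (j + j + 1)) (sem_slice_seq P (j + j))) \<and>
    sem_baire_ge D (sem_slice_seq P (j + j + 1))
      (sem_rsub (sem_slice_seq P ((j + 1) + (j + 1))) (sem_slice_seq P (j + j + 1))))"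

lemma rel_fine [rel]:
  assumes D: "set_rel c D E" and X: "set_rel c X A" and i: "num_rel c i x"
  shows "fm_rel c (fine D X i) (sem_fine E A x)"
  unfolding fine_def sem_fine_def
  by ((assumption | rule rel set_rel_ext[OF D] set_rel_ext[OF X] num_rel_ext[OF i] | erule rel_ext extends_trans)+)

definition sem_cauchy_seq :: "number set \<Rightarrow> bool" where
  "sem_cauchy_seq Z \<longleftrightarrow> (\<forall>\<epsilon>. 0 < val \<epsilon> \<longrightarrow> (\<exists>k. \<forall>m n. k \<le> m \<longrightarrow> k \<le> n \<longrightarrow>
    sem_real_le (sem_rabs (sem_rsub (sem_slice_seq Z m) (sem_slice_seq Z n))) (sem_rconst \<epsilon>)))"

lemma rel_cauchy_seq [rel]:
  assumes X: "set_rel c X A"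
  shows "fm_rel c (cauchy_seq X) (sem_cauchy_seq A)"
  unfolding cauchy_seq_def sem_cauchy_seq_def
  by ((assumption | rule rel set_rel_ext[OF X] | erule rel_ext extends_trans)+)

definition sem_is_limit :: "number set \<Rightarrow> sequence \<Rightarrow> bool" where
  "sem_is_limit Z y \<longleftrightarrow> (\<forall>\<epsilon>. 0 < val \<epsilon> \<longrightarrow> (\<exists>k. \<forall>n. k \<le> n \<longrightarrow>
    sem_real_le (sem_rabs (sem_rsub (sem_slice_seq Z n) y)) (sem_rconst \<epsilon>)))"

lemma rel_is_limit [rel]:
  assumes X: "set_rel c X A" and R: "seq_rel c R r"
  shows "fm_rel c (is_limit X R) (sem_is_limit A r)"
  unfolding is_limit_def sem_is_limit_def
  by ((assumption | rule rel set_rel_ext[OF X] seq_rules[OF R] | erule rel_ext extends_trans)+)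

lemma eval_CL_B1:
  "eval Sets v V CL_B1 \<longleftrightarrow>
    (\<forall>D\<in>Sets. sem_baire1_gauge D \<longrightarrow> (\<exists>P\<in>Sets. \<exists>l. sem_tagged_partition P l \<and> sem_fine D P l))"
proof -
  have "fm_rel (0, 0, v, V)
      (\<forall>\<^sub>S D. baire1_gauge D \<^bold>\<longrightarrow> (\<exists>\<^sub>S P. \<exists>\<^sub>N l. tagged_partition P l \<^bold>\<and> fine D P l))
      (\<forall>D\<in>Sets. sem_baire1_gauge D \<longrightarrow> (\<exists>P\<in>Sets. \<exists>l. sem_tagged_partition P l \<and> sem_fine D P l))"
    by (assumption | rule rel | erule rel_ext)+
  then show ?thesis by (simp add: fm_rel_def CL_B1_def sentence_def)
qed

lemma eval_SC:
  "eval Sets v V SC \<longleftrightarrow>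
    (\<forall>Z\<in>Sets. sem_real_sequence Z \<and> (\<forall>n. sem_in_01 (sem_slice_seq Z n)) \<and> sem_cauchy_seq Z \<longrightarrow>
      (\<exists>Y\<in>Sets. sem_real_set Y \<and> sem_is_limit Z (sem_set_seq Y)))"
proof -
  have "fm_rel (0, 0, v, V)
      (\<forall>\<^sub>S Z. real_sequence Z \<^bold>\<and> (\<forall>\<^sub>N n. in_01 (slice_seq Z n)) \<^bold>\<and> cauchy_seq Z \<^bold>\<longrightarrow>
        (\<exists>\<^sub>S Y. real_set Y \<^bold>\<and> is_limit Z (set_seq Y)))
      (\<forall>Z\<in>Sets. sem_real_sequence Z \<and> (\<forall>n. sem_in_01 (sem_slice_seq Z n)) \<and> sem_cauchy_seq Z \<longrightarrow>
        (\<exists>Y\<in>Sets. sem_real_set Y \<and> sem_is_limit Z (sem_set_seq Y)))"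
    by (assumption | rule rel | erule rel_ext)+
  then show ?thesis by (simp add: fm_rel_def SC_def sentence_def)
qed

section \<open>Powers of two\<close>

(* Triples and intervals are handled as units, through val and their codes. *)
declare split_paired_All [simp del] split_paired_Ex [simp del]

lemma polynomial_tpair: "polynomial f \<Longrightarrow> polynomial g \<Longrightarrow> polynomial (\<lambda>v. tpair (f v) (g v))"
  unfolding tpair_def by (intro polynomial_intros)

definition power_graph :: "number set \<Rightarrow> bool" where
  "power_graph F \<longleftrightarrow> F \<in> Sets \<and> (\<forall>i. \<exists>j. tpair i j \<in> F \<and> (\<forall>j'. tpair i j' \<in> F \<longrightarrow> j' = j)) \<and>
    tpair 0 1 \<in> F \<and> (\<forall>i j. tpair i j \<in> F \<longrightarrow> tpair (i + 1) (j + j) \<in> F)"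

text \<open>
  Agreement of two graphs at a given exponent is \<open>\<Sigma>\<^sub>1\<close> when stated as the existence of a common value.
\<close>

lemma power_graph_unique:
  assumes "power_graph F" "power_graph G" "tpair k m \<in> F" "tpair k n \<in> G"
  shows "m = n"
proof -
  have "Sigma1 (\<lambda>v. \<exists>y. tpair (v 0) y \<in> F \<and> tpair (v 0) y \<in> G)"
    using assms(1,2) unfolding power_graph_def
    by (intro Sigma1_ex Sigma1_Delta0 Delta0_basic polynomial_intros polynomial_tpair) auto
  then have "\<exists>y. tpair k y \<in> F \<and> tpair k y \<in> G"
  proof (rule Sigma1_induct)
    show "\<exists>y. tpair 0 y \<in> F \<and> tpair 0 y \<in> G"
      using assms(1,2) unfolding power_graph_def by blast
  next
    fix x assume "\<exists>y. tpair x y \<in> F \<and> tpair x y \<in> G"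
    then show "\<exists>y. tpair (x + 1) y \<in> F \<and> tpair (x + 1) y \<in> G"
      using assms(1,2) unfolding power_graph_def by blast
  qed
  then show ?thesis using assms unfolding power_graph_def by metis
qed

lemma sem_pow2_iff: "sem_pow2 k m \<longleftrightarrow>
    (\<exists>F. power_graph F \<and> (\<forall>n. n \<in> F \<longrightarrow> (\<exists>i j. n = tpair i j)) \<and> tpair k m \<in> F)"
  unfolding sem_pow2_def power_graph_def by blast

lemma sem_pow2_unique: "sem_pow2 k m \<Longrightarrow> sem_pow2 k n \<Longrightarrow> m = n"
  unfolding sem_pow2_iff using power_graph_unique by blast

text \<open>
  One power of two suffices, because the formula defining it supplies the whole graph of exponentiation as a set. The
  definition of a real number contains this formula, so the existence of a real is enough.
\<close>

locale powers =
  assumes power_graph_exists: "\<exists>k m. sem_pow2 k m"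
begin

definition graph :: "number set" where
  "graph = (SOME F. power_graph F \<and> (\<forall>n. n \<in> F \<longrightarrow> (\<exists>i j. n = tpair i j)))"

lemma graph: "power_graph graph" "\<forall>n. n \<in> graph \<longrightarrow> (\<exists>i j. n = tpair i j)"
proof -
  have "\<exists>F. power_graph F \<and> (\<forall>n. n \<in> F \<longrightarrow> (\<exists>i j. n = tpair i j))"
    using power_graph_exists unfolding sem_pow2_iff by blast
  from someI_ex[OF this] show "power_graph graph" "\<forall>n. n \<in> graph \<longrightarrow> (\<exists>i j. n = tpair i j)"
    unfolding graph_def by blast+
qed

lemma graph_Sets: "graph \<in> Sets" using graph by (simp add: power_graph_def)

definition two_to :: "number \<Rightarrow> number" where "two_to k = (THE m. tpair k m \<in> graph)"

lemma graph_iff: "tpair k m \<in> graph \<longleftrightarrow> m = two_to k"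
proof -
  obtain j where j: "tpair k j \<in> graph" "\<And>j'. tpair k j' \<in> graph \<Longrightarrow> j' = j"
    using graph(1) unfolding power_graph_def by blast
  then have "two_to k = j" unfolding two_to_def by blast
  then show ?thesis using j by blast
qed

lemma sem_pow2: "sem_pow2 k m \<longleftrightarrow> m = two_to k"
  using graph graph_iff sem_pow2_unique unfolding sem_pow2_iff by metis

lemma two_to_0: "two_to 0 = 1" and two_to_Suc: "two_to (k + 1) = two_to k + two_to k"
  using graph(1) graph_iff unfolding power_graph_def by metis+

text \<open>
  Exponentiation is not a term, so an induction about it runs over its graph.
\<close>

lemma two_to_induct:
  assumes "Delta0 (\<lambda>v. P (v 1) (v 0))" "P 0 (1::number)" "\<And>k y. P k y \<Longrightarrow> P (k + 1) (y + y)"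
  shows "P k (two_to k)"
proof -
  have "Delta0 (\<lambda>v. (\<lambda>v. P (v 1) (v 0)) (case_nat (v 0) (\<lambda>_. v 1)))"
  proof (rule Delta0_subst[OF assms(1)])
    show "polynomial (\<lambda>v. case_nat (v 0) (\<lambda>_. v 1) i)" for i
      by (cases i) (auto intro: polynomial_intros)
  qed
  then have "Sigma1 (\<lambda>v. \<exists>y. tpair (v 0) y \<in> graph \<and> P (v 0) y)"
    using graph_Sets
    by (intro Sigma1_ex_Delta0 Delta0_basic polynomial_intros polynomial_tpair) auto
  then have "\<exists>y. tpair k y \<in> graph \<and> P k y"
    by (rule Sigma1_induct) (auto simp: graph_iff two_to_0 two_to_Suc assms)
  then show ?thesis by (auto simp: graph_iff)
qed

lemma less_two_to: "k < two_to k"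
proof (rule two_to_induct)
  fix k y :: number assume "k < y"
  then have "k + 1 \<le> y" by (metis linorder_not_less number_less_add_1)
  moreover have "0 < y" using \<open>k < y\<close> by (rule le_less_trans[OF number_ge_0])
  ultimately show "k + 1 < y + y" by (metis add_0 add_le_less_mono add.commute)
qed (intro Delta0_basic polynomial_intros, simp)

lemma two_to_pos: "0 < two_to k"
  using less_two_to[of k] by (meson le_less_trans number_ge_0)

definition E :: "number \<Rightarrow> rational" where "E k = 1 / rat_of (two_to k)"

lemma rat_of_pos [simp]: "0 < rat_of x \<longleftrightarrow> 0 < x"
  using rat_of_less[of 0 x] by simp

lemma E_pos [simp]: "0 < E k"
  using two_to_pos[of k] rat_of_less[of 0 "two_to k"] by (simp add: E_def)

lemma E_nonneg [simp]: "0 \<le> E k"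
  using E_pos[of k] by (rule less_imp_le)

lemma E_Suc: "E (k + 1) = E k / 2"
  by (simp add: E_def two_to_Suc)

lemma E_antimono: "m \<le> n \<Longrightarrow> E n \<le> E m"
proof -
  assume "m \<le> n"
  then obtain d where n: "n = m + d" by (auto simp: number_le_iff)
  have "two_to m \<le> two_to (m + d)"
  proof -
    have "Sigma1 (\<lambda>v. \<exists>y. tpair (m + v 0) y \<in> graph \<and> two_to m \<le> y)"
      using graph_Sets
      by (intro Sigma1_ex_Delta0 Delta0_basic polynomial_intros polynomial_tpair)
    then have "\<exists>y. tpair (m + d) y \<in> graph \<and> two_to m \<le> y"
      by (rule Sigma1_induct)
        (auto simp: graph_iff two_to_Suc add.assoc[symmetric] intro: add_increasing)
    then show ?thesis by (auto simp: graph_iff)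
  qed
  then show ?thesis
    unfolding n E_def using two_to_pos[of m] rat_of_less[of 0 "two_to m"]
    by (intro divide_left_mono) (auto intro!: mult_pos_pos simp: less_le_trans)
qed

lemma E_small: "0 < \<epsilon> \<Longrightarrow> \<exists>k. E k < \<epsilon>"
proof -
  assume pos: "0 < \<epsilon>"
  obtain a b c where \<epsilon>: "\<epsilon> = (rat_of a - rat_of b) / (rat_of c + 1)" by (rule rational_cases)
  have "0 < rat_of a - rat_of b"
    using pos unfolding \<epsilon> by (simp only: pos_less_divide_eq[OF rat_of_add_1_pos(1)] mult_zero_left)
  then have "b < a" by simp
  then have "rat_of (b + 1) \<le> rat_of a" by (metis linorder_not_less number_less_add_1 rat_of_le)
  then have "1 / (rat_of c + 1) \<le> \<epsilon>" unfolding \<epsilon> by (intro divide_right_mono) auto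
  moreover have "E (c + 1) < 1 / (rat_of c + 1)"
    using less_two_to[of "c + 1"] rat_of_less[of "c + 1" "two_to (c + 1)"]
    unfolding E_def by (intro divide_strict_left_mono) (auto intro!: mult_pos_pos simp: two_to_pos)
  ultimately show ?thesis by (meson less_le_trans)
qed

lemma E_bound: "0 < \<epsilon> \<Longrightarrow> \<exists>K. \<forall>n\<ge>K. E n < \<epsilon>"
  using E_small E_antimono by (meson le_less_trans)

definition inv_pow2 :: "number \<Rightarrow> triple" where "inv_pow2 k = (1, 0, two_to k - 1)"

lemma two_to_minus_1: "two_to k - 1 + 1 = two_to k"
proof -
  have "1 \<le> two_to k" using two_to_pos[of k] by (metis number_less_add_1 add_0 linorder_not_less)
  then show ?thesis by (rule le_add_diff_inverse2)
qed

lemma val_inv_pow2 [simp]: "val (inv_pow2 k) = E k"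
proof -
  have "rat_of (two_to k - 1) + 1 = rat_of (two_to k)"
    using two_to_minus_1[of k] by (metis rat_of_simps(2,3))
  then show ?thesis by (simp add: inv_pow2_def val_def E_def)
qed

lemma sem_inv_pow2 [simp]: "sem_inv_pow2 k P \<longleftrightarrow> P (inv_pow2 k)"
proof -
  have "c + 1 = two_to k \<longleftrightarrow> c = two_to k - 1" for c
    using two_to_minus_1[of k] by (metis add_right_cancel)
  then show ?thesis by (simp add: sem_inv_pow2_def sem_pow2 inv_pow2_def)
qed

section \<open>Reals as sequences of rationals\<close>

text \<open>
  A sequence of triples is replaced by the sequence of its values in the ordered field; \<open>fast\<close> is the modulus
  of convergence that makes it a real.
\<close>

definition represents :: "sequence \<Rightarrow> (number \<Rightarrow> rational) \<Rightarrow> bool" where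
  "represents R x \<longleftrightarrow> (\<forall>k. \<exists>q. R k q) \<and> (\<forall>k q. R k q \<longrightarrow> val q = x k)"

definition fast :: "(number \<Rightarrow> rational) \<Rightarrow> bool" where
  "fast x \<longleftrightarrow> (\<forall>m n. m \<le> n \<longrightarrow> \<bar>x m - x n\<bar> \<le> E m)"

lemma represents_real:
  assumes "sem_is_real R"
  obtains x where "represents R x" "fast x"
proof -
  have 1: "\<exists>q. R k q \<and> (\<forall>q'. R k q' \<longrightarrow> q' = q)" for k
    using assms unfolding sem_is_real_def by blast
  have 2: "val q \<le> val q' + E m \<and> val q' \<le> val q + E m" if "m \<le> n" "R m q" "R n q'" for m n q q'
    using assms that unfolding sem_is_real_def sem_inv_pow2 val_inv_pow2 by blast
  have "\<exists>f. \<forall>k. R k (f k) \<and> (\<forall>q'. R k q' \<longrightarrow> q' = f k)" by (rule choice) (use 1 in blast)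
  then obtain f where f: "\<And>k. R k (f k)" "\<And>k q. R k q \<Longrightarrow> q = f k" by blast
  have "\<bar>val (f m) - val (f n)\<bar> \<le> E m" if "m \<le> n" for m n
    using 2[OF that f(1) f(1)] by linarith
  then have "fast (\<lambda>k. val (f k))" unfolding fast_def by blast
  moreover have "represents R (\<lambda>k. val (f k))" unfolding represents_def using f by blast
  ultimately show ?thesis by (intro that)
qed

lemma represents_all:
  assumes "represents R x" "represents R' y"
  shows "(\<forall>q q'. R k q \<longrightarrow> R' k q' \<longrightarrow> P (val q) (val q')) \<longleftrightarrow> P (x k) (y k)"
proof -
  obtain q q' where "R k q" "R' k q'" using assms unfolding represents_def by blast
  moreover have "val q = x k" if "R k q" for q using assms(1) that unfolding represents_def by blast
  moreover have "val q = y k" if "R' k q" for q using assms(2) that unfolding represents_def by blast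
  ultimately show ?thesis by (metis (no_types))
qed

lemma real_le_iff:
  "represents R x \<Longrightarrow> represents R' y \<Longrightarrow> sem_real_le R R' \<longleftrightarrow> (\<forall>k. x k \<le> y k + (E k + E k))"
  unfolding sem_real_le_def sem_inv_pow2 val_inv_pow2
  using represents_all[of R x R' y _ "\<lambda>a b. a \<le> b + (E k + E k)" for k] by simp

lemma real_less_iff:
  "represents R x \<Longrightarrow> represents R' y \<Longrightarrow> sem_real_less R R' \<longleftrightarrow> (\<exists>k. x k + (E k + E k) < y k)"
  by (simp add: sem_real_less_def real_le_iff not_le)

lemma real_eq_iff:
  "represents R x \<Longrightarrow> represents R' y \<Longrightarrow>
    sem_real_eq R R' \<longleftrightarrow> (\<forall>k. \<bar>x k - y k\<bar> \<le> E k + E k)"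
proof -
  assume "represents R x" "represents R' y"
  then have "sem_real_eq R R' \<longleftrightarrow> (\<forall>k. x k \<le> y k + (E k + E k) \<and> y k \<le> x k + (E k + E k))"
    unfolding sem_real_eq_def sem_inv_pow2 val_inv_pow2
    using represents_all[of R x R' y _ "\<lambda>a b. a \<le> b + (E k + E k) \<and> b \<le> a + (E k + E k)" for k]
    by simp
  moreover have "x k \<le> y k + (E k + E k) \<and> y k \<le> x k + (E k + E k) \<longleftrightarrow> \<bar>x k - y k\<bar> \<le> E k + E k"
    for k by linarith
  ultimately show ?thesis by simp
qed

lemma represents_rconst: "represents (sem_rconst p) (\<lambda>_. val p)"
  by (simp add: represents_def sem_rconst_def)

lemma represents_rsub:
  assumes x: "represents R x" and y: "represents R' y"
  shows "represents (sem_rsub R R') (\<lambda>k. x (k + 1) - y (k + 1))"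
  unfolding represents_def
proof (intro conjI allI impI)
  fix k
  obtain p p' where "R (k + 1) p" "R' (k + 1) p'" using x y unfolding represents_def by blast
  then show "\<exists>q. sem_rsub R R' k q" unfolding sem_rsub_def by blast
next
  fix k q assume "sem_rsub R R' k q"
  then obtain p p' where "R (k + 1) p" "R' (k + 1) p'" "q = tadd p (tneg p')"
    unfolding sem_rsub_def by blast
  then show "val q = x (k + 1) - y (k + 1)" using x y unfolding represents_def by simp
qed

lemma represents_rabs:
  assumes x: "represents R x"
  shows "represents (sem_rabs R) (\<lambda>k. \<bar>x k\<bar>)"
  unfolding represents_def
proof (intro conjI allI impI)
  fix k
  obtain p where "R k p" using x unfolding represents_def by blast
  then show "\<exists>q. sem_rabs R k q" unfolding sem_rabs_def by (cases "0 \<le> val p") (auto simp: not_le)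
next
  fix k q assume "sem_rabs R k q"
  then obtain p where "R k p" "0 \<le> val p \<and> q = p \<or> val p < 0 \<and> q = tneg p"
    unfolding sem_rabs_def by blast
  then show "val q = \<bar>x k\<bar>" using x unfolding represents_def by auto
qed

lemma fast_near: "fast x \<Longrightarrow> m \<le> k \<Longrightarrow> m \<le> n \<Longrightarrow> \<bar>x k - x n\<bar> \<le> E m"
proof -
  assume x: "fast x" and le: "m \<le> k" "m \<le> n"
  have "\<bar>x k - x n\<bar> \<le> E (min k n)"
  proof (cases "k \<le> n")
    case True
    then show ?thesis using x by (simp add: fast_def min_def)
  next
    case False
    then have "\<bar>x n - x k\<bar> \<le> E n" using x by (simp add: fast_def)
    then show ?thesis using False by (simp add: min_def abs_minus_commute)
  qed
  also have "\<dots> \<le> E m" using le by (intro E_antimono) simp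
  finally show ?thesis .
qed

lemma fast_le: "fast x \<Longrightarrow> \<bar>x k - x n\<bar> \<le> E k + E n"
proof -
  assume "fast x"
  then have "\<bar>x k - x n\<bar> \<le> E (min k n)" by (rule fast_near) auto
  also have "\<dots> \<le> E k + E n"
    using E_pos[of k] E_pos[of n] by (cases "k \<le> n") (simp_all add: min_def)
  finally show ?thesis .
qed

lemma in_01_iff:
  "represents R x \<Longrightarrow> sem_in_01 R \<longleftrightarrow> (\<forall>k. 0 \<le> x k + (E k + E k) \<and> x k \<le> 1 + (E k + E k))"
  unfolding sem_in_01_def
  by (simp add: real_le_iff[OF represents_rconst] real_le_iff[OF _ represents_rconst] all_conj_distrib)

end

section \<open>The distance to a rational number as a coded function\<close>

text \<open>
  On the closure of the interval \<open>u\<close> within \<open>[0,1]\<close>, whose end points are given by \<open>max\<close> and \<open>min\<close>, the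
  distance to \<open>r\<close> takes values in the open interval \<open>w\<close>. Because the distance to a rational is piecewise linear, this
  is a finite combination of comparisons of rationals, hence decidable. The distance to a real would only
  give a \<open>\<Sigma>\<^sub>1\<close> condition, which is the reason for approximating the sequence by rationals first.
\<close>

definition cover :: "triple \<Rightarrow> interval \<Rightarrow> interval \<Rightarrow> bool" where
  "cover r u w \<longleftrightarrow> sem_basic_01 u \<and> val (fst w) < val (snd w) \<and>
    val r - max (val (fst u)) 0 < val (snd w) \<and> min (val (snd u)) 1 - val r < val (snd w) \<and>
    (val (fst w) < 0 \<or> val (fst w) < max (val (fst u)) 0 - val r \<or>
     val (fst w) < val r - min (val (snd u)) 1)"

lemma cover_image:
  assumes "cover r u w" "val (fst u) \<le> y" "y \<le> val (snd u)" "0 \<le> y" "y \<le> 1"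
  shows "val (fst w) < \<bar>y - val r\<bar> \<and> \<bar>y - val r\<bar> < val (snd w)"
proof -
  have 1: "max (val (fst u)) 0 \<le> y" "y \<le> min (val (snd u)) 1" using assms by auto
  then show ?thesis
    using assms(1) unfolding cover_def by (cases "0 \<le> y - val r") auto
qed

lemma cover_partial_continuous: "sem_partial_continuous (cover r)"
  unfolding sem_partial_continuous_def
proof (intro conjI allI impI)
  fix u w assume c: "cover r u w"
  then show "sem_basic_01 u" "val (fst w) < val (snd w)" by (simp_all add: cover_def)
next
  fix u w w' assume c: "cover r u w" "cover r u w'"
  let ?y = "max (val (fst u)) 0"
  have "val (fst u) \<le> ?y" "?y \<le> val (snd u)" "0 \<le> ?y" "?y \<le> 1"
    using c(1) by (auto simp: cover_def sem_basic_01_def)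
  then show "sem_meets_R w w'"
    using cover_image[OF c(1)] cover_image[OF c(2)] unfolding sem_meets_R_def by (meson less_trans)
next
  fix u w u' assume c: "cover r u w" and b: "sem_basic_01 u'" and s: "sem_subset_01 u' u"
  have "max (val (fst u)) 0 \<le> max (val (fst u')) 0" "min (val (snd u')) 1 \<le> min (val (snd u)) 1"
    using s unfolding sem_subset_01_def by auto
  then show "cover r u' w" using c b unfolding cover_def by linarith
next
  fix u w w' assume "cover r u w" "val (fst w') < val (snd w')" "sem_subset_R w w'"
  then show "cover r u w'" unfolding cover_def sem_subset_R_def by linarith
qed

context powers
begin

lemma real_less_const:
  "represents R x \<Longrightarrow> sem_real_less (sem_rconst p) R \<longleftrightarrow> (\<exists>k. val p + (E k + E k) < x k)"
  "represents R x \<Longrightarrow> sem_real_less R (sem_rconst p) \<longleftrightarrow> (\<exists>k. x k + (E k + E k) < val p)"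
  by (simp_all add: real_less_iff[OF represents_rconst] real_less_iff[OF _ represents_rconst])

text \<open>
  The intervals come from a single approximation \<open>x k\<close>. An interval of radius \<open>4 * E k\<close> around it contains the
  real with the margin that the order of reals asks for, and over this interval the distance to \<open>r\<close> varies by
  at most the radius, hence by less than \<open>5 * E k\<close>.
\<close>

lemma cover_in_domain:
  assumes x: "represents R x" "fast x" and R: "sem_in_01 R"
  shows "sem_in_domain (cover r) R"
  unfolding sem_in_domain_def
proof (intro allI impI)
  fix \<epsilon> :: triple assume "0 < val \<epsilon>"
  then obtain k where k: "E k < val \<epsilon> / 16" using E_small[of "val \<epsilon> / 16"] by auto
  obtain p where p: "val p = x k - 4 * E k" by (rule val_surj)
  obtain q where q: "val q = x k + 4 * E k" by (rule val_surj)
  obtain s where s: "val s = \<bar>x k - val r\<bar> - 5 * E k" by (rule val_surj)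
  obtain t where t: "val t = \<bar>x k - val r\<bar> + 5 * E k" by (rule val_surj)
  have x01: "0 \<le> x k + (E k + E k)" "x k \<le> 1 + (E k + E k)"
    using R in_01_iff[OF x(1)] by auto
  note pos = E_pos[of k]
  have "sem_basic_01 (p, q)"
    unfolding sem_basic_01_def fst_conv snd_conv p q using x01 pos by linarith
  moreover have "\<bar>a - b\<bar> - 5 * e < \<bar>a - b\<bar> + 5 * e \<and> b - max (a - 4 * e) 0 < \<bar>a - b\<bar> + 5 * e \<and>
      min (a + 4 * e) 1 - b < \<bar>a - b\<bar> + 5 * e \<and>
      (\<bar>a - b\<bar> - 5 * e < 0 \<or> \<bar>a - b\<bar> - 5 * e < max (a - 4 * e) 0 - b \<or>
       \<bar>a - b\<bar> - 5 * e < b - min (a + 4 * e) 1)" if "0 < e" for a b e :: rational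
    using that by (auto simp: max_def min_def abs_if)
  ultimately have "cover r (p, q) (s, t)"
    unfolding cover_def fst_conv snd_conv p q s t using pos by blast
  moreover have "val p + (E k + E k) < x k" "x k + (E k + E k) < val q"
    unfolding p q using pos by linarith+
  then have "sem_in_U R (p, q)"
    unfolding sem_in_U_def fst_conv snd_conv real_less_const[OF x(1)] using R by blast
  moreover have "val t - val s \<le> val \<epsilon>" unfolding s t using k pos by linarith
  ultimately show "\<exists>w. sem_witness (cover r) R (val \<epsilon>) w"
    unfolding sem_witness_def by (metis fst_conv snd_conv)
qed

text \<open>
  The value at stage \<open>k\<close> is the midpoint of an interval of length at most \<open>E k\<close> that contains the distance of \<open>r\<close> to all
  points of some \<open>u\<close> containing the real. The approximations \<open>x n\<close> lie in \<open>u\<close> eventually, up to a deviation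
  from \<open>[0,1]\<close> of at most \<open>2 * E n\<close>, and \<open>x j\<close> is compared with a late one.
\<close>

lemma fun_value_cover:
  assumes x: "represents R x" "fast x" and v: "sem_fun_value (cover r) R k q"
  shows "\<bar>\<bar>x j - val r\<bar> - val q\<bar> \<le> E k + 2 * E j"
proof -
  obtain w u where c: "cover r u w" and U: "sem_in_U R u" and l: "val (snd w) - val (fst w) \<le> E k"
    and q: "val q = (val (fst w) + val (snd w)) / 2"
    using v unfolding sem_fun_value_def sem_inv_pow2 sem_least_witness_def sem_witness_def val_inv_pow2
    by auto
  obtain i where i: "val (fst u) + (E i + E i) < x i"
    using U real_less_const(1)[OF x(1)] unfolding sem_in_U_def by blast
  obtain i' where i': "x i' + (E i' + E i') < val (snd u)"
    using U real_less_const(2)[OF x(1)] unfolding sem_in_U_def by blast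
  define n where "n = max (j + 1) (max i i')"
  have n: "j + 1 \<le> n" "i \<le> n" "i' \<le> n" by (simp_all add: n_def le_max_iff_disj)
  have "\<bar>x i - x n\<bar> \<le> E i" "\<bar>x i' - x n\<bar> \<le> E i'" using x(2) n by (auto simp: fast_def)
  then have pq: "val (fst u) < x n" "x n < val (snd u)"
    using i i' E_pos[of i] E_pos[of i'] by linarith+
  have x01: "0 \<le> x n + (E n + E n)" "x n \<le> 1 + (E n + E n)"
    using U in_01_iff[OF x(1)] unfolding sem_in_U_def by auto
  define y where "y = max 0 (min 1 (x n))"
  have b: "val (fst u) < 1" "0 < val (snd u)" using c unfolding cover_def sem_basic_01_def by auto
  have y: "\<bar>y - x n\<bar> \<le> 2 * E n"
    unfolding y_def using x01 by (auto simp: max_def min_def abs_if)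
  have "val (fst u) \<le> y" "y \<le> val (snd u)" "0 \<le> y" "y \<le> 1"
    unfolding y_def using pq b by (auto simp: max_def min_def)
  from cover_image[OF c this]
  have "\<bar>\<bar>y - val r\<bar> - val q\<bar> \<le> E k / 2" unfolding q using l by (simp add: abs_if field_simps)
  moreover have "E n \<le> E j / 2" using E_antimono[OF n(1)] by (simp add: E_Suc)
  moreover have "\<bar>x j - x n\<bar> \<le> E j"
    using x(2) n(1) unfolding fast_def by (meson order_trans add_increasing2 number_ge_0 order_refl zero_le_one)
  ultimately show ?thesis using y E_pos[of k] E_pos[of j] by linarith
qed

end

section \<open>Definability of the gauge\<close>

definition polytriple :: "((nat \<Rightarrow> number) \<Rightarrow> triple) \<Rightarrow> bool" where
  "polytriple f \<longleftrightarrow> polynomial (\<lambda>v. fst (f v)) \<and> polynomial (\<lambda>v. fst (snd (f v))) \<and>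
    polynomial (\<lambda>v. snd (snd (f v)))"

lemma polytriple_Pair:
  "polynomial f \<Longrightarrow> polynomial g \<Longrightarrow> polynomial h \<Longrightarrow> polytriple (\<lambda>v. (f v, g v, h v))"
  by (simp add: polytriple_def)

lemma polytriple_const: "polytriple (\<lambda>v. q)"
  by (simp add: polytriple_def polynomial_const)

lemma polytriple_tadd: "polytriple f \<Longrightarrow> polytriple g \<Longrightarrow> polytriple (\<lambda>v. tadd (f v) (g v))"
  unfolding polytriple_def tadd_def fst_conv snd_conv
  by (elim conjE) (intro conjI polynomial_intros)

lemma polytriple_tneg: "polytriple f \<Longrightarrow> polytriple (\<lambda>v. tneg (f v))"
  by (simp add: polytriple_def tneg_def)

lemma polynomial_tcode: "polytriple f \<Longrightarrow> polynomial (\<lambda>v. tcode (f v))"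
  unfolding polytriple_def tcode_def by (intro polynomial_tpair) auto

lemma polynomial_intcode:
  "polytriple f \<Longrightarrow> polytriple g \<Longrightarrow> polynomial (\<lambda>v. intcode (f v, g v))"
  unfolding intcode_def fst_conv snd_conv by (intro polynomial_tpair polynomial_tcode)

lemma Delta0_val_le:
  assumes "polytriple f" "polytriple g"
  shows "Delta0 (\<lambda>v. val (f v) \<le> val (g v))"
proof -
  have "val p \<le> val q \<longleftrightarrow> fst p * (snd (snd q) + 1) + fst (snd q) * (snd (snd p) + 1)
      \<le> fst q * (snd (snd p) + 1) + fst (snd p) * (snd (snd q) + 1)" for p q
    using val_le_iff[of "fst p" "fst (snd p)" "snd (snd p)" "fst q" "fst (snd q)" "snd (snd q)"] by simp
  then show ?thesis
    using assms unfolding polytriple_def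
    by (simp only:) (intro Delta0_le polynomial_intros; elim conjE; assumption)
qed

lemma Delta0_val_less:
  "polytriple f \<Longrightarrow> polytriple g \<Longrightarrow> Delta0 (\<lambda>v. val (f v) < val (g v))"
  unfolding not_le[symmetric] by (intro Delta0_not Delta0_val_le)

lemmas definable = Delta0_basic Delta0_val_le Delta0_val_less polynomial_intros polynomial_tpair
  polynomial_tcode polynomial_intcode polytriple_Pair polytriple_const polytriple_tadd polytriple_tneg

lemma Delta0_comprehension: "Delta0 (\<lambda>v. P (v 0)) \<Longrightarrow> {x. P x} \<in> Sets"
  by (intro Delta1_comprehension Sigma1_Delta0 Delta0_not)

lemma cover_triples:
  "cover r (p, q) (s, t) \<longleftrightarrow>
    (val p < val q \<and> val p < val (1, 0, 0) \<and> val (0, 0, 0) < val q) \<and> val s < val t \<and>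
    (val (tadd r (tneg p)) < val t \<or> val r < val t) \<and>
    (val (tadd q (tneg r)) < val t \<or> val (tadd (1, 0, 0) (tneg r)) < val t) \<and>
    (val s < val (0, 0, 0) \<or>
     (val s < val (tadd p (tneg r)) \<or> val s < val (tneg r)) \<or>
     (val s < val (tadd r (tneg q)) \<or> val s < val (tadd r (tneg (1, 0, 0)))))"
  unfolding cover_def sem_basic_01_def fst_conv snd_conv val_tadd val_tneg val_const
  by (simp add: max_def min_def) linarith

lemma Delta0_cover:
  "polytriple r \<Longrightarrow> polytriple p \<Longrightarrow> polytriple q \<Longrightarrow> polytriple s \<Longrightarrow> polytriple t \<Longrightarrow>
    Delta0 (\<lambda>v. cover (r v) (p v, q v) (s v, t v))"
  unfolding cover_triples by (intro definable)

definition triples :: "number set" where "triples = {x. \<exists>q. x = tcode q}"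

lemma triples_Sets: "triples \<in> Sets"
proof -
  have "(\<exists>q. x = tcode q) \<longleftrightarrow> (\<exists>a\<le>x. \<exists>b\<le>x. \<exists>c\<le>x. x = tcode (a, b, c))" for x
  proof
    assume "\<exists>q. x = tcode q"
    then obtain a b c where x: "x = tcode (a, b, c)" by (metis prod.collapse)
    then have "a \<le> x" "b \<le> x" "c \<le> x"
      unfolding tcode_def fst_conv snd_conv by (meson le_tpair1 le_tpair2 order_trans)+
    then show "\<exists>a\<le>x. \<exists>b\<le>x. \<exists>c\<le>x. x = tcode (a, b, c)" using x by blast
  qed blast
  then show ?thesis
    unfolding triples_def
    by (simp only:) (intro Delta0_comprehension Delta0_bex_le definable)
qed

definition gauge_codes :: "number set" where
  "gauge_codes = {n. \<exists>m u w. n = tpair m (tpair (intcode u) (intcode w))}"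

lemma gauge_codes_Sets: "gauge_codes \<in> Sets"
proof -
  have "(\<exists>m u w. n = tpair m (tpair (intcode u) (intcode w))) \<longleftrightarrow>
    (\<exists>m\<le>n. \<exists>p\<le>n. \<exists>q\<le>n. \<exists>s\<le>n. \<exists>t\<le>n. p \<in> triples \<and> q \<in> triples \<and> s \<in> triples \<and> t \<in> triples \<and>
      n = tpair m (tpair (tpair p q) (tpair s t)))" (is "?L \<longleftrightarrow> ?R") for n
  proof
    assume ?L
    then obtain m u w where n: "n = tpair m (tpair (intcode u) (intcode w))" by blast
    have n: "n = tpair m (tpair (tpair (tcode (fst u)) (tcode (snd u))) (tpair (tcode (fst w)) (tcode (snd w))))"
      using n by (simp add: intcode_def)
    have "m \<le> n" "tcode (fst u) \<le> n" "tcode (snd u) \<le> n" "tcode (fst w) \<le> n" "tcode (snd w) \<le> n"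
      unfolding n by (meson le_tpair1 le_tpair2 order_trans)+
    moreover have "tcode q \<in> triples" for q by (auto simp: triples_def)
    ultimately show ?R using n by blast
  next
    assume ?R
    then obtain m p q s t where "n = tpair m (tpair (tpair (tcode p) (tcode q)) (tpair (tcode s) (tcode t)))"
      unfolding triples_def by blast
    then have "n = tpair m (tpair (intcode (p, q)) (intcode (s, t)))" by (simp add: intcode_def)
    then show ?L by blast
  qed
  then show ?thesis
    unfolding gauge_codes_def
    by (simp only:) (intro Delta0_comprehension Delta0_bex_le definable triples_Sets)
qed

text \<open>
  The function \<open>\<rho>\<close> is given by a single-valued part of \<open>Z\<close>. Quantifying its value existentially makes both the
  set and its complement \<open>\<Sigma>\<^sub>1\<close>, apart from the numbers that are not codes, which are decidable.
\<close>

lemma gauge_set_Sets: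
  assumes Z: "Z \<in> Sets" and \<rho>: "\<And>m q. tpair (tpair m m) (tcode q) \<in> Z \<longleftrightarrow> q = \<rho> m"
  shows "{n. \<exists>m u w. n = tpair m (tpair (intcode u) (intcode w)) \<and> cover (\<rho> m) u w} \<in> Sets"
proof (rule Delta1_comprehension)
  have pos: "(\<exists>m u w. n = tpair m (tpair (intcode u) (intcode w)) \<and> cover (\<rho> m) u w) \<longleftrightarrow>
    (\<exists>m u w r. n = tpair m (tpair (intcode u) (intcode w)) \<and> tpair (tpair m m) (tcode r) \<in> Z \<and>
      cover r u w)" for n
    unfolding \<rho> by blast
  show "Sigma1 (\<lambda>v. \<exists>m u w. v 0 = tpair m (tpair (intcode u) (intcode w)) \<and> cover (\<rho> m) u w)"
    unfolding pos unfolding ex_interval ex_triple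
    by (intro Sigma1_ex Sigma1_Delta0 definable Delta0_cover Z)
  have neg: "\<not> (\<exists>m u w. n = tpair m (tpair (intcode u) (intcode w)) \<and> cover (\<rho> m) u w) \<longleftrightarrow>
    n \<notin> gauge_codes \<or>
    (\<exists>m u w r. n = tpair m (tpair (intcode u) (intcode w)) \<and> tpair (tpair m m) (tcode r) \<in> Z \<and>
      \<not> cover r u w)" for n
    unfolding \<rho> gauge_codes_def by (auto simp: split_paired_Ex)
  show "Sigma1 (\<lambda>v. \<not> (\<exists>m u w. v 0 = tpair m (tpair (intcode u) (intcode w)) \<and> cover (\<rho> m) u w))"
    unfolding neg unfolding ex_interval ex_triple
    by (intro Sigma1_or Sigma1_ex Sigma1_Delta0 definable Delta0_cover Z gauge_codes_Sets)
qed

text \<open>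
  Limits are ruled out for reals that exist as sets, so the points and tags of a partition have to be
  extracted from the sequence as sets.
\<close>

definition slice_set :: "number set \<Rightarrow> number \<Rightarrow> number set" where
  "slice_set A i = {n. \<exists>k q. n = tpair k (tcode q) \<and> tpair (tpair i k) (tcode q) \<in> A}"

lemma slice_set_seq: "sem_set_seq (slice_set A i) = sem_slice_seq A i"
  by (auto simp: sem_set_seq_def sem_slice_seq_def slice_set_def fun_eq_iff)

lemma slice_set_Sets:
  assumes "A \<in> Sets"
  shows "slice_set A i \<in> Sets"
proof -
  have "(\<exists>k q. n = tpair k (tcode q) \<and> tpair (tpair i k) (tcode q) \<in> A) \<longleftrightarrow>
    (\<exists>k\<le>n. \<exists>y\<le>n. n = tpair k y \<and> y \<in> triples \<and> tpair (tpair i k) y \<in> A)" for n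
    unfolding triples_def using le_tpair1 le_tpair2 by blast
  then show ?thesis
    unfolding slice_set_def
    by (simp only:) (intro Delta0_comprehension Delta0_bex_le definable triples_Sets assms)
qed

lemma slice_set_real: "sem_is_real (sem_slice_seq A i) \<Longrightarrow> sem_real_set (slice_set A i)"
  unfolding sem_real_set_def slice_set_seq by (auto simp: slice_set_def)

section \<open>The gauge of a divergent sequence\<close>

context powers
begin

lemma less_rconstD:
  "sem_real_less F (sem_rconst q) \<Longrightarrow> \<exists>k p. F k p \<and> val p + (E k + E k) < val q"
  unfolding sem_real_less_def sem_real_le_def sem_inv_pow2 val_inv_pow2 sem_rconst_def not_le[symmetric]
  by blast

lemma rconst_lessD:
  "sem_real_less (sem_rconst q) F \<Longrightarrow> \<exists>k p. F k p \<and> val q + (E k + E k) < val p"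
  unfolding sem_real_less_def sem_real_le_def sem_inv_pow2 val_inv_pow2 sem_rconst_def not_le[symmetric]
  by blast

end

locale divergent = powers +
  fixes Z :: "number set" and z :: "number \<Rightarrow> number \<Rightarrow> rational"
  assumes Z_Sets: "Z \<in> Sets"
    and Z_real: "\<And>i. sem_is_real (sem_slice_seq Z i)"
    and Z_rep: "\<And>i. represents (sem_slice_seq Z i) (z i)" "\<And>i. fast (z i)"
    and Z_01: "\<And>i. sem_in_01 (sem_slice_seq Z i)"
    and Z_cauchy: "sem_cauchy_seq Z"
    and no_limit: "\<And>Y. Y \<in> Sets \<Longrightarrow> sem_real_set Y \<Longrightarrow> \<not> sem_is_limit Z (sem_set_seq Y)"
begin

definition r :: "number \<Rightarrow> rational" where "r n = z n n"

text \<open>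
  \<open>z m\<close> and \<open>z n\<close> are compared at a place beyond both diagonal places, which the rate of convergence reaches
  from \<open>z m m\<close> and \<open>z n n\<close> with errors \<open>E m\<close> and \<open>E n\<close>.
\<close>

lemma r_cauchy:
  assumes "0 < \<epsilon>"
  shows "\<exists>K. \<forall>m\<ge>K. \<forall>n\<ge>K. \<bar>r m - r n\<bar> \<le> \<epsilon>"
proof -
  obtain q where q: "val q = \<epsilon> / 4" by (rule val_surj)
  then have "0 < val q" using assms by simp
  then obtain K1 where "\<forall>m n. K1 \<le> m \<longrightarrow> K1 \<le> n \<longrightarrow>
      sem_real_le (sem_rabs (sem_rsub (sem_slice_seq Z m) (sem_slice_seq Z n))) (sem_rconst q)"
    using Z_cauchy unfolding sem_cauchy_seq_def by blast
  then have K1: "\<bar>z m (k + 1) - z n (k + 1)\<bar> \<le> \<epsilon> / 4 + (E k + E k)" if "K1 \<le> m" "K1 \<le> n" for m n k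
    using that real_le_iff[OF represents_rabs[OF represents_rsub[OF Z_rep(1) Z_rep(1)]] represents_rconst] q
    by simp
  obtain K2 where K2: "\<forall>n\<ge>K2. E n < \<epsilon> / 8" using E_bound[of "\<epsilon> / 8"] assms by auto
  have "\<bar>r m - r n\<bar> \<le> \<epsilon>" if "max K1 K2 \<le> m" "max K1 K2 \<le> n" for m n
  proof -
    define k where "k = max m n"
    have k: "m \<le> k + 1" "n \<le> k + 1" "K2 \<le> k"
      using that by (auto simp: k_def le_max_iff_disj intro: add_increasing2)
    have "\<bar>z m m - z m (k + 1)\<bar> \<le> E m" "\<bar>z n n - z n (k + 1)\<bar> \<le> E n"
      using Z_rep(2) k unfolding fast_def by blast+
    moreover have "\<bar>z m (k + 1) - z n (k + 1)\<bar> \<le> \<epsilon> / 4 + (E k + E k)" using that by (intro K1) auto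
    moreover have "E m < \<epsilon> / 8" "E n < \<epsilon> / 8" "E k < \<epsilon> / 8" using K2 that k by auto
    ultimately show ?thesis unfolding r_def by linarith
  qed
  then show ?thesis by blast
qed

lemma r_01: "- (2 * E n) \<le> r n" "r n \<le> 1 + 2 * E n"
proof -
  have "0 \<le> z n n + (E n + E n) \<and> z n n \<le> 1 + (E n + E n)"
    using Z_01[of n] in_01_iff[OF Z_rep(1)[of n]] by blast
  then show "- (2 * E n) \<le> r n" "r n \<le> 1 + 2 * E n" unfolding r_def by linarith+
qed

definition rcode :: "number \<Rightarrow> triple" where "rcode n = (THE q. sem_slice_seq Z n n q)"

lemma rcode: "sem_slice_seq Z n n q \<longleftrightarrow> q = rcode n"
proof -
  obtain p where p: "sem_slice_seq Z n n p" "\<And>q. sem_slice_seq Z n n q \<Longrightarrow> q = p"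
    using Z_real[of n] unfolding sem_is_real_def by blast
  then have "rcode n = p" unfolding rcode_def by blast
  then show ?thesis using p by blast
qed

lemma val_rcode [simp]: "val (rcode n) = r n"
  using rcode[of n "rcode n"] Z_rep(1)[of n] unfolding represents_def r_def by blast

definition gauge :: "number set" where
  "gauge = {n. \<exists>m u w. n = tpair m (tpair (intcode u) (intcode w)) \<and> cover (rcode m) u w}"

lemma gauge_Sets: "gauge \<in> Sets"
  unfolding gauge_def
  by (rule gauge_set_Sets[OF Z_Sets]) (use rcode in \<open>simp add: sem_slice_seq_def\<close>)

lemma slice_gauge: "sem_slice_fun gauge m = cover (rcode m)"
  by (auto simp: sem_slice_fun_def gauge_def fun_eq_iff)

text \<open>The virtual limit of \<open>r\<close> is compared with a real \<open>x\<close> through rational gaps that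
  persist from some index on.\<close>

definition below :: "(number \<Rightarrow> rational) \<Rightarrow> bool" where
  "below x \<longleftrightarrow> (\<exists>\<epsilon>>0. \<forall>\<^sub>F n in at_top. \<epsilon> \<le> r n - x n)"
definition above :: "(number \<Rightarrow> rational) \<Rightarrow> bool" where
  "above x \<longleftrightarrow> (\<exists>\<epsilon>>0. \<forall>\<^sub>F n in at_top. \<epsilon> \<le> x n - r n)"

lemma E_eventually: "0 < \<epsilon> \<Longrightarrow> \<forall>\<^sub>F n in at_top. E n < \<epsilon>"
  using E_bound[of \<epsilon>] by (simp add: eventually_at_top_linorder)

lemma ev_witness: "\<forall>\<^sub>F n :: number in at_top. P n \<Longrightarrow> \<exists>n. P n"
  using eventually_happens[of P at_top] by simp

lemma not_convergent:
  assumes Y: "Y \<in> Sets" "sem_real_set Y" and y: "represents (sem_set_seq Y) y" "fast y"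
  shows "\<exists>\<epsilon>>0. \<not> (\<forall>\<^sub>F n in at_top. \<bar>y n - r n\<bar> \<le> \<epsilon>)"
proof (rule ccontr)
  assume "\<not> ?thesis"
  then have conv: "\<And>\<epsilon>. 0 < \<epsilon> \<Longrightarrow> \<forall>\<^sub>F n in at_top. \<bar>y n - r n\<bar> \<le> \<epsilon>" by blast
  have "sem_is_limit Z (sem_set_seq Y)"
    unfolding sem_is_limit_def
  proof (intro allI impI)
    fix q assume q: "0 < val q"
    have "\<forall>\<^sub>F n in at_top. \<bar>y n - r n\<bar> \<le> val q / 2 \<and> E n < val q / 4"
      using q by (intro eventually_conj conv E_eventually) auto
    then obtain K where K: "\<forall>n\<ge>K. \<bar>y n - r n\<bar> \<le> val q / 2 \<and> E n < val q / 4"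
      unfolding eventually_at_top_linorder by blast
    have "\<bar>z n (k + 1) - y (k + 1)\<bar> \<le> val q + (E k + E k)" if "K \<le> n" for n k
    proof -
      have "\<bar>z n (k + 1) - z n n\<bar> \<le> E (k + 1) + E n" "\<bar>y (k + 1) - y n\<bar> \<le> E (k + 1) + E n"
        using Z_rep(2) y(2) by (blast intro: fast_le)+
      moreover have "\<bar>y n - r n\<bar> \<le> val q / 2" "E n < val q / 4" using K that by auto
      ultimately show ?thesis using E_pos[of k] unfolding E_Suc r_def by linarith
    qed
    then show "\<exists>k. \<forall>n. k \<le> n \<longrightarrow>
        sem_real_le (sem_rabs (sem_rsub (sem_slice_seq Z n) (sem_set_seq Y))) (sem_rconst q)"
      using real_le_iff[OF represents_rabs[OF represents_rsub[OF Z_rep(1) y(1)]] represents_rconst]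
      by blast
  qed
  then show False using no_limit Y by blast
qed

text \<open>
  If \<open>y\<close> is not a limit, it stays away from \<open>r\<close> by some \<open>\<epsilon>\<close> at arbitrarily late places. After both sequences
  have settled within a fraction of \<open>\<epsilon>\<close>, one such place fixes the side for good.
\<close>

lemma below_or_above:
  assumes "Y \<in> Sets" "sem_real_set Y" "represents (sem_set_seq Y) y" "fast y"
  shows "below y \<or> above y"
proof -
  obtain \<epsilon> where \<epsilon>: "0 < \<epsilon>" "\<not> (\<forall>\<^sub>F n in at_top. \<bar>y n - r n\<bar> \<le> \<epsilon>)"
    using not_convergent[OF assms] by blast
  obtain K1 where K1: "\<forall>m\<ge>K1. \<forall>n\<ge>K1. \<bar>r m - r n\<bar> \<le> \<epsilon> / 4" 
    using r_cauchy[of "\<epsilon> / 4"] \<epsilon> by auto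
  obtain K2 where K2: "E K2 < \<epsilon> / 8" using E_small[of "\<epsilon> / 8"] \<epsilon> by auto
  define K where "K = max K1 K2"
  obtain N where N: "K \<le> N" "\<epsilon> < \<bar>y N - r N\<bar>"
    using \<epsilon>(2) unfolding eventually_at_top_linorder by (meson not_le)
  have near: "\<bar>r N - r n\<bar> \<le> \<epsilon> / 4 \<and> \<bar>y N - y n\<bar> < \<epsilon> / 8" if "K \<le> n" for n
    using K1 K2 N(1) that fast_near[OF assms(4), of K2 N n] unfolding K_def by auto
  show ?thesis
  proof (cases "y N \<le> r N")
    case True
    have "\<epsilon> / 2 \<le> r n - y n" if "K \<le> n" for n using near[OF that] N True \<epsilon>(1) by linarith
    then have "below y"
      unfolding below_def eventually_at_top_linorder using \<epsilon>(1) by (intro exI[of _ "\<epsilon> / 2"]) auto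
    then show ?thesis ..
  next
    case False
    have "\<epsilon> / 2 \<le> y n - r n" if "K \<le> n" for n using near[OF that] N False \<epsilon>(1) by linarith
    then have "above y"
      unfolding above_def eventually_at_top_linorder using \<epsilon>(1) by (intro exI[of _ "\<epsilon> / 2"]) auto
    then show ?thesis ..
  qed
qed

lemma gauge_value:
  assumes "represents R x" "fast x" "sem_fun_value (sem_slice_fun gauge m) R k q"
  shows "\<bar>\<bar>x j - r m\<bar> - val q\<bar> \<le> E k + 2 * E j"
  using fun_value_cover[OF assms(1,2), of "rcode m" k q j] assms(3) by (simp add: slice_gauge)

lemma gauge_baire1: "sem_baire1 gauge"
  unfolding sem_baire1_def
proof (intro conjI allI impI ballI)
  fix n assume "n \<in> gauge"
  then show "\<exists>m u w. n = tpair m (tpair (intcode u) (intcode w))" unfolding gauge_def by blast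
next
  fix m
  show "sem_total_continuous (sem_slice_fun gauge m)"
    unfolding sem_total_continuous_def slice_gauge
  proof (intro conjI ballI impI cover_partial_continuous)
    fix X assume X: "sem_real_set X" "sem_in_01 (sem_set_seq X)"
    then obtain x where "represents (sem_set_seq X) x" "fast x"
      using represents_real unfolding sem_real_set_def by blast
    then show "sem_in_domain (cover (rcode m)) (sem_set_seq X)" using X(2) by (rule cover_in_domain)
  qed
next
  fix X q assume X: "sem_real_set X" and q: "0 < val q"
  obtain x where x: "represents (sem_set_seq X) x" "fast x"
    using X represents_real unfolding sem_real_set_def by blast
  obtain K where K: "\<forall>m\<ge>K. \<forall>n\<ge>K. \<bar>r m - r n\<bar> \<le> val q" using r_cauchy q by blast
  have "sem_real_le (sem_rabs (sem_rsub (sem_fun_value (sem_slice_fun gauge m) (sem_set_seq X))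
          (sem_fun_value (sem_slice_fun gauge n) (sem_set_seq X)))) (sem_rconst q)"
    if mn: "K \<le> m" "K \<le> n" for m n
    unfolding sem_real_le_def sem_inv_pow2 val_inv_pow2
  proof (intro allI impI)
    fix k p p'
    assume "sem_rabs (sem_rsub (sem_fun_value (sem_slice_fun gauge m) (sem_set_seq X))
          (sem_fun_value (sem_slice_fun gauge n) (sem_set_seq X))) k p" and p': "sem_rconst q k p'"
    then obtain a b where a: "sem_fun_value (sem_slice_fun gauge m) (sem_set_seq X) (k + 1) a"
      and b: "sem_fun_value (sem_slice_fun gauge n) (sem_set_seq X) (k + 1) b"
      and p: "val p = \<bar>val a - val b\<bar>"
      unfolding sem_rabs_def sem_rsub_def by auto
    have "\<bar>\<bar>x (k + 1 + 1) - r m\<bar> - val a\<bar> \<le> E (k + 1) + 2 * E (k + 1 + 1)"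
      "\<bar>\<bar>x (k + 1 + 1) - r n\<bar> - val b\<bar> \<le> E (k + 1) + 2 * E (k + 1 + 1)"
      using gauge_value[OF x] a b by blast+
    moreover have "\<bar>r m - r n\<bar> \<le> val q" using K mn by blast
    ultimately show "val p \<le> val p' + (E k + E k)"
      using p p' unfolding E_Suc sem_rconst_def by (simp add: abs_if split: if_splits)
  qed
  then show "\<exists>k. \<forall>m n. k \<le> m \<longrightarrow> k \<le> n \<longrightarrow>
      sem_real_le (sem_rabs (sem_rsub (sem_fun_value (sem_slice_fun gauge m) (sem_set_seq X))
          (sem_fun_value (sem_slice_fun gauge n) (sem_set_seq X)))) (sem_rconst q)"
    by blast
qed

text \<open>
  If the gauge were not positive at \<open>x\<close>, the distances of \<open>x\<close> to \<open>r n\<close> would become arbitrarily small, making \<open>x\<close> a limit.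
\<close>

lemma gauge_is_gauge: "sem_baire1_gauge gauge"
  unfolding sem_baire1_gauge_def
proof (intro conjI ballI impI notI gauge_baire1)
  fix X assume X: "X \<in> Sets" "sem_real_set X"
    and le: "sem_baire_le gauge (sem_set_seq X) (sem_rconst (0, 0, 0))"
  obtain x where x: "represents (sem_set_seq X) x" "fast x"
    using X represents_real unfolding sem_real_set_def by blast
  have "\<forall>\<^sub>F n in at_top. \<bar>x n - r n\<bar> \<le> \<epsilon>" if \<epsilon>: "0 < \<epsilon>" for \<epsilon>
  proof -
    obtain q where q: "val q = \<epsilon> / 2" by (rule val_surj)
    obtain k where "E k < \<epsilon> / 4" using E_small[of "\<epsilon> / 4"] \<epsilon> by auto
    then have "sem_real_less (sem_rconst (0, 0, 0)) (sem_rconst q)"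
      unfolding real_less_const(1)[OF represents_rconst] val_const q by (intro exI[of _ k]) auto
    then obtain K where K: "\<forall>m. K \<le> m \<longrightarrow>
        sem_real_less (sem_fun_value (sem_slice_fun gauge m) (sem_set_seq X)) (sem_rconst q)"
      using le unfolding sem_baire_le_def by blast
    have "\<bar>x m - r m\<bar> \<le> \<epsilon> / 2 + 2 * E m" if m: "K \<le> m" for m
    proof -
      obtain k p where "sem_fun_value (sem_slice_fun gauge m) (sem_set_seq X) k p"
        and p: "val p + (E k + E k) < \<epsilon> / 2"
        using less_rconstD[OF K[rule_format, OF m]] q by auto
      then show ?thesis using gauge_value[OF x, of m k p m] E_pos[of k] by linarith
    qed
    then have "\<forall>\<^sub>F m in at_top. \<bar>x m - r m\<bar> \<le> \<epsilon> / 2 + 2 * E m"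
      unfolding eventually_at_top_linorder by blast
    moreover have "\<forall>\<^sub>F m in at_top. E m < \<epsilon> / 4" using \<epsilon> by (intro E_eventually) auto
    ultimately show ?thesis by eventually_elim linarith
  qed
  then show False using not_convergent[OF X x] by blast
qed

text \<open>
  Fineness in terms of approximations. The rational \<open>q\<close> is a lower bound of the real \<open>A - B\<close> that is
  close enough to it, and values of the gauge above \<open>q\<close> are distances, up to errors that vanish with \<open>m\<close>.
\<close>

lemma fine_bound:
  assumes ge: "sem_baire_ge gauge T (sem_rsub A B)" and t: "represents T t" "fast t"
    and a: "represents A a" "fast a" and b: "represents B b" "fast b" and \<epsilon>: "0 < \<epsilon>"
  shows "\<forall>\<^sub>F m in at_top. a m - b m - \<epsilon> \<le> \<bar>t m - r m\<bar>"
proof -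
  obtain k where k: "E k < \<epsilon> / 8" using E_small[of "\<epsilon> / 8"] \<epsilon> by auto
  obtain q where q: "val q = a (k + 1) - b (k + 1) - 4 * E k" by (rule val_surj)
  have "sem_real_less (sem_rconst q) (sem_rsub A B)"
    unfolding real_less_const(1)[OF represents_rsub[OF a(1) b(1)]] q
    by (intro exI[of _ k]) (use E_pos[of k] in linarith)
  then obtain K where K: "\<forall>m. K \<le> m \<longrightarrow>
      sem_real_less (sem_rconst q) (sem_fun_value (sem_slice_fun gauge m) T)"
    using ge unfolding sem_baire_ge_def by blast
  have "a m - b m - \<epsilon> \<le> \<bar>t m - r m\<bar>" if m: "max K (k + 1) \<le> m" for m
  proof -
    have "K \<le> m" using m by simp
    then obtain j p where v: "sem_fun_value (sem_slice_fun gauge m) T j p"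
      and p: "val q + (E j + E j) < val p"
      using rconst_lessD[OF K[rule_format]] by blast
    have "\<bar>a (k + 1) - a m\<bar> \<le> E (k + 1)" "\<bar>b (k + 1) - b m\<bar> \<le> E (k + 1)"
      using a(2) b(2) m unfolding fast_def by auto
    moreover have "E m \<le> E (k + 1)" using m by (intro E_antimono) auto
    ultimately show ?thesis
      using gauge_value[OF t v, of m] p q k E_pos[of j] unfolding E_Suc by linarith
  qed
  then show ?thesis unfolding eventually_at_top_linorder by blast
qed

text \<open>
  If the limit lay between \<open>x\<close> and the tag \<open>t\<close>, then by fineness \<open>t - x\<close> would be at most the distance of
  \<open>t\<close> from the limit, so that \<open>x\<close> could not be strictly below the limit. So \<open>t\<close> is below the limit, and
  then \<open>x'\<close> cannot be strictly above it, since \<open>x' - t\<close> is at most that distance.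
\<close>

lemma below_step:
  assumes x: "below x" and t: "below t \<or> above t" and x': "below x' \<or> above x'"
    and left: "\<And>\<epsilon>. 0 < \<epsilon> \<Longrightarrow> \<forall>\<^sub>F m in at_top. t m - x m - \<epsilon> \<le> \<bar>t m - r m\<bar>"
    and right: "\<And>\<epsilon>. 0 < \<epsilon> \<Longrightarrow> \<forall>\<^sub>F m in at_top. x' m - t m - \<epsilon> \<le> \<bar>t m - r m\<bar>"
  shows "below x'"
proof -
  have "below t"
  proof (rule ccontr)
    assume "\<not> below t"
    then obtain \<delta> where \<delta>: "0 < \<delta>" "\<forall>\<^sub>F n in at_top. \<delta> \<le> t n - r n"
      using t unfolding above_def by blast
    obtain \<epsilon> where \<epsilon>: "0 < \<epsilon>" "\<forall>\<^sub>F n in at_top. \<epsilon> \<le> r n - x n" using x unfolding below_def by blast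
    have "\<forall>\<^sub>F n in at_top. t n - x n - \<epsilon> / 2 \<le> \<bar>t n - r n\<bar>" using \<epsilon>(1) by (intro left) auto
    with \<delta>(2) \<epsilon>(2) have "\<forall>\<^sub>F n :: number in at_top. False"
      by eventually_elim (use \<delta>(1) \<epsilon>(1) in linarith)
    then show False using ev_witness by blast
  qed
  show "below x'"
  proof (rule ccontr)
    assume "\<not> below x'"
    then obtain \<delta> where \<delta>: "0 < \<delta>" "\<forall>\<^sub>F n in at_top. \<delta> \<le> x' n - r n"
      using x' unfolding above_def by blast
    obtain \<epsilon> where \<epsilon>: "0 < \<epsilon>" "\<forall>\<^sub>F n in at_top. \<epsilon> \<le> r n - t n"
      using \<open>below t\<close> unfolding below_def by blast
    have "\<forall>\<^sub>F n in at_top. x' n - t n - \<delta> / 2 \<le> \<bar>t n - r n\<bar>" using \<delta>(1) by (intro right) auto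
    with \<delta>(2) \<epsilon>(2) have "\<forall>\<^sub>F n :: number in at_top. False"
      by eventually_elim (use \<delta>(1) \<epsilon>(1) in linarith)
    then show False using ev_witness by blast
  qed
qed

end

section \<open>Fine partitions locate the limit\<close>

locale fine_partition = divergent +
  fixes P :: "number set" and l :: number and x :: "number \<Rightarrow> number \<Rightarrow> rational"
  assumes P: "P \<in> Sets"
    and part: "sem_tagged_partition P l"
    and fine: "sem_fine gauge P l"
    and x: "\<And>i. i < l + l + 1 \<Longrightarrow> represents (sem_slice_seq P i) (x i)"
      "\<And>i. i < l + l + 1 \<Longrightarrow> fast (x i)"
begin

abbreviation pt :: "number \<Rightarrow> number \<Rightarrow> rational" where "pt j \<equiv> x (j + j)"
abbreviation tg :: "number \<Rightarrow> number \<Rightarrow> rational" where "tg j \<equiv> x (j + j + 1)"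

lemma side:
  assumes i: "i < l + l + 1"
  shows "below (x i) \<or> above (x i)"
proof -
  have "sem_is_real (sem_slice_seq P i)"
    using part i unfolding sem_tagged_partition_def sem_finite_real_sequence_def by blast
  then show ?thesis
    using P x[OF i] slice_set_Sets slice_set_real
    by - (rule below_or_above[of "slice_set P i"], simp_all add: slice_set_seq)
qed

lemma entry_indices:
  assumes "j < l"
  shows "j + j < l + l + 1" "j + j + 1 < l + l + 1" "(j + 1) + (j + 1) < l + l + 1"
proof -
  have "j + 1 \<le> l" using assms by (metis linorder_not_less number_less_add_1)
  then have *: "(j + 1) + (j + 1) \<le> l + l" by (intro add_mono)
  have "j + j + 1 \<le> (j + 1) + (j + 1)" "j + j \<le> (j + 1) + (j + 1)"
    by (simp_all add: algebra_simps add_increasing)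
  then show "j + j < l + l + 1" "j + j + 1 < l + l + 1" "(j + 1) + (j + 1) < l + l + 1"
    using * by (auto simp: number_less_add_1 intro: order_trans)
qed

lemma step:
  assumes j: "j < l" and b: "below (pt j)"
  shows "below (pt (j + 1))"
proof (rule below_step[OF b side[OF entry_indices(2)[OF j]] side[OF entry_indices(3)[OF j]]])
  note X = x[OF entry_indices(1)[OF j]] x[OF entry_indices(2)[OF j]] x[OF entry_indices(3)[OF j]]
  have f: "sem_baire_ge gauge (sem_slice_seq P (j + j + 1))
      (sem_rsub (sem_slice_seq P (j + j + 1)) (sem_slice_seq P (j + j)))"
    "sem_baire_ge gauge (sem_slice_seq P (j + j + 1))
      (sem_rsub (sem_slice_seq P ((j + 1) + (j + 1))) (sem_slice_seq P (j + j + 1)))"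
    using fine j unfolding sem_fine_def by blast+
  fix \<epsilon> :: rational assume "0 < \<epsilon>"
  then show "\<forall>\<^sub>F m in at_top. tg j m - pt j m - \<epsilon> \<le> \<bar>tg j m - r m\<bar>"
    "\<forall>\<^sub>F m in at_top. pt (j + 1) m - tg j m - \<epsilon> \<le> \<bar>tg j m - r m\<bar>"
    using fine_bound[OF f(1) X(3,4) X(3,4) X(1,2)] fine_bound[OF f(2) X(3,4) X(5,6) X(3,4)]
    by blast+
qed

lemma below_0: "below (pt 0)"
proof (rule ccontr)
  assume "\<not> below (pt 0)"
  then obtain \<epsilon> where \<epsilon>: "0 < \<epsilon>" "\<forall>\<^sub>F n in at_top. \<epsilon> \<le> pt 0 n - r n"
    using side[of "0 + 0"] unfolding above_def by auto
  have "sem_real_eq (sem_slice_seq P (0 + 0)) (sem_rconst (0, 0, 0))"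
    using part unfolding sem_tagged_partition_def by blast
  then have z: "\<bar>pt 0 n\<bar> \<le> E n + E n" for n
    using real_eq_iff[OF x(1) represents_rconst, of "0 + 0"] by simp
  have "\<forall>\<^sub>F n in at_top. E n < \<epsilon> / 8" using \<epsilon> by (intro E_eventually) auto
  with \<epsilon>(2) have "\<forall>\<^sub>F n :: number in at_top. False"
  proof eventually_elim
    case (elim n)
    then show ?case using z[of n] r_01(1)[of n] \<epsilon>(1) by linarith
  qed
  then show False using ev_witness by blast
qed

lemma not_below_1: "\<not> below (pt l)"
proof
  assume "below (pt l)"
  then obtain \<epsilon> where \<epsilon>: "0 < \<epsilon>" "\<forall>\<^sub>F n in at_top. \<epsilon> \<le> r n - pt l n"
    unfolding below_def by blast
  have "sem_real_eq (sem_slice_seq P (l + l)) (sem_rconst (1, 0, 0))"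
    using part unfolding sem_tagged_partition_def by blast
  then have z: "\<bar>pt l n - 1\<bar> \<le> E n + E n" for n
    using real_eq_iff[OF x(1) represents_rconst, of "l + l"] by simp
  have "\<forall>\<^sub>F n in at_top. E n < \<epsilon> / 8" using \<epsilon> by (intro E_eventually) auto
  with \<epsilon>(2) have "\<forall>\<^sub>F n :: number in at_top. False"
  proof eventually_elim
    case (elim n)
    then show ?case using z[of n] r_01(2)[of n] \<epsilon>(1) by linarith
  qed
  then show False using ev_witness by blast
qed

text \<open>
  Comparing approximations at the place \<open>b\<close> itself makes the lower bound on the gap decidable. The factor 4
  leaves room for the errors of both approximations: the bound improves with \<open>b\<close> and holds for later approximations
  with factor 2.
\<close>

definition gap :: "number \<Rightarrow> number \<Rightarrow> bool" where
  "gap j b \<longleftrightarrow> 4 * E b < pt (j + 1) b - pt j b"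

lemma gap_later:
  assumes "gap j b" "j < l" "b \<le> n"
  shows "2 * E b < pt (j + 1) n - pt j n"
proof -
  have "\<bar>pt (j + 1) b - pt (j + 1) n\<bar> \<le> E b" "\<bar>pt j b - pt j n\<bar> \<le> E b"
    using x(2) entry_indices[OF assms(2)] assms(3) unfolding fast_def by blast+
  then show ?thesis using assms(1) unfolding gap_def by linarith
qed

lemma gap_mono:
  assumes "gap j b" "j < l" "b + 1 \<le> b'"
  shows "gap j b'"
proof -
  have "b \<le> b'" using assms(3) by (meson add_increasing2 order_refl order_trans zero_le_one)
  then have "2 * E b < pt (j + 1) b' - pt j b'" by (rule gap_later[OF assms(1,2)])
  moreover have "E b' \<le> E b / 2" using E_antimono[OF assms(3)] by (simp add: E_Suc)
  ultimately show ?thesis unfolding gap_def by linarith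
qed

lemma gap_exists:
  assumes j: "j < l"
  shows "\<exists>b. gap j b"
proof -
  note X = x[OF entry_indices(1)[OF j]] x[OF entry_indices(3)[OF j]]
  have "sem_real_less (sem_slice_seq P (j + j)) (sem_slice_seq P ((j + 1) + (j + 1)))"
    using part j unfolding sem_tagged_partition_def by blast
  then obtain k where k: "pt j k + (E k + E k) < pt (j + 1) k"
    using real_less_iff[OF X(1) X(3)] by blast
  define \<delta> where "\<delta> = pt (j + 1) k - pt j k - (E k + E k)"
  have "0 < \<delta> / 4" using k by (simp add: \<delta>_def)
  then obtain K where K: "\<forall>n\<ge>K. E n < \<delta> / 4" using E_bound by blast
  define b where "b = max k K"
  have "\<bar>pt (j + 1) k - pt (j + 1) b\<bar> \<le> E k" "\<bar>pt j k - pt j b\<bar> \<le> E k"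
    using X(2,4) unfolding fast_def b_def by auto
  moreover have "4 * E b < \<delta>" using K[rule_format, of b] by (simp add: b_def)
  ultimately have "gap j b" unfolding gap_def by (simp add: \<delta>_def abs_le_iff)
  then show ?thesis ..
qed

lemma entry_code:
  assumes "i < l + l + 1"
  shows "tpair (tpair i b) (tcode p) \<in> P \<Longrightarrow> val p = x i b" "\<exists>p. tpair (tpair i b) (tcode p) \<in> P"
  using x(1)[OF assms] unfolding represents_def sem_slice_seq_def by blast+

text \<open>
  The approximations and the power of two are single-valued, so their values may be quantified existentially in the
  definition of the set as well as of its complement.
\<close>

lemma gap_Sets: "{n. \<exists>j b. n = tpair j b \<and> j < l \<and> gap j b} \<in> Sets"
proof -
  let ?data = "\<lambda>j b p q c. tpair (tpair (j + j) b) (tcode p) \<in> P \<and>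
      tpair (tpair ((j + 1) + (j + 1)) b) (tcode q) \<in> P \<and> tpair b (c + 1) \<in> graph"
  let ?small = "\<lambda>p q c. val (tadd p (1 + 1 + 1 + 1, 0, c)) < val q"
  have small: "?small p q c \<longleftrightarrow> gap j b" if "j < l" "?data j b p q c" for j b p q c
  proof -
    have "val p = pt j b" "val q = pt (j + 1) b"
      using that entry_code(1) entry_indices by blast+
    moreover have "val (1 + 1 + 1 + 1, 0, c) = 4 * E b"
    proof -
      have "c + 1 = two_to b" using that(2) by (simp only: graph_iff)
      then have "rat_of c + 1 = rat_of (two_to b)" by (metis rat_of_simps(2,3))
      moreover have "rat_of (1 + 1 + 1 + 1) = 4" by (simp only: rat_of_simps)
      ultimately show ?thesis
        unfolding val_def E_def fst_conv snd_conv
        by (simp only: rat_of_simps(1) diff_zero mult_1_right times_divide_eq_right)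
    qed
    ultimately show ?thesis by (auto simp: gap_def)
  qed
  have data: "\<exists>p q c. ?data j b p q c" if "j < l" for j b
    using entry_code(2)[OF entry_indices(1)[OF that], of b]
      entry_code(2)[OF entry_indices(3)[OF that], of b] two_to_minus_1[of b]
    unfolding graph_iff by blast
  have gap_pos: "gap j b \<longleftrightarrow> (\<exists>p q c. ?data j b p q c \<and> ?small p q c)"
    and gap_neg: "\<not> gap j b \<longleftrightarrow> (\<exists>p q c. ?data j b p q c \<and> \<not> ?small p q c)"
    if j: "j < l" for j b
  proof -
    obtain p q c where d: "?data j b p q c" using data[OF j] by blast
    show "gap j b \<longleftrightarrow> (\<exists>p q c. ?data j b p q c \<and> ?small p q c)"
    proof
      assume "gap j b"
      then have "?small p q c" by (rule small[OF j d, THEN iffD2])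
      then show "\<exists>p q c. ?data j b p q c \<and> ?small p q c" using d by blast
    next
      assume "\<exists>p q c. ?data j b p q c \<and> ?small p q c"
      then obtain p q c where d: "?data j b p q c" and s: "?small p q c" by blast
      show "gap j b" by (rule small[OF j d, THEN iffD1, OF s])
    qed
    show "\<not> gap j b \<longleftrightarrow> (\<exists>p q c. ?data j b p q c \<and> \<not> ?small p q c)"
    proof
      assume g: "\<not> gap j b"
      have "\<not> ?small p q c" using g small[OF j d] by argo
      then show "\<exists>p q c. ?data j b p q c \<and> \<not> ?small p q c" using d by blast
    next
      assume "\<exists>p q c. ?data j b p q c \<and> \<not> ?small p q c"
      then obtain p q c where d: "?data j b p q c" and s: "\<not> ?small p q c" by blast
      show "\<not> gap j b" using s small[OF j d] by argo
    qed
  qed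
  show ?thesis
  proof (rule Delta1_comprehension)
    have pos: "(\<exists>j b. n = tpair j b \<and> j < l \<and> gap j b) \<longleftrightarrow>
      (\<exists>j b p q c. n = tpair j b \<and> j < l \<and> ?data j b p q c \<and> ?small p q c)" for n
      using gap_pos by (metis (no_types, lifting))
    show "Sigma1 (\<lambda>v. \<exists>j b. v 0 = tpair j b \<and> j < l \<and> gap j b)"
      unfolding pos unfolding ex_triple
      by (intro Sigma1_ex Sigma1_Delta0 definable P graph_Sets)
    have neg: "\<not> (\<exists>j b. n = tpair j b \<and> j < l \<and> gap j b) \<longleftrightarrow>
      \<not> (\<exists>j\<le>n. \<exists>b\<le>n. n = tpair j b \<and> j < l) \<or>
      (\<exists>j b p q c. n = tpair j b \<and> j < l \<and> ?data j b p q c \<and> \<not> ?small p q c)" (is "?L \<longleftrightarrow> ?R") for n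
    proof
      assume L: ?L
      show ?R
      proof (cases "\<exists>j b. n = tpair j b \<and> j < l")
        case True
        then obtain j b where n: "n = tpair j b" "j < l" by blast
        then have "\<not> gap j b" using L by blast
        then obtain p q c where "?data j b p q c" "\<not> ?small p q c" using gap_neg[OF n(2)] by blast
        then show ?thesis using n by blast
      qed blast
    next
      assume ?R
      then show ?L
      proof
        assume "\<not> (\<exists>j\<le>n. \<exists>b\<le>n. n = tpair j b \<and> j < l)"
        then show ?L using le_tpair1 le_tpair2 by blast
      next
        assume "\<exists>j b p q c. n = tpair j b \<and> j < l \<and> ?data j b p q c \<and> \<not> ?small p q c"
        then obtain j b p q c where n: "n = tpair j b" "j < l" "?data j b p q c" "\<not> ?small p q c"
          by blast
        then have "\<not> gap j b" using gap_neg[OF n(2)] by blast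
        then show ?L using n(1) by (metis tpair_inject)
      qed
    qed
    show "Sigma1 (\<lambda>v. \<not> (\<exists>j b. v 0 = tpair j b \<and> j < l \<and> gap j b))"
      unfolding neg unfolding ex_triple
      by (intro Sigma1_or Sigma1_ex Sigma1_Delta0 Delta0_not Delta0_bex_le definable P graph_Sets)
  qed
qed

text \<open>
  \<open>\<Sigma>\<^sub>1\<close> collection for the decidable predicate \<open>gap\<close>, which is monotone in \<open>b\<close>: the bounds for smaller \<open>j\<close>
  and for the next one are combined by their maximum.
\<close>

lemma uniform_gap: "\<exists>b. \<forall>j<l. gap j b"
proof -
  obtain G where G: "G \<in> Sets" "\<And>j b. tpair j b \<in> G \<longleftrightarrow> j < l \<and> gap j b" using gap_Sets by auto
  have "Sigma1 (\<lambda>v. \<exists>b. \<forall>j<v 0. j < l \<longrightarrow> tpair j b \<in> G)"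
    by (intro Sigma1_ex Sigma1_Delta0 Delta0_ball definable G(1))
  then have "\<exists>b. \<forall>j<l. j < l \<longrightarrow> tpair j b \<in> G"
  proof (rule Sigma1_induct)
    show "\<exists>b. \<forall>j<0. j < l \<longrightarrow> tpair j b \<in> G" using basic_axioms_model(7) by blast
  next
    fix n assume "\<exists>b. \<forall>j<n. j < l \<longrightarrow> tpair j b \<in> G"
    then obtain b where b: "\<And>j. j < n \<Longrightarrow> j < l \<Longrightarrow> gap j b" using G(2) by blast
    obtain b' where b': "n < l \<Longrightarrow> gap n b'" using gap_exists by blast
    have "gap j (max b b' + 1)" if j: "j < n + 1" "j < l" for j
    proof (cases "j = n")
      case True
      then show ?thesis using gap_mono[OF b', of "max b b' + 1"] j by simp
    next
      case False
      then have "j < n" using j by simp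
      then show ?thesis using gap_mono[OF b[of j], of "max b b' + 1"] j by simp
    qed
    then show "\<exists>b. \<forall>j<n + 1. j < l \<longrightarrow> tpair j b \<in> G" using G(2) by blast
  qed
  then show ?thesis using G(2) by blast
qed

text \<open>
  The virtual limit is within \<open>e / 4\<close> of \<open>r N\<close>, while neighbouring points are more than \<open>2 * e\<close> apart. Thus
  the decidable condition \<open>pt j N < r N + e\<close> holds for all points below the limit (\<open>near\<close>), and if it holds
  for a point, then the point before it is below the limit (\<open>far\<close>), so the point itself is by \<open>step\<close> (\<open>reach\<close>).
  This makes the condition inductive.
\<close>

lemma no_fine_partition: False
proof -
  obtain b where b: "\<And>j. j < l \<Longrightarrow> gap j b" using uniform_gap by blast
  define e where "e = E b"
  have e: "0 < e" by (simp add: e_def)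
  obtain K where K: "\<forall>m\<ge>K. \<forall>n\<ge>K. \<bar>r m - r n\<bar> \<le> e / 4" using r_cauchy[of "e / 4"] e by auto
  obtain K' where K': "\<forall>n\<ge>K'. E n < e / 8" using E_bound[of "e / 8"] e by auto
  define N where "N = max b (max K K')"
  have N: "b \<le> N" "K \<le> N" "E N < e / 8" using K' by (auto simp: N_def le_max_iff_disj)
  have close: "\<bar>r N - r n\<bar> \<le> e / 4" "i < l + l + 1 \<Longrightarrow> \<bar>x i N - x i n\<bar> \<le> E N" if "N \<le> n" for i n
    using K N that x(2)[of i] unfolding fast_def by (meson order_trans)+
  have near: "x i N < r N + e" if bl: "below (x i)" and il: "i < l + l + 1" for i
  proof -
    obtain \<epsilon> where \<epsilon>: "0 < \<epsilon>" "\<forall>\<^sub>F n in at_top. \<epsilon> \<le> r n - x i n" using bl unfolding below_def by blast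
    have "\<forall>\<^sub>F n in at_top. N \<le> n" by (rule eventually_ge_at_top)
    with \<epsilon>(2) have "\<forall>\<^sub>F n :: number in at_top. x i N < r N + e"
    proof eventually_elim
      case (elim n)
      then show ?case using close(1)[of n] close(2)[of n i] il N(3) \<epsilon>(1) e by linarith
    qed
    then show ?thesis using ev_witness by blast
  qed
  have far: "below (pt j)" if j: "j < l" and n: "pt (j + 1) N < r N + e" for j
  proof -
    have 1: "2 * e < pt (j + 1) N - pt j N"
      unfolding e_def by (rule gap_later[OF b[OF j] j N(1)])
    have "e / 2 \<le> r m - pt j m" if "N \<le> m" for m
      using close(1)[OF that] close(2)[OF that entry_indices(1)[OF j]] 1 n N(3) e by linarith
    then show ?thesis
      unfolding below_def eventually_at_top_linorder using e by (intro exI[of _ "e / 2"]) auto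
  qed
  have reach: "below (pt j)" if "j \<le> l" "j = 0 \<or> pt j N < r N + e" for j
  proof (cases "j = 0")
    case True
    then show ?thesis using below_0 by simp
  next
    case False
    then obtain i where i: "j = i + 1" using number_cases by blast
    then have "i < l" using that(1) by (metis linorder_not_less number_less_add_1)
    then show ?thesis using step[OF _ far] that(2) False i by simp
  qed
  obtain q where q: "val q = r N + e" by (rule val_surj)
  have less: "(\<exists>p. tpair (tpair (j + j) N) (tcode p) \<in> P \<and> val p < val q) \<longleftrightarrow> pt j N < r N + e"
    if "j \<le> l" for j
  proof -
    have "j + j < l + l + 1" using that by (simp add: add_mono number_less_add_1)
    then show ?thesis using entry_code[of "j + j" N] unfolding q by metis
  qed
  have "Sigma1 (\<lambda>v. l < v 0 \<or> (\<exists>p. tpair (tpair (v 0 + v 0) N) (tcode p) \<in> P \<and> val p < val q))"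
    unfolding ex_triple by (intro Sigma1_or Sigma1_ex Sigma1_Delta0 definable P)
  then have "l < l \<or> (\<exists>p. tpair (tpair (l + l) N) (tcode p) \<in> P \<and> val p < val q)"
  proof (rule Sigma1_induct)
    have "pt 0 N < r N + e" using near[OF below_0] by simp
    then show "l < 0 \<or> (\<exists>p. tpair (tpair (0 + 0) N) (tcode p) \<in> P \<and> val p < val q)"
      using less[of 0] by simp
  next
    fix j assume IH: "l < j \<or> (\<exists>p. tpair (tpair (j + j) N) (tcode p) \<in> P \<and> val p < val q)"
    show "l < j + 1 \<or> (\<exists>p. tpair (tpair ((j + 1) + (j + 1)) N) (tcode p) \<in> P \<and> val p < val q)"
    proof (cases "l < j + 1")
      case False
      then have j1: "j + 1 \<le> l" by (rule leI)
      then have j: "j < l" by (rule less_le_trans[rotated]) simp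
      then have "pt j N < r N + e" using IH less[of j] by auto
      then have "below (pt j)" using reach[of j] j by simp
      then have "pt (j + 1) N < r N + e" using near step[OF j] entry_indices(3)[OF j] by blast
      then show ?thesis using less[OF j1] by blast
    qed blast
  qed
  then have "below (pt l)" using less[of l] reach[of l] by simp
  then show False using not_below_1 by blast
qed

end

section \<open>From the model back to provability\<close>

theorem theorem7p2p2:
  shows "provable RCA0 (Imp CL_B1 SC)"
proof (rule ccontr)
  assume "\<not> provable RCA0 (Imp CL_B1 SC)"
  then have "Neg (Imp CL_B1 SC) \<in> H" by (rule H(4))
  then have "eval Sets (\<lambda>i. abs_number (Var i)) (\<lambda>i. extension (id i)) (Neg (Imp CL_B1 SC))"
    using truth[of Var id "Neg (Imp CL_B1 SC)"] by simp
  then have CL: "eval Sets (\<lambda>i. abs_number (Var i)) (\<lambda>i. extension (id i)) CL_B1"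
    and SC: "\<not> eval Sets (\<lambda>i. abs_number (Var i)) (\<lambda>i. extension (id i)) SC"
    by simp_all
  obtain Z where Z: "Z \<in> Sets" "sem_real_sequence Z" "\<And>n. sem_in_01 (sem_slice_seq Z n)"
    "sem_cauchy_seq Z" "\<And>Y. Y \<in> Sets \<Longrightarrow> sem_real_set Y \<Longrightarrow> \<not> sem_is_limit Z (sem_set_seq Y)"
    using SC unfolding eval_SC by blast
  have real: "sem_is_real (sem_slice_seq Z i)" for i
    using Z(2) unfolding sem_real_sequence_def by blast
  \<comment> \<open>The rate of convergence of a real mentions powers of two, so \<open>Z\<close> itself provides exponentiation.\<close>
  obtain q where "sem_slice_seq Z 0 0 q" using real[of 0] unfolding sem_is_real_def by blast
  then have "sem_inv_pow2 0 (\<lambda>e. val q \<le> val q + val e \<and> val q \<le> val q + val e)"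
    using real[of 0] unfolding sem_is_real_def by blast
  then have "\<exists>m. sem_pow2 0 m" unfolding sem_inv_pow2_def by blast
  then interpret powers by unfold_locales blast
  have "\<exists>z. \<forall>i. represents (sem_slice_seq Z i) (z i) \<and> fast (z i)"
    by (rule choice) (use real represents_real in blast)
  then obtain z where "\<And>i. represents (sem_slice_seq Z i) (z i)" "\<And>i. fast (z i)" by blast
  then interpret divergent Z z
    using Z(1) real Z(3-5) by unfold_locales
  obtain P l where P: "P \<in> Sets" "sem_tagged_partition P l" "sem_fine gauge P l"
    using CL gauge_Sets gauge_is_gauge unfolding eval_CL_B1 by blast
  have P_real: "i < l + l + 1 \<Longrightarrow> sem_is_real (sem_slice_seq P i)" for i
    using P(2) unfolding sem_tagged_partition_def sem_finite_real_sequence_def by blast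
  have "\<exists>x. \<forall>i. i < l + l + 1 \<longrightarrow> represents (sem_slice_seq P i) (x i) \<and> fast (x i)"
    by (rule choice) (use P_real represents_real in blast)
  then obtain x where "\<And>i. i < l + l + 1 \<Longrightarrow> represents (sem_slice_seq P i) (x i)"
    "\<And>i. i < l + l + 1 \<Longrightarrow> fast (x i)" by blast
  then interpret fine_partition Z z P l x using P by unfold_locales blast+
  show False by (rule no_fine_partition)
qed

end
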